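(* Consider the two-user real Gaussian MIMO interference channel with channel matrices $H_1,H_2,H_3,H_4$ and power constraints $P_1,P_2$ (see context), where $H_2$ and $H_4$ are square and invertible. If $H_2^TH_2\succeq H_4^TH_4$ and $H_3^TH_3\succeq H_1^TH_1$, then the capacity region is the union, over all symmetric positive semidefinite $S_1,S_2$ with $\mathrm{tr}(S_1)\le P_1$ and $\mathrm{tr}(S_2)\le P_2$, of the sets of pairs of nonnegative reals $(R_1,R_2)$ satisfying $$R_1\le\tfrac12\log\left|I+H_1S_1H_1^T\right|,\qquad R_2\le\tfrac12\log\left|I+H_4S_2H_4^T\right|,$$ $$R_1+R_2\le\tfrac12\log\left|I+H_1S_1H_1^T+H_2S_2H_2^T\right|,\qquad R_1+R_2\le\tfrac12\log\left|I+H_3S_1H_3^T+H_4S_2H_4^T\right| .$$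
   Context: Channel: at each use, $y_1=H_1x_1+H_2x_2+z_1$ and $y_2=H_3x_1+H_4x_2+z_2$, where $x_i$ is the real vector sent by transmitter $i$, $y_i$ is the vector seen by receiver $i$, the $H_j$ are fixed real matrices of compatible sizes known to all, and $z_1,z_2$ are Gaussian vectors with zero mean and identity covariance, independent of the inputs and i.i.d. over channel uses. A length-$n$ code with rates $(R_1,R_2)$: independent messages $m_i$ uniform on a set of size $\lceil e^{nR_i}\rceil$; transmitter $i$ maps $m_i$ to $(x_{i,1},\dots,x_{i,n})$ subject to the average power constraint $\frac1n\sum_{j=1}^nE\|x_{i,j}\|^2\le P_i$; receiver $i$ estimates $m_i$ from $(y_{i,1},\dots,y_{i,n})$ only. A pair of nonnegative rates is achievable if there are codes with error probabilities at both receivers tending to $0$ as $n\to\infty$; the capacity region is the closure of the set of achievable pairs. Notation: $|X|$ of a matrix is its determinant; $\log$ is natural; $A\succeq B$ means $A-B$ is positive semidefinite. *)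

theory Defs
  imports "HOL-Probability.Probability"
begin

definition pos_semidef :: "real^'n^'n \<Rightarrow> bool" where
  "pos_semidef A \<longleftrightarrow> transpose A = A \<and> (\<forall>v. 0 \<le> v \<bullet> (A *v v))"

definition loewner_ge :: "real^'n^'n \<Rightarrow> real^'n^'n \<Rightarrow> bool"  (infix "\<succeq>" 50) where
  "A \<succeq> B \<longleftrightarrow> pos_semidef (A - B)"

(* Zero mean and identity covariance: the density is exp (- |z|^2 / 2) / (2 pi)^(d/2) with
   d = CARD('n), written as the product of the densities of its coordinates. *)
definition std_gaussian :: "(real^'n) measure" where
  "std_gaussian = density lborel (\<lambda>z. ennreal (\<Prod>i\<in>UNIV. std_normal_density (z $ i)))"

(* N is the joint law of (z1, z2) in one channel use.  Only the two marginals are prescribed;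
   the dependence between the noises at the two receivers is arbitrary. *)
definition noise_law :: "((real^'r1) \<times> (real^'r2)) measure \<Rightarrow> bool" where
  "noise_law N \<longleftrightarrow> prob_space N \<and> sets N = sets borel \<and>
     distr N borel fst = std_gaussian \<and> distr N borel snd = std_gaussian"

definition messages :: "real \<Rightarrow> nat \<Rightarrow> nat set" where
  "messages R n = {..<nat \<lceil>exp (real n * R)\<rceil>}"

definition message_law :: "real \<Rightarrow> nat \<Rightarrow> nat pmf" where
  "message_law R n = pmf_of_set (messages R n)"

(* f m j is the vector sent in channel use j < n when the message is m. *)
definition power_constraint :: "real \<Rightarrow> real \<Rightarrow> nat \<Rightarrow> (nat \<Rightarrow> nat \<Rightarrow> real^'t) \<Rightarrow> bool" where
  "power_constraint P R n f \<longleftrightarrow>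
     1 / real n * (\<Sum>j<n. measure_pmf.expectation (message_law R n) (\<lambda>m. (norm (f m j))\<^sup>2)) \<le> P"

definition decoder :: "real \<Rightarrow> nat \<Rightarrow> ((nat \<Rightarrow> real^'r) \<Rightarrow> nat) \<Rightarrow> bool" where
  "decoder R n g \<longleftrightarrow> g \<in> measurable (\<Pi>\<^sub>M j\<in>{..<n}. borel) (count_space (messages R n))"

(* Joint law of ((m1, m2), z) over a block of n uses: independent uniform messages, independent
   of the noise pairs z j, which are i.i.d. with law N. *)
definition block_law ::
    "((real^'r1) \<times> (real^'r2)) measure \<Rightarrow> real \<Rightarrow> real \<Rightarrow> nat \<Rightarrow>
     ((nat \<times> nat) \<times> (nat \<Rightarrow> (real^'r1) \<times> (real^'r2))) measure" where
  "block_law N R1 R2 n =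
     measure_pmf (pair_pmf (message_law R1 n) (message_law R2 n)) \<Otimes>\<^sub>M (\<Pi>\<^sub>M j\<in>{..<n}. N)"

definition received ::
    "real^'t1^'r \<Rightarrow> real^'t2^'r \<Rightarrow> nat \<Rightarrow> (nat \<Rightarrow> real^'t1) \<Rightarrow> (nat \<Rightarrow> real^'t2) \<Rightarrow>
     (nat \<Rightarrow> real^'r) \<Rightarrow> (nat \<Rightarrow> real^'r)" where
  "received A B n x1 x2 z = (\<lambda>j\<in>{..<n}. A *v x1 j + B *v x2 j + z j)"

definition error1 ::
    "real^'t1^'r1 \<Rightarrow> real^'t2^'r1 \<Rightarrow> ((real^'r1) \<times> (real^'r2)) measure \<Rightarrow> real \<Rightarrow> real \<Rightarrow> nat \<Rightarrow>
     (nat \<Rightarrow> nat \<Rightarrow> real^'t1) \<Rightarrow> (nat \<Rightarrow> nat \<Rightarrow> real^'t2) \<Rightarrow> ((nat \<Rightarrow> real^'r1) \<Rightarrow> nat) \<Rightarrow> real" where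
  "error1 H1 H2 N R1 R2 n f1 f2 g1 =
     measure (block_law N R1 R2 n)
       {((m1, m2), z) \<in> space (block_law N R1 R2 n).
          g1 (received H1 H2 n (f1 m1) (f2 m2) (\<lambda>j. fst (z j))) \<noteq> m1}"

definition error2 ::
    "real^'t1^'r2 \<Rightarrow> real^'t2^'r2 \<Rightarrow> ((real^'r1) \<times> (real^'r2)) measure \<Rightarrow> real \<Rightarrow> real \<Rightarrow> nat \<Rightarrow>
     (nat \<Rightarrow> nat \<Rightarrow> real^'t1) \<Rightarrow> (nat \<Rightarrow> nat \<Rightarrow> real^'t2) \<Rightarrow> ((nat \<Rightarrow> real^'r2) \<Rightarrow> nat) \<Rightarrow> real" where
  "error2 H3 H4 N R1 R2 n f1 f2 g2 =
     measure (block_law N R1 R2 n)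
       {((m1, m2), z) \<in> space (block_law N R1 R2 n).
          g2 (received H3 H4 n (f1 m1) (f2 m2) (\<lambda>j. snd (z j))) \<noteq> m2}"

definition achievable ::
    "real^'t1^'r1 \<Rightarrow> real^'t2^'r1 \<Rightarrow> real^'t1^'r2 \<Rightarrow> real^'t2^'r2 \<Rightarrow>
     ((real^'r1) \<times> (real^'r2)) measure \<Rightarrow> real \<Rightarrow> real \<Rightarrow> real \<Rightarrow> real \<Rightarrow> bool" where
  "achievable H1 H2 H3 H4 N P1 P2 R1 R2 \<longleftrightarrow>
     0 \<le> R1 \<and> 0 \<le> R2 \<and>
     (\<exists>f1 f2 g1 g2.
        (\<forall>n>0. power_constraint P1 R1 n (f1 n) \<and> power_constraint P2 R2 n (f2 n) \<and>
               decoder R1 n (g1 n) \<and> decoder R2 n (g2 n)) \<and>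
        (\<lambda>n. error1 H1 H2 N R1 R2 n (f1 n) (f2 n) (g1 n)) \<longlonglongrightarrow> 0 \<and>
        (\<lambda>n. error2 H3 H4 N R1 R2 n (f1 n) (f2 n) (g2 n)) \<longlonglongrightarrow> 0)"

definition capacity_region ::
    "real^'t1^'r1 \<Rightarrow> real^'t2^'r1 \<Rightarrow> real^'t1^'r2 \<Rightarrow> real^'t2^'r2 \<Rightarrow>
     ((real^'r1) \<times> (real^'r2)) measure \<Rightarrow> real \<Rightarrow> real \<Rightarrow> (real \<times> real) set" where
  "capacity_region H1 H2 H3 H4 N P1 P2 =
     closure {(R1, R2). achievable H1 H2 H3 H4 N P1 P2 R1 R2}"

end

theory Submission
  imports Defs
begin

text \<open>Converse: because \<open>transpose H2 ** H2 \<succeq> transpose H4 ** H4\<close>, receiver 1, once it knows the first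
  message, can subtract its signal and degrade what is left to a copy of the output of receiver 2; so it
  decodes both messages, and likewise receiver 2. Hence every rate constraint follows from a
  point-to-point bound, in which the decoder is compared under the true law and under independent
  Gaussian outputs with the averaged covariance of the codewords; both sum rates come from the pair of
  messages. The maximising covariances converge along a subsequence by compactness.

  Achievability: Gaussian random codebooks and a likelihood-ratio threshold decoder that looks for one's
  own message jointly with some message of the interferer, without having to find the latter. The
  region is approached after shrinking the covariances slightly, which leaves slack in the power
  constraints and, by continuity of the determinants, in all the rate constraints.\<close>

section \<open>Positive semidefinite matrices\<close>

text \<open>\<open>noise_law\<close> fixes only the marginals of \<open>N\<close>, so no argument
  may use the joint law of the noises. \<open>average_error\<close> expresses each error probability
  through the noise of one receiver, and the degradation builds its own extra noise. The
  point-to-point bound is a change of measure, not a computation with entropies. The reference law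
  follows the mean of the codewords in each use but has one covariance \<open>S\<close> for all
  uses, the identity plus an average over messages and uses. With this choice the quadratic terms
  cancel in the mean and only \<open>ln (det S)\<close> remains; neither concavity of log det nor
  extremality of Gaussian entropy enters. For achievability one pair of codebooks must serve two
  receivers and two power constraints. Each requirement is expressed by a nonnegative function of
  the codebooks with small mean, and a draw is chosen at which their sum is small. Degenerate cases
  shape the statements: a user of rate 0 has a single message, and with zero power neither rate nor
  power has slack.\<close>

declare transpose_matrix_vector [simp del]

section \<open>Rank-one terms and factorisations of positive semidefinite matrices\<close>

definition outer :: "real^'n \<Rightarrow> real^'n^'n" where
  "outer a = (\<chi> i k. a $ i * a $ k)"

lemma outer_mult_vec: "outer a *v v = (a \<bullet> v) *\<^sub>R a"
  by (simp add: outer_def matrix_vector_mult_def vec_eq_iff inner_vec_def sum_distrib_left mult_ac)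

lemma transpose_outer [simp]: "transpose (outer a) = outer a"
  by (simp add: outer_def transpose_def vec_eq_iff mult.commute)

lemma transpose_add: "transpose (A + B) = transpose A + transpose (B :: real^'n^'m)"
  by (simp add: transpose_def vec_eq_iff)

lemma transpose_diff: "transpose (A - B) = transpose A - transpose (B :: real^'n^'m)"
  by (simp add: transpose_def vec_eq_iff)

lemma sum_matrix_vector_mult: "(\<Sum>i\<in>I. f i :: real^'n^'m) *v x = (\<Sum>i\<in>I. f i *v x)"
  by (induction I rule: infinite_finite_induct) (auto simp: matrix_vector_mult_add_rdistrib)

lemma symmetric_inner_commute:
  fixes A :: "real^'n^'n"
  assumes "transpose A = A"
  shows "u \<bullet> (A *v v) = v \<bullet> (A *v u)"
  by (metis assms dot_lmul_matrix inner_commute transpose_matrix_vector)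

lemma inner_matrix_transpose: "(A *v x) \<bullet> y = x \<bullet> (transpose A *v (y :: real^'m))"
  for A :: "real^'n^'m"
  by (metis dot_lmul_matrix inner_commute transpose_matrix_vector)

text \<open>The form evaluated at \<open>u + t *\<^sub>R v\<close> is a nonnegative quadratic
  polynomial in \<open>t\<close>, which bounds its discriminant. \<open>A\<close> may be singular,
  so a vanishing leading coefficient is treated separately.\<close>

lemma pos_semidef_cauchy_schwarz:
  assumes "pos_semidef A"
  shows "(u \<bullet> (A *v v))\<^sup>2 \<le> (u \<bullet> (A *v u)) * (v \<bullet> (A *v v))"
proof -
  define a b c where "a = v \<bullet> (A *v v)" and "b = u \<bullet> (A *v v)" and "c = u \<bullet> (A *v u)"
  have sym: "v \<bullet> (A *v u) = b"
    using assms symmetric_inner_commute unfolding pos_semidef_def b_def by metis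
  have q: "0 \<le> c + 2 * t * b + t * t * a" for t
  proof -
    have "0 \<le> (u + t *\<^sub>R v) \<bullet> (A *v (u + t *\<^sub>R v))"
      using assms unfolding pos_semidef_def by blast
    also have "\<dots> = c + 2 * t * b + t * t * a"
      by (simp add: matrix_vector_right_distrib matrix_vector_mult_scaleR inner_add_left
          inner_add_right sym algebra_simps flip: a_def b_def c_def)
    finally show ?thesis .
  qed
  show ?thesis
  proof (cases "a = 0")
    case True
    have "b = 0"
      \<comment> \<open>For \<open>b \<noteq> 0\<close> this \<open>t\<close> would make the now
        linear polynomial \<open>c + 2 * t * b\<close> equal to -1.\<close>
      using q[of "- (c + 1) / (2 * b)"] True by (cases "b = 0") (auto simp: field_simps)
    then show ?thesis using True by (simp add: a_def b_def)
  next
    case False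
    moreover have "0 \<le> a" using assms unfolding pos_semidef_def a_def by blast
    ultimately have "0 < a" by simp
    have "0 \<le> a * (c + 2 * (- b / a) * b + (- b / a) * (- b / a) * a)"
      using q[of "- b / a"] \<open>0 < a\<close> by (intro mult_nonneg_nonneg) auto
    also have "\<dots> = a * c - b\<^sup>2" using \<open>0 < a\<close> by (simp add: field_simps power2_eq_square)
    finally show ?thesis by (simp add: a_def b_def c_def mult.commute)
  qed
qed

text \<open>Symmetric Gaussian elimination: for each coordinate axis in turn a rank-one term is
  subtracted, chosen so that the remainder stays positive semidefinite and annihilates that axis.
  Once all axes are annihilated the remainder is 0. This gives a square root without eigenvalues,
  and the rank-one terms later carry an induction over Gaussian densities.\<close>

lemma pos_semidef_sum_outer:
  fixes S :: "real^'n^'n"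
  assumes "pos_semidef S"
  obtains g :: "'n \<Rightarrow> real^'n" where "S = (\<Sum>i\<in>UNIV. outer (g i))"
proof -
  have "\<exists>g. pos_semidef (S - (\<Sum>i\<in>F. outer (g i))) \<and>
      (\<forall>k\<in>F. (S - (\<Sum>i\<in>F. outer (g i))) *v axis k 1 = 0)" if "finite F" for F :: "'n set"
    using that
  proof (induction F)
    case empty
    then show ?case using assms by auto
  next
    case (insert k F)
    then obtain g :: "'n \<Rightarrow> real^'n" where g: "pos_semidef (S - (\<Sum>i\<in>F. outer (g i)))"
      "\<And>k. k \<in> F \<Longrightarrow> (S - (\<Sum>i\<in>F. outer (g i))) *v axis k 1 = 0" by blast
    define T where "T = S - (\<Sum>i\<in>F. outer (g i))"
    define e :: "real^'n" where "e = axis k 1"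
    define d where "d = e \<bullet> (T *v e)"
    \<comment> \<open>\<open>T - outer a\<close> is the Schur complement of the diagonal entry
      \<open>d\<close>. For \<open>d = 0\<close> Cauchy-Schwarz already gives
      \<open>T *v e = 0\<close>, and nothing has to be subtracted.\<close>
    define a where "a = (if d = 0 then 0 else (1 / sqrt d) *\<^sub>R (T *v e))"
    have T: "pos_semidef T" and TF: "\<And>k. k \<in> F \<Longrightarrow> T *v axis k 1 = 0"
      using g unfolding T_def by auto
    have sym: "u \<bullet> (T *v v) = v \<bullet> (T *v u)" for u v
      using T symmetric_inner_commute unfolding pos_semidef_def by blast
    have "d \<ge> 0" using T unfolding d_def pos_semidef_def by blast
    have zero: "T *v e = 0" if "d = 0"
    proof -
      have "(w \<bullet> (T *v e))\<^sup>2 \<le> 0" for w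
        using pos_semidef_cauchy_schwarz[OF T, of w e] that by (simp add: d_def)
      from this[of "T *v e"] show ?thesis by simp
    qed
    have av: "(a \<bullet> v) *\<^sub>R a = (if d = 0 then 0 else ((v \<bullet> (T *v e)) / d) *\<^sub>R (T *v e))" for v
      using \<open>d \<ge> 0\<close> by (simp add: a_def inner_commute)
    define T' where "T' = T - outer a"
    have mult: "T' *v v = T *v v - (if d = 0 then 0 else ((v \<bullet> (T *v e)) / d) *\<^sub>R (T *v e))" for v
      unfolding T'_def by (simp only: matrix_vector_mult_diff_rdistrib outer_mult_vec av)
    have "pos_semidef T'"
      unfolding pos_semidef_def
    proof (intro conjI allI)
      show "transpose T' = T'" using T unfolding T'_def pos_semidef_def by (simp add: transpose_diff)
      show "0 \<le> v \<bullet> (T' *v v)" for v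
      proof (cases "d = 0")
        case True
        then show ?thesis using T unfolding pos_semidef_def by (simp add: mult)
      next
        case False
        then have "(v \<bullet> (T *v e))\<^sup>2 / d \<le> v \<bullet> (T *v v)"
          using pos_semidef_cauchy_schwarz[OF T, of v e] \<open>d \<ge> 0\<close> by (simp add: d_def[symmetric] field_simps)
        then show ?thesis using False by (simp add: mult inner_diff_right power2_eq_square)
      qed
    qed
    moreover have "T' *v axis j 1 = 0" if "j \<in> insert k F" for j
    proof (cases "j = k")
      case True
      then show ?thesis using zero by (simp add: mult flip: e_def) (simp add: d_def)
    next
      case False
      then have "T *v axis j 1 = 0" using that TF by blast
      \<comment> \<open>By symmetry the coefficient \<open>axis j 1 \<bullet> (T *v e)\<close>
        vanishes as well, so axes annihilated earlier stay annihilated.\<close>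
      then show ?thesis using sym[of "axis j 1" e] by (simp add: mult)
    qed
    moreover have "T' = S - (\<Sum>i\<in>insert k F. outer ((g(k := a)) i))"
    proof -
      have "(\<Sum>i\<in>F. outer ((g(k := a)) i)) = (\<Sum>i\<in>F. outer (g i))"
        using insert by (intro sum.cong) auto
      then show ?thesis using insert by (simp add: T'_def T_def)
    qed
    ultimately show ?case by metis
  qed
  from this[of UNIV] obtain g :: "'n \<Rightarrow> real^'n" where g: "\<And>k. (S - (\<Sum>i\<in>UNIV. outer (g i))) *v axis k 1 = 0" by auto
  have "S - (\<Sum>i\<in>UNIV. outer (g i)) = 0"
    using g by (simp add: vec_eq_iff matrix_vector_mult_basis column_def)
  then show thesis using that by simp
qed

lemma sum_outer_columns: "A ** transpose A = (\<Sum>k\<in>UNIV. outer (column k A))"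
  for A :: "real^'m^'n"
  by (simp add: outer_def matrix_matrix_mult_def transpose_def column_def vec_eq_iff)

lemma pos_semidef_factor:
  fixes S :: "real^'n^'n"
  assumes "pos_semidef S"
  obtains G :: "real^'n^'n" where "S = G ** transpose G"
proof -
  obtain g :: "'n \<Rightarrow> real^'n" where g: "S = (\<Sum>i\<in>UNIV. outer (g i))" using pos_semidef_sum_outer[OF assms] .
  define G where "G = (\<chi> i k. g k $ i)"
  have "column k G = g k" for k by (simp add: G_def column_def vec_eq_iff)
  then show thesis using that[of G] by (simp add: g sum_outer_columns)
qed

lemma pos_semidef_gram: "pos_semidef (A ** transpose A)" for A :: "real^'m^'n"
proof -
  have "v \<bullet> ((A ** transpose A) *v v) = (transpose A *v v) \<bullet> (transpose A *v v)" for v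
    by (simp add: inner_matrix_transpose matrix_vector_mul_assoc)
  then show ?thesis by (simp add: pos_semidef_def matrix_transpose_mul)
qed

lemma pos_semidef_congruence:
  fixes A :: "real^'m^'n"
  assumes "pos_semidef S"
  shows "pos_semidef (A ** S ** transpose A)"
proof -
  obtain G :: "real^'m^'m" where G: "S = G ** transpose G" using pos_semidef_factor[OF assms] .
  have "A ** S ** transpose A = (A ** G) ** transpose (A ** G)"
    by (simp add: G matrix_transpose_mul matrix_mul_assoc)
  then show ?thesis by (simp only: pos_semidef_gram)
qed

lemma pos_semidef_add: "pos_semidef A \<Longrightarrow> pos_semidef B \<Longrightarrow> pos_semidef (A + B)"
  by (simp add: pos_semidef_def transpose_add matrix_vector_mult_add_rdistrib inner_add_right)

lemma pos_semidef_outer: "pos_semidef (outer a)"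
  by (simp add: pos_semidef_def outer_mult_vec inner_commute)

lemma pos_semidef_sum: "(\<And>i. i \<in> I \<Longrightarrow> pos_semidef (f i)) \<Longrightarrow> pos_semidef (\<Sum>i\<in>I. f i)"
proof (induction I rule: infinite_finite_induct)
  case (infinite A) then show ?case by (simp add: pos_semidef_def transpose_def vec_eq_iff)
next
  case empty then show ?case by (simp add: pos_semidef_def transpose_def vec_eq_iff)
next
  case (insert x F) then show ?case by (simp add: pos_semidef_add)
qed

lemma pos_semidef_scaleR: "pos_semidef A \<Longrightarrow> 0 \<le> c \<Longrightarrow> pos_semidef (c *\<^sub>R A)"
  by (simp add: pos_semidef_def transpose_def vec_eq_iff scaleR_matrix_vector_assoc[symmetric])

section \<open>Positive definite matrices and determinants of rank-one updates\<close>

definition pos_def :: "real^'n^'n \<Rightarrow> bool" where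
  "pos_def A \<longleftrightarrow> transpose A = A \<and> (\<forall>v. v \<noteq> 0 \<longrightarrow> 0 < v \<bullet> (A *v v))"

lemma pos_def_mat_1 [simp]: "pos_def (mat 1)"
  by (simp add: pos_def_def)

lemma pos_def_imp_semidef: "pos_def A \<Longrightarrow> pos_semidef A"
  by (simp add: pos_def_def pos_semidef_def) (metis inner_zero_left order.refl less_imp_le)

lemma pos_def_add: "pos_def A \<Longrightarrow> pos_semidef B \<Longrightarrow> pos_def (A + B)"
  by (simp add: pos_def_def pos_semidef_def transpose_add matrix_vector_mult_add_rdistrib
      inner_add_right add_pos_nonneg)

lemma pos_def_invertible: "pos_def A \<Longrightarrow> invertible A"
  unfolding pos_def_def invertible_left_inverse matrix_left_invertible_ker
  by (metis inner_zero_right less_irrefl)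

lemma matrix_inv_right: "invertible A \<Longrightarrow> A ** matrix_inv A = mat 1"
  and matrix_inv_left: "invertible A \<Longrightarrow> matrix_inv A ** A = mat 1"
  for A :: "real^'n^'n"
  unfolding matrix_inv_def invertible_def by (metis (mono_tags, lifting) someI_ex)+

lemma matrix_inv_unique:
  fixes A B :: "real^'n^'n"
  assumes "A ** B = mat 1"
  shows "matrix_inv A = B"
proof -
  have "invertible A" using assms invertible_right_inverse by blast
  then show ?thesis by (metis assms matrix_inv_left matrix_mul_assoc matrix_mul_lid matrix_mul_rid)
qed

lemma pos_def_factor:
  fixes S :: "real^'n^'n"
  assumes "pos_def S"
  obtains G :: "real^'n^'n" where "S = G ** transpose G" "invertible G"
proof -
  obtain G :: "real^'n^'n" where G: "S = G ** transpose G" using pos_semidef_factor pos_def_imp_semidef assms by blast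
  have "det S = (det G)\<^sup>2" by (simp add: G det_mul power2_eq_square)
  moreover have "det S \<noteq> 0" using assms pos_def_invertible invertible_det_nz by blast
  ultimately have "invertible G" by (auto simp: invertible_det_nz)
  then show thesis using that G by blast
qed

lemma pos_def_det: "pos_def S \<Longrightarrow> 0 < det S"
  by (metis pos_def_factor det_mul det_transpose invertible_det_nz zero_less_power2 power2_eq_square)

text \<open>Conjugation by an orthogonal matrix keeps the determinant. An orthogonal map between
  \<open>axis k (norm a)\<close> and \<open>a\<close> makes the matrix diagonal, with
  \<open>1 + a \<bullet> a\<close> in position \<open>k\<close> and 1 elsewhere.\<close>

lemma det_mat_1_plus_outer: "det (mat 1 + outer (a :: real^'n)) = 1 + a \<bullet> a"
proof -
  fix k :: 'n
  obtain f where f: "orthogonal_transformation f" "f (axis k (norm a)) = a"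
    using orthogonal_transformation_exists[of "axis k (norm a)" a]
    by (auto simp: norm_eq_sqrt_inner inner_axis_axis)
  define Q where "Q = matrix f"
  have Q: "orthogonal_matrix Q" and fQ: "f = (*v) Q"
    using f orthogonal_transformation_matrix[of f] unfolding Q_def
    by (auto simp: fun_eq_iff matrix_works linear_matrix_vector_mul_eq)
  define D :: "real^'n^'n" where "D = mat 1 + outer (axis k (norm a))"
  have QQ: "Q ** transpose Q = mat 1" using Q by (simp add: orthogonal_matrix_def)
  have "Q ** D ** transpose Q = mat 1 + outer a"
  proof -
    have "(Q ** D ** transpose Q) *v v = (mat 1 + outer a) *v v" for v
    proof -
      have "(Q ** D ** transpose Q) *v v = Q *v (D *v (transpose Q *v v))"
        by (simp flip: matrix_vector_mul_assoc)
      also have "D *v (transpose Q *v v) = transpose Q *v v + ((a \<bullet> v) *\<^sub>R axis k (norm a))"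
        using f(2) by (simp add: D_def matrix_vector_mult_add_rdistrib outer_mult_vec inner_matrix_transpose[symmetric] fQ)
      also have "Q *v \<dots> = v + (a \<bullet> v) *\<^sub>R a"
        using f(2) by (simp add: fQ matrix_vector_right_distrib matrix_vector_mul_assoc QQ matrix_vector_mult_scaleR)
      finally show ?thesis by (simp add: matrix_vector_mult_add_rdistrib outer_mult_vec)
    qed
    then show ?thesis by (simp add: matrix_eq)
  qed
  moreover have "det (Q ** D ** transpose Q) = det D"
  proof -
    have "det Q * det (transpose Q) = 1" using QQ by (metis det_I det_mul)
    then show ?thesis by (simp add: det_mul)
  qed
  moreover have "det D = 1 + a \<bullet> a"
  proof -
    have "D $ i $ j = 0" if "i \<noteq> j" for i j
      using that by (auto simp: D_def outer_def mat_def axis_def)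
    then have "det D = (\<Prod>i\<in>UNIV. D $ i $ i)" by (rule det_diagonal)
    also have "\<dots> = (\<Prod>i\<in>UNIV. if i = k then 1 + a \<bullet> a else 1)"
      by (intro prod.cong refl) (auto simp: D_def outer_def mat_def axis_def dot_square_norm power2_eq_square)
    finally show ?thesis by simp
  qed
  ultimately show ?thesis by simp
qed

text \<open>Matrix determinant lemma. With \<open>S = C ** transpose C\<close> and \<open>B\<close>
  the inverse of \<open>C\<close>, the congruence by \<open>C\<close> turns the update of the
  identity by \<open>B *v a\<close> into the update of \<open>S\<close> by \<open>a\<close>.\<close>

lemma det_add_outer:
  fixes S :: "real^'n^'n"
  assumes "pos_def S"
  shows "det (S + outer a) = det S * (1 + a \<bullet> (matrix_inv S *v a))"
proof -
  obtain C :: "real^'n^'n" where C: "S = C ** transpose C" "invertible C" using pos_def_factor[OF assms] .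
  obtain B :: "real^'n^'n" where B: "C ** B = mat 1" "B ** C = mat 1" using C(2) by (auto simp: invertible_def)
  have TB: "transpose B ** transpose C = mat 1" "transpose C ** transpose B = mat 1"
    using B by (metis matrix_transpose_mul transpose_mat)+
  have "C ** (mat 1 + outer (B *v a)) ** transpose C = S + outer a"
  proof -
    have "(C ** (mat 1 + outer (B *v a)) ** transpose C) *v v = (S + outer a) *v v" for v
    proof -
      have "(C ** (mat 1 + outer (B *v a)) ** transpose C) *v v
          = C *v (transpose C *v v + ((B *v a) \<bullet> (transpose C *v v)) *\<^sub>R (B *v a))"
        by (simp add: matrix_vector_mult_add_rdistrib outer_mult_vec flip: matrix_vector_mul_assoc)
      also have "\<dots> = S *v v + (a \<bullet> v) *\<^sub>R a"
        by (simp add: inner_matrix_transpose matrix_vector_mul_assoc TB matrix_vector_right_distrib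
            matrix_vector_mult_scaleR B C(1))
      finally show ?thesis by (simp add: matrix_vector_mult_add_rdistrib outer_mult_vec)
    qed
    then show ?thesis by (simp add: matrix_eq)
  qed
  then have "det (S + outer a) = det S * det (mat 1 + outer (B *v a))"
    by (metis (no_types, lifting) C(1) det_mul mult.commute mult.assoc)
  also have "\<dots> = det S * (1 + (B *v a) \<bullet> (B *v a))" by (simp add: det_mat_1_plus_outer)
  also have "(B *v a) \<bullet> (B *v a) = a \<bullet> (matrix_inv S *v a)"
  proof -
    have "matrix_inv S = transpose B ** B"
    proof (rule matrix_inv_unique)
      show "S ** (transpose B ** B) = mat 1"
        using B TB C(1) by (metis matrix_mul_assoc matrix_mul_lid)
    qed
    then show ?thesis by (simp add: inner_matrix_transpose matrix_vector_mul_assoc)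
  qed
  finally show ?thesis .
qed


section \<open>Contractions from the Loewner order\<close>

lemma contraction_transpose_gram:
  fixes K :: "real^'m^'n"
  assumes "\<And>x. norm (K *v x) \<le> norm x"
  shows "pos_semidef (mat 1 - K ** transpose K)"
  unfolding pos_semidef_def
proof (intro conjI allI)
  show "transpose (mat 1 - K ** transpose K) = mat 1 - K ** transpose K"
    by (simp add: transpose_diff matrix_transpose_mul transpose_mat)
next
  fix v
  \<comment> \<open>A matrix and its transpose have the same operator norm: Cauchy-Schwarz at this
    \<open>w\<close> bounds the square of \<open>norm w\<close> by \<open>norm v * norm w\<close>,
    and one factor cancels.\<close>
  define w where "w = transpose K *v v"
  have 1: "w \<bullet> w = v \<bullet> (K *v w)"
    unfolding w_def by (simp add: inner_matrix_transpose inner_commute)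
  also have "\<dots> \<le> norm v * norm (K *v w)" by (rule norm_cauchy_schwarz)
  also have "\<dots> \<le> norm v * norm w" by (intro mult_left_mono assms) auto
  finally have "norm w * norm w \<le> norm v * norm w" by (simp add: dot_square_norm power2_eq_square)
  then have "norm w \<le> norm v" by (cases "norm w = 0") auto
  then have "w \<bullet> w \<le> v \<bullet> v" by (simp add: dot_square_norm power2_eq_square mult_mono)
  then show "0 \<le> v \<bullet> ((mat 1 - K ** transpose K) *v v)"
    using 1 by (simp add: matrix_vector_mult_diff_rdistrib inner_diff_right w_def matrix_vector_mul_assoc)
qed

lemma loewner_ge_gram_iff:
  fixes A C :: "real^'m^'n"
  shows "transpose C ** C \<succeq> transpose A ** A \<longleftrightarrow> (\<forall>x. norm (A *v x) \<le> norm (C *v x))"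
proof -
  have sq: "x \<bullet> ((transpose M ** M) *v x) = (norm (M *v x))\<^sup>2" for M :: "real^'m^'n" and x
    by (simp add: matrix_vector_mul_assoc[symmetric] inner_matrix_transpose[symmetric] dot_square_norm)
  show ?thesis
    by (simp add: loewner_ge_def pos_semidef_def transpose_diff matrix_transpose_mul
        matrix_vector_mult_diff_rdistrib inner_diff_right sq)
qed

text \<open>The orthogonal projection, written in an orthonormal basis. It is symmetric and
  idempotent, so the square of \<open>norm (f y)\<close> is \<open>f y \<bullet> y\<close>, and
  Cauchy-Schwarz shows that norms do not grow.\<close>

lemma subspace_projection:
  fixes V :: "(real^'n) set"
  assumes "subspace V"
  obtains f where "linear f" "\<And>y. f y \<in> V" "\<And>y. y \<in> V \<Longrightarrow> f y = y" "\<And>y. norm (f y) \<le> norm y"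
proof -
  obtain B where B: "B \<subseteq> V" "pairwise orthogonal B" "\<And>x. x \<in> B \<Longrightarrow> norm x = 1"
    "independent B" "span B = V"
    using orthonormal_basis_subspace[OF assms] by metis
  have fin: "finite B" using B(4) independent_imp_finite by blast
  define f where "f y = (\<Sum>b\<in>B. (b \<bullet> y) *\<^sub>R b)" for y
  have lin: "linear f"
    unfolding f_def by (intro linearI) (simp_all add: inner_add_right scaleR_add_left sum.distrib scaleR_sum_right)
  have V: "f y \<in> V" for y
    unfolding f_def using B(1) assms by (intro subspace_sum subspace_scale) auto
  have fB: "f b = b" if "b \<in> B" for b
  proof -
    have "f b = (\<Sum>c\<in>B. if c = b then b else 0)"
      unfolding f_def
    proof (rule sum.cong[OF refl])
      fix c assume "c \<in> B"
      then show "(c \<bullet> b) *\<^sub>R c = (if c = b then b else 0)"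
        using B(2,3) that by (auto simp: dot_square_norm pairwise_def orthogonal_def)
    qed
    then show ?thesis using that fin by simp
  qed
  have id: "f y = y" if "y \<in> V" for y
    using linear_eq_on_span[OF lin linear_id, of B y] fB that B(5) by simp
  have sym: "f x \<bullet> y = x \<bullet> f y" for x y
    by (simp add: f_def inner_sum_left inner_sum_right inner_commute mult.commute)
  have "norm (f y) \<le> norm y" for y
  proof -
    have "norm (f y) * norm (f y) = f y \<bullet> y"
      using sym[of "f y" y] id[OF V[of y]] by (simp add: dot_square_norm flip: power2_eq_square)
    also have "\<dots> \<le> norm (f y) * norm y" by (rule norm_cauchy_schwarz)
    finally show ?thesis by (cases "norm (f y) = 0") auto
  qed
  then show thesis using that lin V id by blast
qed

text \<open>Douglas factorisation. As \<open>norm (A *v x) \<le> norm (C *v x)\<close>, the value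
  \<open>A *v x\<close> depends only on \<open>C *v x\<close>, and sending the latter to the former
  is a contraction on the range of \<open>C\<close>. Since \<open>C\<close> may be rectangular or
  singular, \<open>K\<close> first projects orthogonally onto that range. The second conclusion
  makes \<open>mat 1 - K ** transpose K\<close> a legitimate covariance for additional
  noise.\<close>

lemma loewner_ge_gram_factor:
  fixes A C :: "real^'m^'n"
  assumes "transpose C ** C \<succeq> transpose A ** A"
  obtains K :: "real^'n^'n" where "A = K ** C" "pos_semidef (mat 1 - K ** transpose K)"
proof -
  have le: "norm (A *v x) \<le> norm (C *v x)" for x using assms by (simp add: loewner_ge_gram_iff)
  define V where "V = range ((*v) C)"
  have V: "subspace V" unfolding V_def by (intro linear_subspace_image) auto
  obtain J where J: "linear J" "\<And>y. y \<in> V \<Longrightarrow> C *v (J y) = y"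
    using linear_exists_right_inverse_on[of "(*v) C" UNIV] unfolding V_def by auto
  obtain f where f: "linear f" "\<And>y. f y \<in> V" "\<And>y. y \<in> V \<Longrightarrow> f y = y" "\<And>y. norm (f y) \<le> norm y"
    using subspace_projection[OF V] by metis
  define K where "K = matrix (\<lambda>y. A *v J (f y))"
  have lin: "linear (\<lambda>y. A *v J (f y))"
    using linear_compose[OF linear_compose[OF f(1) J(1)] matrix_vector_mul_linear[of A]] by (simp add: o_def)
  have K: "K *v y = A *v J (f y)" for y
    unfolding K_def using lin by (simp add: matrix_works linear_matrix_vector_mul_eq)
  have "norm (K *v y) \<le> norm y" for y
    using le[of "J (f y)"] J(2)[OF f(2)[of y]] f(4)[of y] by (simp add: K)
  then have "pos_semidef (mat 1 - K ** transpose K)" by (rule contraction_transpose_gram)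
  moreover have "A = K ** C"
  proof -
    have "A *v x = (K ** C) *v x" for x
    proof -
      have CV: "C *v x \<in> V" by (auto simp: V_def)
      have "(K ** C) *v x = A *v J (C *v x)"
        by (simp add: K f(3)[OF CV] flip: matrix_vector_mul_assoc)
      \<comment> \<open>\<open>x - J (C *v x)\<close> lies in the kernel of \<open>C\<close>, hence
        by the norm inequality in that of \<open>A\<close>.\<close>
      moreover have "norm (A *v (x - J (C *v x))) \<le> norm (C *v (x - J (C *v x)))" by (rule le)
      then have "A *v (x - J (C *v x)) = 0"
        by (simp add: matrix_vector_mult_diff_distrib J(2)[OF CV])
      ultimately show ?thesis by (simp add: matrix_vector_mult_diff_distrib)
    qed
    then show ?thesis by (simp add: matrix_eq)
  qed
  ultimately show thesis using that by blast
qed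

section \<open>Compactness of the set of admissible covariances\<close>

lemma pos_semidef_entry_le_trace:
  assumes "pos_semidef S"
  shows "\<bar>S $ i $ j\<bar> \<le> trace S"
proof -
  have d: "axis i 1 \<bullet> (S *v axis j 1) = S $ i $ j" for i j
    by (simp add: matrix_vector_mult_basis column_def inner_axis')
  have nn: "0 \<le> S $ k $ k" for k
    using assms d[of k k] unfolding pos_semidef_def by metis
  have le: "S $ k $ k \<le> trace S" for k
    unfolding trace_def by (rule member_le_sum) (auto simp: nn)
  have "(S $ i $ j)\<^sup>2 \<le> (S $ i $ i) * (S $ j $ j)"
    using pos_semidef_cauchy_schwarz[OF assms, of "axis i 1" "axis j 1"] by (simp add: d)
  also have "\<dots> \<le> (trace S)\<^sup>2"
    unfolding power2_eq_square using nn le by (intro mult_mono) (auto intro: order_trans)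
  finally show ?thesis
    using nn le by (metis abs_le_square_iff abs_of_nonneg order_trans)
qed

lemma trace_pos_semidef_nonneg: "pos_semidef S \<Longrightarrow> 0 \<le> trace S"
  using pos_semidef_entry_le_trace abs_ge_zero order_trans by blast

lemma continuous_on_det [continuous_intros]:
  fixes f :: "'a::topological_space \<Rightarrow> real^'n^'n"
  assumes "continuous_on X f"
  shows "continuous_on X (\<lambda>x. det (f x))"
  unfolding det_def by (intro continuous_intros assms)

lemma continuous_on_matrix_mult [continuous_intros]:
  fixes f :: "'a::topological_space \<Rightarrow> real^'n^'m" and g :: "'a \<Rightarrow> real^'k^'n"
  assumes "continuous_on X f" "continuous_on X g"
  shows "continuous_on X (\<lambda>x. f x ** g x)"
  unfolding matrix_matrix_mult_def by (intro continuous_intros assms)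

lemma continuous_on_trace [continuous_intros]:
  fixes f :: "'a::topological_space \<Rightarrow> real^'n^'n"
  assumes "continuous_on X f"
  shows "continuous_on X (\<lambda>x. trace (f x))"
  unfolding trace_def by (intro continuous_intros assms)

lemma continuous_on_matrix_vector_mult [continuous_intros]:
  fixes f :: "'a::topological_space \<Rightarrow> real^'n^'m"
  assumes "continuous_on X f"
  shows "continuous_on X (\<lambda>x. f x *v v)"
  unfolding matrix_vector_mult_def by (intro continuous_intros assms)

lemma continuous_on_transpose [continuous_intros]:
  fixes f :: "'a::topological_space \<Rightarrow> real^'n^'m"
  assumes "continuous_on X f"
  shows "continuous_on X (\<lambda>x. transpose (f x))"
  unfolding transpose_def by (intro continuous_intros assms)

text \<open>Bounded because the trace dominates the absolute value of every entry, by nonnegativity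
  of the diagonal and of the 2 by 2 principal minors; closed because semidefiniteness is an
  intersection of closed conditions.\<close>

lemma compact_pos_semidef_trace: "compact {S :: real^'n^'n. pos_semidef S \<and> trace S \<le> P}"
proof -
  have "norm S \<le> real CARD('n) * (real CARD('n) * P)" if "pos_semidef S" "trace S \<le> P" for S :: "real^'n^'n"
  proof -
    have "norm S \<le> (\<Sum>i\<in>UNIV. norm (S $ i))" unfolding norm_vec_def by (rule L2_set_le_sum) auto
    also have "\<dots> \<le> (\<Sum>i\<in>(UNIV::'n set). \<Sum>j\<in>(UNIV::'n set). P)"
    proof (rule sum_mono)
      fix i
      have "norm (S $ i) \<le> (\<Sum>j\<in>UNIV. \<bar>S $ i $ j\<bar>)" by (rule norm_le_l1_cart)
      also have "\<dots> \<le> (\<Sum>j\<in>(UNIV::'n set). P)"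
        using pos_semidef_entry_le_trace[OF that(1)] that(2) by (intro sum_mono) (auto intro: order_trans)
      finally show "norm (S $ i) \<le> (\<Sum>j\<in>(UNIV::'n set). P)" .
    qed
    finally show ?thesis by simp
  qed
  then have "bounded {S :: real^'n^'n. pos_semidef S \<and> trace S \<le> P}" by (auto simp: bounded_iff)
  moreover have "closed {S :: real^'n^'n. pos_semidef S \<and> trace S \<le> P}"
    unfolding pos_semidef_def
    by (intro closed_Collect_conj closed_Collect_all closed_Collect_eq closed_Collect_le continuous_intros)
  ultimately show ?thesis by (simp add: compact_eq_bounded_closed)
qed

section \<open>Gaussian densities\<close>

lemma borel_measurable_matrix_vector_mult [measurable (raw)]:
  fixes A :: "real^'n^'m"
  assumes "f \<in> borel_measurable M"
  shows "(\<lambda>x. A *v f x) \<in> borel_measurable M"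
  using assms by (rule borel_measurable_continuous_on[rotated]) (simp add: linear_continuous_on)

lemma borel_measurable_nth [measurable (raw)]:
  fixes f :: "'a \<Rightarrow> real^'n"
  assumes "f \<in> borel_measurable M"
  shows "(\<lambda>x. f x $ i) \<in> borel_measurable M"
  using assms by (rule borel_measurable_continuous_on[rotated]) (intro continuous_intros)

definition gauss_density :: "real^'n^'n \<Rightarrow> real^'n \<Rightarrow> real" where
  "gauss_density S y = exp (- (y \<bullet> (matrix_inv S *v y)) / 2) / sqrt ((2 * pi) ^ CARD('n) * det S)"

lemma gauss_density_measurable [measurable]: "gauss_density S \<in> borel_measurable borel"
  unfolding gauss_density_def by measurable

lemma gauss_density_pos: "pos_def S \<Longrightarrow> 0 < gauss_density S y"
  by (simp add: gauss_density_def pos_def_det)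

lemma gauss_density_mat_1:
  "gauss_density (mat 1 :: real^'n^'n) y = (\<Prod>i\<in>UNIV. std_normal_density (y $ i))"
proof -
  have "(\<Prod>i\<in>UNIV. std_normal_density (y $ i))
      = (1 / sqrt (2 * pi)) ^ CARD('n) * exp (\<Sum>i\<in>UNIV. - (y $ i)\<^sup>2 / 2)"
    by (simp add: std_normal_density_def prod_dividef exp_sum power_one_over)
  moreover have "(\<Sum>i\<in>UNIV. - (y $ i)\<^sup>2 / 2) = - (y \<bullet> y) / 2"
    by (simp add: inner_vec_def power2_eq_square sum_negf sum_divide_distrib)
  moreover have "sqrt ((2 * pi) ^ CARD('n)) = (sqrt (2 * pi)) ^ CARD('n)"
    by (rule real_sqrt_power)
  ultimately show ?thesis
    by (simp add: gauss_density_def matrix_inv_unique power_one_over divide_simps)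
qed

lemma std_gaussian_eq: "std_gaussian = density lborel (\<lambda>z. ennreal (gauss_density (mat 1) z))"
  by (simp add: std_gaussian_def gauss_density_mat_1)

lemma sets_std_gaussian [simp, measurable_cong]: "sets std_gaussian = sets borel"
  by (simp add: std_gaussian_def)

lemma space_std_gaussian [simp]: "space std_gaussian = UNIV"
  by (simp add: std_gaussian_def)

text \<open>\<open>lborel\<close> on vectors is a product over \<open>Basis\<close>, the Gaussian
  weight a product over coordinate indices; \<open>SOME\<close> recovers the index of a basis vector
  and translates one product into the other.\<close>

lemma prod_vec_Basis:
  fixes z :: "real^'n" and h :: "'n \<Rightarrow> real \<Rightarrow> 'b::comm_monoid_mult"
  shows "(\<Prod>i\<in>UNIV. h i (z $ i)) = (\<Prod>b\<in>Basis. h (SOME i. b = axis i 1) (z \<bullet> b))"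
proof -
  have inj: "inj (\<lambda>i::'n. axis i (1::real))" by (auto simp: inj_def axis_eq_axis)
  have B: "(Basis :: (real^'n) set) = (\<lambda>i. axis i 1) ` UNIV" by (auto simp: Basis_vec_def)
  have "(SOME k. (axis i 1 :: real^'n) = axis k 1) = i" for i
    by (rule some_equality) (auto simp: axis_eq_axis)
  then show ?thesis unfolding B by (subst prod.reindex[OF inj]) (simp add: inner_axis)
qed

text \<open>Fubini over the coordinates: the Gaussian weight factorises, so moments of the vector
  reduce to one-dimensional ones.\<close>

lemma std_gaussian_integral_prod:
  fixes f :: "'n::finite \<Rightarrow> real \<Rightarrow> real"
  assumes f: "\<And>i. integrable lborel (\<lambda>x. std_normal_density x * f i x)"
    and [measurable]: "\<And>i. f i \<in> borel_measurable borel"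
  shows "integrable (std_gaussian :: (real^'n) measure) (\<lambda>z. \<Prod>i\<in>UNIV. f i (z $ i))" (is ?A)
    and "(\<integral>z. (\<Prod>i\<in>UNIV. f i (z $ i)) \<partial>(std_gaussian :: (real^'n) measure))
      = (\<Prod>i\<in>UNIV. \<integral>x. std_normal_density x * f i x \<partial>lborel)" (is ?B)
proof -
  interpret product_sigma_finite "\<lambda>_::real^'n. lborel :: real measure" ..
  define h where "h i x = std_normal_density x * f i x" for i x
  define k where "k b = h (SOME i. b = axis i 1)" for b :: "real^'n"
  have hm [measurable]: "h i \<in> borel_measurable borel" for i unfolding h_def by measurable
  have km [measurable]: "k i \<in> borel_measurable borel" for i unfolding k_def by measurable
  have k: "integrable lborel (k b)" for b unfolding k_def h_def using f by simp
  have eq: "(\<Prod>i\<in>UNIV. std_normal_density (z $ i)) * (\<Prod>i\<in>UNIV. f i (z $ i)) = (\<Prod>b\<in>Basis. k b (z \<bullet> b))"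
    for z :: "real^'n"
    unfolding k_def using prod_vec_Basis[of h z] by (simp add: h_def prod.distrib)
  have [simp]: "(\<Sum>b\<in>Basis. x b *\<^sub>R b) \<bullet> c = x c" if "c \<in> Basis" for c :: "real^'n" and x
    using that by (simp add: inner_sum_left inner_Basis if_distrib cong: if_cong)
  have eq2: "(\<Prod>b\<in>Basis. k b ((\<Sum>b\<in>Basis. x b *\<^sub>R b) \<bullet> b)) = (\<Prod>b\<in>Basis. k b (x b))" for x
    by (intro prod.cong) auto
  have int: "integrable (\<Pi>\<^sub>M b\<in>(Basis::(real^'n) set). lborel) (\<lambda>x. \<Prod>b\<in>Basis. k b (x b))"
    by (intro product_integrable_prod k) auto
  show ?A
    unfolding std_gaussian_def
    by (subst integrable_density) (simp_all add: eq prod_nonneg lborel_eq[where 'a="real^'n"] integrable_distr_eq eq2 int)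
  have "(\<integral>z. (\<Prod>i\<in>UNIV. f i (z $ i)) \<partial>(std_gaussian :: (real^'n) measure))
      = (\<integral>z. (\<Prod>b\<in>Basis. k b (z \<bullet> b)) \<partial>lborel)"
    unfolding std_gaussian_def
    by (subst integral_density) (simp_all add: eq prod_nonneg)
  also have "\<dots> = (\<integral>x. (\<Prod>b\<in>Basis. k b (x b)) \<partial>(\<Pi>\<^sub>M b\<in>(Basis::(real^'n) set). lborel))"
    by (subst lborel_eq) (simp add: integral_distr eq2)
  also have "\<dots> = (\<Prod>b\<in>(Basis::(real^'n) set). \<integral>x. k b x \<partial>lborel)"
    by (intro product_integral_prod k) auto
  also have "\<dots> = (\<Prod>i\<in>UNIV. \<integral>x. h i x \<partial>lborel)"
    unfolding k_def using prod_vec_Basis[of "\<lambda>i _. \<integral>x. h i x \<partial>lborel" undefined] by simp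
  finally show ?B by (simp add: h_def)
qed

lemma prob_space_std_gaussian [simp, intro]: "prob_space (std_gaussian :: (real^'n) measure)"
proof
  have "emeasure (std_gaussian :: (real^'n) measure) (space std_gaussian)
      = (\<integral>\<^sup>+z. (\<Prod>i\<in>UNIV. ennreal (std_normal_density (z $ i))) \<partial>(lborel :: (real^'n) measure))"
    by (simp add: std_gaussian_def emeasure_density prod_ennreal)
  also have "\<dots> = (\<integral>\<^sup>+z. (\<Prod>b\<in>Basis. ennreal (std_normal_density (z \<bullet> b))) \<partial>(lborel :: (real^'n) measure))"
    by (simp add: prod_vec_Basis[of "\<lambda>_ x. ennreal (std_normal_density x)"])
  also have "\<dots> = 1"
    by (subst nn_integral_lborel_prod) (simp_all add: nn_integral_eq_integral)
  finally show "emeasure (std_gaussian :: (real^'n) measure) (space std_gaussian) = 1" .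
qed

section \<open>Moments of the standard Gaussian vector\<close>

lemma integrable_std_normal_power: "integrable lborel (\<lambda>x. std_normal_density x * x ^ k)"
  by (rule integrable_std_normal_moment)

lemma std_gaussian_moment_2:
  shows "integrable (std_gaussian :: (real^'n) measure) (\<lambda>z. z $ i * z $ j)"
    and "(\<integral>z. z $ i * z $ j \<partial>(std_gaussian :: (real^'n) measure)) = (if i = j then 1 else 0)"
proof -
  \<comment> \<open>The two exponents add, so that the product over the coordinates is
    \<open>z $ i * z $ j\<close> whether or not the indices coincide.\<close>
  define f where "f k x = x ^ ((if k = i then 1 else 0) + (if k = j then 1 else 0))" for k :: 'n and x :: real
  have f: "(\<Prod>k\<in>UNIV. f k (z $ k)) = z $ i * z $ j" for z
    by (simp add: f_def power_add prod.distrib if_distrib[of "\<lambda>k. _ ^ k"] cong: if_cong)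
  have int: "integrable lborel (\<lambda>x. std_normal_density x * f k x)" for k
    unfolding f_def by (rule integrable_std_normal_power)
  have [measurable]: "f k \<in> borel_measurable borel" for k unfolding f_def by measurable
  show "integrable (std_gaussian :: (real^'n) measure) (\<lambda>z. z $ i * z $ j)"
    using std_gaussian_integral_prod(1)[of f, OF int] by (simp add: f)
  have m0: "(\<integral>x. std_normal_density x * x ^ 0 \<partial>lborel) = 1" by simp
  have m1: "(\<integral>x. std_normal_density x * x ^ 1 \<partial>lborel) = 0"
    using integral_std_normal_moment_odd[of 0] by simp
  have m2: "(\<integral>x. std_normal_density x * x ^ 2 \<partial>lborel) = 1"
    using integral_std_normal_moment_even[of 1] by (simp add: fact_numeral)
  have "(\<Prod>k\<in>UNIV. \<integral>x. std_normal_density x * f k x \<partial>lborel) = (if i = j then 1 else 0)"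
  proof (cases "i = j")
    case True
    have "(\<integral>x. std_normal_density x * f k x \<partial>lborel) = 1" for k
      using m0 m2 True by (simp add: f_def numeral_2_eq_2)
    then show ?thesis using True by simp
  next
    case False
    have "(\<integral>x. std_normal_density x * f i x \<partial>lborel) = 0"
      using m1 False by (simp add: f_def)
    then show ?thesis using False by (auto intro!: prod_zero)
  qed
  then show "(\<integral>z. z $ i * z $ j \<partial>(std_gaussian :: (real^'n) measure)) = (if i = j then 1 else 0)"
    using std_gaussian_integral_prod(2)[of f, OF int] by (simp add: f)
qed

lemma std_gaussian_moment_1:
  shows "integrable (std_gaussian :: (real^'n) measure) (\<lambda>z. z $ i)"
    and "(\<integral>z. z $ i \<partial>(std_gaussian :: (real^'n) measure)) = 0"
proof -
  define f where "f k x = x ^ (if k = i then 1 else 0)" for k :: 'n and x :: real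
  have f: "(\<Prod>k\<in>UNIV. f k (z $ k)) = z $ i" for z
    by (simp add: f_def if_distrib[of "\<lambda>k. _ ^ k"] cong: if_cong)
  have int: "integrable lborel (\<lambda>x. std_normal_density x * f k x)" for k
    unfolding f_def by (rule integrable_std_normal_power)
  have [measurable]: "f k \<in> borel_measurable borel" for k unfolding f_def by measurable
  show "integrable (std_gaussian :: (real^'n) measure) (\<lambda>z. z $ i)"
    using std_gaussian_integral_prod(1)[of f, OF int] by (simp add: f)
  have "(\<integral>x. std_normal_density x * f i x \<partial>lborel) = 0"
    using integral_std_normal_moment_odd[of 0] by (simp add: f_def)
  then have "(\<Prod>k\<in>UNIV. \<integral>x. std_normal_density x * f k x \<partial>lborel) = 0" by (auto intro!: prod_zero)
  then show "(\<integral>z. z $ i \<partial>(std_gaussian :: (real^'n) measure)) = 0"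
    using std_gaussian_integral_prod(2)[of f, OF int] by (simp add: f)
qed

text \<open>Quadratic forms are bounded by a multiple of \<open>(norm z)\<^sup>2\<close>; fourth
  moments therefore give them finite variance, on which the Chebyshev bounds rely.\<close>

lemma integrable_std_gaussian_norm4: "integrable (std_gaussian :: (real^'n) measure) (\<lambda>z. (norm z) ^ 4)"
proof -
  have int: "integrable (std_gaussian :: (real^'n) measure) (\<lambda>z. (z $ i)\<^sup>2 * (z $ j)\<^sup>2)" for i j
  proof -
    define f where "f k x = x ^ ((if k = i then 2 else 0) + (if k = j then 2 else 0))" for k :: 'n and x :: real
    have f: "(\<Prod>k\<in>UNIV. f k (z $ k)) = (z $ i)\<^sup>2 * (z $ j)\<^sup>2" for z
      by (simp add: f_def power_add prod.distrib if_distrib[of "\<lambda>k. _ ^ k"] cong: if_cong)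
    have "integrable lborel (\<lambda>x. std_normal_density x * f k x)" for k
      unfolding f_def by (rule integrable_std_normal_power)
    moreover have [measurable]: "f k \<in> borel_measurable borel" for k unfolding f_def by measurable
    ultimately show ?thesis using std_gaussian_integral_prod(1)[of f] by (simp add: f)
  qed
  have "(norm z) ^ 4 = (\<Sum>i\<in>UNIV. \<Sum>j\<in>UNIV. (z $ i)\<^sup>2 * (z $ j)\<^sup>2)" for z :: "real^'n"
  proof -
    have "(norm z) ^ 4 = (z \<bullet> z) * (z \<bullet> z)" by (simp add: dot_square_norm power2_eq_square power4_eq_xxxx)
    then show ?thesis by (simp add: inner_vec_def power2_eq_square sum_product)
  qed
  then show ?thesis using int by simp
qed

lemma std_gaussian_quadratic:
  fixes X :: "real^'n^'n"
  shows "integrable std_gaussian (\<lambda>z. z \<bullet> (X *v z))"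
    and "(\<integral>z. z \<bullet> (X *v z) \<partial>std_gaussian) = trace X"
proof -
  have eq: "z \<bullet> (X *v z) = (\<Sum>i\<in>UNIV. \<Sum>j\<in>UNIV. X $ i $ j * (z $ i * z $ j))" for z
    by (simp add: inner_vec_def matrix_vector_mult_def sum_distrib_left mult_ac)
  show "integrable std_gaussian (\<lambda>z. z \<bullet> (X *v z))"
    unfolding eq by (simp add: std_gaussian_moment_2(1))
  have "(\<integral>z. z \<bullet> (X *v z) \<partial>std_gaussian)
      = (\<Sum>i\<in>UNIV. \<Sum>j\<in>UNIV. X $ i $ j * (\<integral>z. z $ i * z $ j \<partial>(std_gaussian :: (real^'n) measure)))"
    unfolding eq by (simp add: integral_sum std_gaussian_moment_2(1))
  also have "\<dots> = trace X" by (simp add: std_gaussian_moment_2(2) trace_def if_distrib cong: if_cong)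
  finally show "(\<integral>z. z \<bullet> (X *v z) \<partial>std_gaussian) = trace X" .
qed

lemma std_gaussian_linear:
  fixes v :: "real^'n"
  shows "integrable std_gaussian (\<lambda>z. v \<bullet> z)" and "(\<integral>z. v \<bullet> z \<partial>std_gaussian) = 0"
  by (simp_all add: inner_vec_def integral_sum std_gaussian_moment_1)

section \<open>Convolution of Gaussian densities\<close>

lemma nn_integral_lborel_translate:
  fixes f :: "'a::euclidean_space \<Rightarrow> ennreal"
  assumes [measurable]: "f \<in> borel_measurable borel"
  shows "(\<integral>\<^sup>+x. f (c + x) \<partial>lborel) = (\<integral>\<^sup>+x. f x \<partial>lborel)"
  by (subst (2) lborel_distr_plus[of c, symmetric]) (simp add: nn_integral_distr)

text \<open>The density after an independent one-dimensional Gaussian along \<open>a\<close> has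
  been added. This rank-one case can be computed outright, since \<open>det_add_outer\<close>
  supplies the determinant; it carries the induction that normalises
  \<open>gauss_density\<close>.\<close>

lemma gauss_density_add_outer:
  fixes S :: "real^'n^'n"
  assumes S: "pos_def S"
  shows "(\<integral>\<^sup>+w. ennreal (std_normal_density w * gauss_density S (v - w *\<^sub>R a)) \<partial>lborel)
    = ennreal (gauss_density (S + outer a) v)"
proof -
  define S' where "S' = S + outer a"
  have S': "pos_def S'" unfolding S'_def by (intro pos_def_add S pos_semidef_outer)
  note inv = matrix_inv_right[OF pos_def_invertible[OF S]] matrix_inv_left[OF pos_def_invertible[OF S]]
    matrix_inv_right[OF pos_def_invertible[OF S']] matrix_inv_left[OF pos_def_invertible[OF S']]
  have sym: "x \<bullet> (S *v y) = y \<bullet> (S *v x)" for x y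
    using S symmetric_inner_commute unfolding pos_def_def by blast
  define u where "u = matrix_inv S' *v v"
  \<comment> \<open>If \<open>v\<close> is the sum of \<open>w *\<^sub>R a\<close> and an
    independent Gaussian of covariance \<open>S\<close>, then \<open>t\<close> is the conditional
    mean of \<open>w\<close> given \<open>v\<close>, and \<open>1 / kappa\<close> its conditional
    variance. Completing the square around \<open>t\<close> separates \<open>v\<close> from
    \<open>w\<close>.\<close>
  define t where "t = a \<bullet> u"
  define b where "b = matrix_inv S *v a"
  define kappa where "kappa = 1 + a \<bullet> b"
  have v: "v = S *v u + t *\<^sub>R a"
  proof -
    have "v = S' *v u" by (simp add: u_def matrix_vector_mul_assoc inv)
    then show ?thesis by (simp add: S'_def matrix_vector_mult_add_rdistrib outer_mult_vec t_def)
  qed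
  have Sb: "S *v b = a" by (simp add: b_def matrix_vector_mul_assoc inv)
  have Sub: "(S *v u) \<bullet> b = t" by (metis Sb inner_commute sym t_def)
  have k: "0 < kappa"
  proof -
    have "a \<bullet> b = b \<bullet> (S *v b)" by (simp add: Sb inner_commute)
    moreover have "0 \<le> b \<bullet> (S *v b)" using pos_def_imp_semidef[OF S] by (simp add: pos_semidef_def)
    ultimately show ?thesis by (simp add: kappa_def)
  qed
  have det: "det S' = det S * kappa"
    using det_add_outer[OF S, of a] by (simp add: S'_def kappa_def b_def)
  have expo: "w\<^sup>2 + (v - w *\<^sub>R a) \<bullet> (matrix_inv S *v (v - w *\<^sub>R a)) = v \<bullet> u + (w - t)\<^sup>2 * kappa" for w
  proof -
    have 1: "v - w *\<^sub>R a = S *v u + (t - w) *\<^sub>R a" by (simp add: v algebra_simps)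
    have 2: "matrix_inv S *v (v - w *\<^sub>R a) = u + (t - w) *\<^sub>R b"
      by (simp add: 1 matrix_vector_right_distrib matrix_vector_mult_scaleR matrix_vector_mul_assoc inv b_def)
    have 3: "a \<bullet> u = t" "a \<bullet> b = kappa - 1" by (simp_all add: t_def kappa_def)
    have 4: "v \<bullet> u = (S *v u) \<bullet> u + t * t" by (subst v) (simp add: inner_add_left 3)
    show ?thesis
      unfolding 1 2[unfolded 1] 4
      by (simp add: inner_add_left inner_add_right Sub 3 algebra_simps power2_eq_square)
  qed
  define \<sigma> where "\<sigma> = 1 / sqrt kappa"
  have \<sigma>: "0 < \<sigma>" "\<sigma>\<^sup>2 = 1 / kappa" using k by (auto simp: \<sigma>_def power_divide)
  have pt: "std_normal_density w * gauss_density S (v - w *\<^sub>R a) = gauss_density S' v * normal_density t \<sigma> w" for w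
  proof -
    have "std_normal_density w * gauss_density S (v - w *\<^sub>R a)
        = exp (- (w\<^sup>2 + (v - w *\<^sub>R a) \<bullet> (matrix_inv S *v (v - w *\<^sub>R a))) / 2)
          / (sqrt (2 * pi) * sqrt ((2 * pi) ^ CARD('n) * det S))"
      by (simp add: std_normal_density_def gauss_density_def exp_add[symmetric] add_divide_distrib)
    also have "\<dots> = exp (- (v \<bullet> u) / 2) * exp (- (w - t)\<^sup>2 * kappa / 2)
          / (sqrt (2 * pi) * sqrt ((2 * pi) ^ CARD('n) * det S))"
      unfolding expo by (simp add: exp_add[symmetric] add_divide_distrib)
    also have "\<dots> = gauss_density S' v * normal_density t \<sigma> w"
      using k pos_def_det[OF S]
      by (simp add: gauss_density_def normal_density_def u_def \<sigma>(2) det real_sqrt_mult real_sqrt_divide)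
    finally show ?thesis .
  qed
  have "(\<integral>\<^sup>+w. ennreal (std_normal_density w * gauss_density S (v - w *\<^sub>R a)) \<partial>lborel)
      = (\<integral>\<^sup>+w. ennreal (gauss_density S' v) * ennreal (normal_density t \<sigma> w) \<partial>lborel)"
    unfolding pt using gauss_density_pos[OF S'] by (simp add: ennreal_mult' less_imp_le)
  also have "\<dots> = ennreal (gauss_density S' v)"
    using \<sigma>(1) by (simp add: nn_integral_cmult nn_integral_eq_integral)
  finally show ?thesis by (simp add: S'_def)
qed

text \<open>Induction on the rank-one terms of \<open>P\<close>, starting from the standard
  Gaussian: by \<open>gauss_density_add_outer\<close> each further term is a convolution, which
  preserves the total mass.\<close>

lemma nn_integral_gauss_density:
  fixes P :: "real^'n^'n"
  assumes "pos_semidef P"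
  shows "(\<integral>\<^sup>+v. ennreal (gauss_density (mat 1 + P) v) \<partial>lborel) = 1"
proof -
  obtain g :: "'n \<Rightarrow> real^'n" where g: "P = (\<Sum>i\<in>UNIV. outer (g i))" using pos_semidef_sum_outer[OF assms] .
  have "(\<integral>\<^sup>+v. ennreal (gauss_density (mat 1 + (\<Sum>i\<in>F. outer (g i))) v) \<partial>lborel) = 1" if "finite F" for F
    using that
  proof (induction F)
    case empty
    interpret prob_space "std_gaussian :: (real^'n) measure" by simp
    show ?case using emeasure_space_1 by (simp add: std_gaussian_eq emeasure_density)
  next
    case (insert i F)
    define S where "S = mat 1 + (\<Sum>i\<in>F. outer (g i))"
    have S: "pos_def S" unfolding S_def by (intro pos_def_add pos_semidef_sum pos_semidef_outer) auto
    have "(\<integral>\<^sup>+v. ennreal (gauss_density (S + outer (g i)) v) \<partial>lborel)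
        = (\<integral>\<^sup>+v. \<integral>\<^sup>+w. ennreal (std_normal_density w * gauss_density S (v - w *\<^sub>R g i)) \<partial>lborel \<partial>lborel)"
      by (simp add: gauss_density_add_outer[OF S])
    also have "\<dots> = (\<integral>\<^sup>+w. \<integral>\<^sup>+v. ennreal (std_normal_density w * gauss_density S (v - w *\<^sub>R g i)) \<partial>lborel \<partial>lborel)"
      by (rule lborel_pair.Fubini') measurable
    also have "\<dots> = (\<integral>\<^sup>+w. ennreal (std_normal_density w) * (\<integral>\<^sup>+v. ennreal (gauss_density S (- (w *\<^sub>R g i) + v)) \<partial>lborel) \<partial>lborel)"
      by (simp add: ennreal_mult' nn_integral_cmult)
    also have "\<dots> = (\<integral>\<^sup>+w. ennreal (std_normal_density w) \<partial>lborel)"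
      using insert by (subst nn_integral_lborel_translate) (simp_all add: S_def)
    also have "\<dots> = 1" by (simp add: nn_integral_eq_integral)
    finally show ?case using insert by (simp add: S_def add.assoc add.commute[of "outer (g i)"])
  qed
  from this[of UNIV] show ?thesis by (simp add: g)
qed

lemma nn_integral_gauss_density_shift:
  fixes P :: "real^'n^'n"
  assumes "pos_semidef P"
  shows "(\<integral>\<^sup>+v. ennreal (gauss_density (mat 1 + P) (v - c)) \<partial>lborel) = 1"
proof -
  have "(\<integral>\<^sup>+v. ennreal (gauss_density (mat 1 + P) (- c + v)) \<partial>lborel) = 1"
    by (subst nn_integral_lborel_translate[of "\<lambda>v. ennreal (gauss_density (mat 1 + P) v)"])
      (simp_all add: nn_integral_gauss_density assms)
  then show ?thesis by simp
qed

lemma nn_integral_std_gaussian: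
  assumes [measurable]: "f \<in> borel_measurable borel"
  shows "(\<integral>\<^sup>+z. f z \<partial>std_gaussian) = (\<integral>\<^sup>+z. ennreal (gauss_density (mat 1) z) * f z \<partial>lborel)"
  unfolding std_gaussian_eq by (simp add: nn_integral_density)

text \<open>Completing the square shows that the left-hand side is a multiple of the right-hand side;
  both are probability densities, so the factor is 1 and no determinant has to be computed.\<close>

lemma nn_integral_gauss_density_convolution:
  fixes A :: "real^'m^'n" and P :: "real^'n^'n"
  assumes P: "pos_semidef P"
  shows "(\<integral>\<^sup>+w. ennreal (gauss_density (mat 1 + P) (v - A *v w)) \<partial>std_gaussian)
    = ennreal (gauss_density (mat 1 + P + A ** transpose A) v)"
proof -
  define S where "S = mat 1 + P"
  define S' where "S' = S + A ** transpose A"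
  have S: "pos_def S" unfolding S_def by (intro pos_def_add P) auto
  have S': "pos_def S'" unfolding S'_def by (intro pos_def_add S pos_semidef_gram)
  note inv = matrix_inv_right[OF pos_def_invertible[OF S]] matrix_inv_left[OF pos_def_invertible[OF S]]
    matrix_inv_right[OF pos_def_invertible[OF S']] matrix_inv_left[OF pos_def_invertible[OF S']]
  have sym: "x \<bullet> (S *v y) = y \<bullet> (S *v x)" for x y
    using S symmetric_inner_commute unfolding pos_def_def by blast
  define q where "q w = (A *v w) \<bullet> (matrix_inv S *v (A *v w)) + w \<bullet> w" for w
  define c where "c = sqrt ((2 * pi) ^ CARD('n) * det S') / (sqrt ((2 * pi) ^ CARD('n) * det S)
    * sqrt ((2 * pi) ^ CARD('m)))"
  have c: "0 \<le> c" using pos_def_det[OF S] pos_def_det[OF S'] by (simp add: c_def)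
  have pt: "gauss_density (mat 1) (transpose A *v (matrix_inv S' *v v) + w)
      * gauss_density S (v - A *v (transpose A *v (matrix_inv S' *v v) + w))
    = gauss_density S' v * (c * exp (- q w / 2))" for v w
  proof -
    define u where "u = matrix_inv S' *v v"
    \<comment> \<open>As in the rank-one case, \<open>t\<close> is the conditional mean of the
      Gaussian input given the output \<open>v\<close>; after a shift by it the exponent is a
      function of \<open>v\<close> plus a function of \<open>w\<close>.\<close>
    define t where "t = transpose A *v u"
    have v: "v = S *v u + A *v t"
    proof -
      have "v = S' *v u" by (simp add: u_def matrix_vector_mul_assoc inv)
      then show ?thesis by (simp add: S'_def matrix_vector_mult_add_rdistrib t_def matrix_vector_mul_assoc)
    qed
    have 1: "v - A *v (t + w) = S *v u - A *v w" by (simp add: v matrix_vector_right_distrib)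
    have 2: "matrix_inv S *v (S *v u - A *v w) = u - matrix_inv S *v (A *v w)"
      by (simp add: matrix_vector_mult_diff_distrib matrix_vector_mul_assoc inv)
    have 3: "(S *v u) \<bullet> (matrix_inv S *v (A *v w)) = u \<bullet> (A *v w)"
      by (metis sym inner_commute inv(1) matrix_vector_mul_assoc matrix_vector_mul_lid)
    have 4: "(A *v w) \<bullet> u = t \<bullet> w" "u \<bullet> (A *v w) = t \<bullet> w" "(A *v t) \<bullet> u = t \<bullet> t"
      using inner_matrix_transpose[of A _ u] by (simp_all add: t_def inner_commute)
    have expo: "(t + w) \<bullet> (t + w) + (v - A *v (t + w)) \<bullet> (matrix_inv S *v (v - A *v (t + w))) = v \<bullet> u + q w"
    proof -
      have "v \<bullet> u = (S *v u) \<bullet> u + t \<bullet> t" by (subst v) (simp add: inner_add_left 4)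
      then show ?thesis
        unfolding 1 2 q_def
        by (simp add: inner_add_left inner_add_right inner_diff_left inner_diff_right 3 4 inner_commute[of w t])
    qed
    have "gauss_density (mat 1) (t + w) * gauss_density S (v - A *v (t + w))
      = exp (- ((t + w) \<bullet> (t + w) + (v - A *v (t + w)) \<bullet> (matrix_inv S *v (v - A *v (t + w)))) / 2)
        / (sqrt ((2 * pi) ^ CARD('n) * det S) * sqrt ((2 * pi) ^ CARD('m)))"
      by (simp add: gauss_density_def matrix_inv_unique exp_add[symmetric] add_divide_distrib mult.commute)
    also have "\<dots> = gauss_density S' v * (c * exp (- q w / 2))"
      unfolding expo using pos_def_det[OF S]  pos_def_det[OF S']
      by (simp add: gauss_density_def u_def c_def add_divide_distrib exp_add[symmetric])
    finally show ?thesis by (simp add: t_def u_def)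
  qed
  define C where "C = (\<integral>\<^sup>+w. ennreal (c * exp (- q w / 2)) \<partial>(lborel :: (real^'m) measure))"
  have [measurable]: "q \<in> borel_measurable borel" unfolding q_def by measurable
  have main: "(\<integral>\<^sup>+w. ennreal (gauss_density S (v - A *v w)) \<partial>std_gaussian) = ennreal (gauss_density S' v) * C" for v
  proof -
    define t where "t = transpose A *v (matrix_inv S' *v v)"
    have "(\<integral>\<^sup>+w. ennreal (gauss_density S (v - A *v w)) \<partial>std_gaussian)
        = (\<integral>\<^sup>+w. ennreal (gauss_density (mat 1) w * gauss_density S (v - A *v w)) \<partial>lborel)"
      by (simp add: nn_integral_std_gaussian ennreal_mult' less_imp_le gauss_density_pos)
    also have "\<dots> = (\<integral>\<^sup>+w. ennreal (gauss_density (mat 1) (t + w) * gauss_density S (v - A *v (t + w))) \<partial>lborel)"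
      by (subst nn_integral_lborel_translate[of "\<lambda>w. ennreal (gauss_density (mat 1) w * gauss_density S (v - A *v w))"])
        simp_all
    also have "\<dots> = (\<integral>\<^sup>+w. ennreal (gauss_density S' v) * ennreal (c * exp (- q w / 2)) \<partial>lborel)"
      unfolding t_def pt using c gauss_density_pos[OF S'] by (simp add: ennreal_mult' less_imp_le)
    finally show ?thesis by (simp add: C_def nn_integral_cmult)
  qed
  have S'_eq: "S' = mat 1 + (P + A ** transpose A)" by (simp add: S'_def S_def add.assoc)
  interpret G: prob_space "std_gaussian :: (real^'m) measure" by simp
  interpret L: sigma_finite_measure "std_gaussian :: (real^'m) measure" by unfold_locales
  interpret pair_sigma_finite lborel "std_gaussian :: (real^'m) measure" ..
  have "C = (\<integral>\<^sup>+v. ennreal (gauss_density S' v) * C \<partial>lborel)"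
    unfolding S'_eq
    by (subst nn_integral_multc) (simp_all add: nn_integral_gauss_density pos_semidef_add P pos_semidef_gram)
  also have "\<dots> = (\<integral>\<^sup>+v. \<integral>\<^sup>+w. ennreal (gauss_density S (v - A *v w)) \<partial>(std_gaussian :: (real^'m) measure) \<partial>lborel)"
    by (simp add: main)
  also have "\<dots> = (\<integral>\<^sup>+w. \<integral>\<^sup>+v. ennreal (gauss_density S (v - A *v w)) \<partial>lborel \<partial>(std_gaussian :: (real^'m) measure))"
    by (rule Fubini'[symmetric]) measurable
  also have "\<dots> = 1"
    using G.emeasure_space_1 by (simp add: S_def nn_integral_gauss_density_shift P)
  finally have "C = 1" .
  then show ?thesis using main[of v] by (simp add: S_def S'_def)
qed

text \<open>Closed sets generate the Borel sets and are stable under intersection, and the indicator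
  of a nonempty closed set is the limit of the clipped functions
  \<open>max 0 (1 - real k * infdist x C)\<close>, which are continuous with values between 0 and
  1.\<close>

lemma measure_eqI_bounded_continuous:
  fixes M N :: "'a::metric_space measure"
  assumes "prob_space M" "prob_space N" and sets [simp, measurable_cong]: "sets M = sets borel" "sets N = sets borel"
    and eq: "\<And>f :: 'a \<Rightarrow> real. continuous_on UNIV f \<Longrightarrow> (\<And>x. 0 \<le> f x) \<Longrightarrow> (\<And>x. f x \<le> 1) \<Longrightarrow>
      (\<integral>x. f x \<partial>M) = (\<integral>x. f x \<partial>N)"
  shows "M = N"
proof -
  interpret M: prob_space M by fact
  interpret N: prob_space N by fact
  have [simp]: "space M = UNIV" "space N = UNIV" using sets_eq_imp_space_eq[OF sets(1)] sets_eq_imp_space_eq[OF sets(2)] by auto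
  have closed: "measure M C = measure N C" if C: "closed C" "C \<noteq> {}" for C
  proof -
    define f where "f k x = max 0 (1 - real k * infdist x C)" for k x
    have cont: "continuous_on UNIV (f k)" for k
      unfolding f_def by (intro continuous_intros)
    have b: "0 \<le> f k x" "f k x \<le> 1" for k x by (auto simp: f_def infdist_nonneg)
    have [measurable]: "f k \<in> borel_measurable borel" for k
      using cont by (rule borel_measurable_continuous_onI)
    have [measurable]: "C \<in> sets borel" using C by simp
    have lim: "(\<lambda>k. f k x) \<longlonglongrightarrow> indicator C x" for x
    proof (cases "x \<in> C")
      case True
      then show ?thesis by (simp add: f_def)
    next
      case False
      then have pos: "0 < infdist x C"
        using C in_closed_iff_infdist_zero infdist_nonneg by (metis less_eq_real_def)
      obtain K where K: "1 / infdist x C < real K" using reals_Archimedean2 by blast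
      have "f k x = 0" if "K \<le> k" for k
      proof -
        have "1 / infdist x C \<le> real k" using K that by (meson less_imp_le of_nat_mono order_trans)
        then show ?thesis using pos by (simp add: f_def field_simps)
      qed
      then have "eventually (\<lambda>k. f k x = 0) sequentially" using eventually_sequentially by blast
      then show ?thesis using False by (simp add: tendsto_eventually)
    qed
    have "(\<lambda>k. \<integral>x. f k x \<partial>M) \<longlonglongrightarrow> (\<integral>x. indicator C x \<partial>M)"
      by (rule integral_dominated_convergence[where w = "\<lambda>_. 1"]) (use lim b in auto)
    moreover have "(\<lambda>k. \<integral>x. f k x \<partial>N) \<longlonglongrightarrow> (\<integral>x. indicator C x \<partial>N)"
      by (rule integral_dominated_convergence[where w = "\<lambda>_. 1"]) (use lim b in auto)
    moreover have "(\<integral>x. f k x \<partial>M) = (\<integral>x. f k x \<partial>N)" for k by (intro eq cont b)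
    ultimately have "(\<integral>x. indicator C x \<partial>M) = (\<integral>x. indicator C x \<partial>N :: real)"
      by (simp add: LIMSEQ_unique)
    then show ?thesis by simp
  qed
  show ?thesis
  proof (rule measure_eqI_generator_eq[where E = "Collect closed" and \<Omega> = UNIV and A = "\<lambda>_. UNIV"])
    show "Int_stable (Collect closed)" by (auto simp: Int_stable_def)
    show "emeasure M X = emeasure N X" if "X \<in> Collect closed" for X
      using closed[of X] that by (cases "X = {}") (simp_all add: M.emeasure_eq_measure N.emeasure_eq_measure)
    show "sets M = sigma_sets UNIV (Collect closed)" "sets N = sigma_sets UNIV (Collect closed)"
      by (simp_all add: borel_eq_closed)
  qed auto
qed

text \<open>Plays the part of the uniqueness theorem for characteristic functions. By hypothesis
  \<open>s *\<^sub>R y\<close> plus standard Gaussian noise has the same density under both laws.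
  Dividing by \<open>s > 0\<close>, the laws of \<open>y\<close> plus noise of scale
  \<open>1 / s\<close> agree, and letting \<open>s\<close> tend to infinity removes the
  noise.\<close>

lemma measure_eqI_gauss_density:
  fixes M N :: "(real^'n) measure"
  assumes "prob_space M" "prob_space N" and sets [simp, measurable_cong]: "sets M = sets borel" "sets N = sets borel"
    and eq: "\<And>s v. (\<integral>\<^sup>+y. ennreal (gauss_density (mat 1) (v - s *\<^sub>R y)) \<partial>M)
       = (\<integral>\<^sup>+y. ennreal (gauss_density (mat 1) (v - s *\<^sub>R y)) \<partial>N)"
  shows "M = N"
proof (rule measure_eqI_bounded_continuous)
  fix f :: "real^'n \<Rightarrow> real"
  assume f: "continuous_on UNIV f" "\<And>x. 0 \<le> f x" "\<And>x. f x \<le> 1"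
  have [measurable]: "f \<in> borel_measurable borel" using f by (intro borel_measurable_continuous_onI)
  let ?G = "std_gaussian :: (real^'n) measure"
  interpret G: prob_space ?G by simp
  have smooth: "(\<integral>\<^sup>+p. ennreal (f (fst p + snd p /\<^sub>R s)) \<partial>(L \<Otimes>\<^sub>M ?G))
      = (\<integral>\<^sup>+v. ennreal (f (v /\<^sub>R s)) * (\<integral>\<^sup>+y. ennreal (gauss_density (mat 1) (v - s *\<^sub>R y)) \<partial>L) \<partial>lborel)"
    if "prob_space L" and [measurable_cong]: "sets L = sets borel" and s: "s > 0" for L s
  proof -
    interpret L: prob_space L by fact
    interpret pair_prob_space L ?G ..
    interpret LL: pair_sigma_finite L "lborel :: (real^'n) measure" ..
    have "(\<integral>\<^sup>+p. ennreal (f (fst p + snd p /\<^sub>R s)) \<partial>(L \<Otimes>\<^sub>M ?G))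
        = (\<integral>\<^sup>+y. \<integral>\<^sup>+z. ennreal (f (y + z /\<^sub>R s)) \<partial>?G \<partial>L)"
      by (subst G.nn_integral_fst[symmetric]) simp_all
    also have "\<dots> = (\<integral>\<^sup>+y. \<integral>\<^sup>+z. ennreal (gauss_density (mat 1) z) * ennreal (f (y + z /\<^sub>R s)) \<partial>lborel \<partial>L)"
      by (simp add: nn_integral_std_gaussian)
    also have "\<dots> = (\<integral>\<^sup>+y. \<integral>\<^sup>+v. ennreal (gauss_density (mat 1) (v - s *\<^sub>R y)) * ennreal (f (v /\<^sub>R s)) \<partial>lborel \<partial>L)"
    proof (rule nn_integral_cong)
      fix y
      have "(\<integral>\<^sup>+v. ennreal (gauss_density (mat 1) (v - s *\<^sub>R y)) * ennreal (f (v /\<^sub>R s)) \<partial>lborel)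
         = (\<integral>\<^sup>+z. ennreal (gauss_density (mat 1) (s *\<^sub>R y + z - s *\<^sub>R y)) * ennreal (f ((s *\<^sub>R y + z) /\<^sub>R s)) \<partial>lborel)"
        by (subst nn_integral_lborel_translate[of "\<lambda>v. ennreal (gauss_density (mat 1) (v - s *\<^sub>R y)) * ennreal (f (v /\<^sub>R s))"])
          simp_all
      also have "\<dots> = (\<integral>\<^sup>+z. ennreal (gauss_density (mat 1) z) * ennreal (f (y + z /\<^sub>R s)) \<partial>lborel)"
        using s by (simp add: scaleR_add_right)
      finally show "(\<integral>\<^sup>+z. ennreal (gauss_density (mat 1) z) * ennreal (f (y + z /\<^sub>R s)) \<partial>lborel)
        = (\<integral>\<^sup>+v. ennreal (gauss_density (mat 1) (v - s *\<^sub>R y)) * ennreal (f (v /\<^sub>R s)) \<partial>lborel)" ..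
    qed
    also have "\<dots> = (\<integral>\<^sup>+v. \<integral>\<^sup>+y. ennreal (gauss_density (mat 1) (v - s *\<^sub>R y)) * ennreal (f (v /\<^sub>R s)) \<partial>L \<partial>lborel)"
      by (rule LL.Fubini'[symmetric]) measurable
    also have "\<dots> = (\<integral>\<^sup>+v. ennreal (f (v /\<^sub>R s)) * (\<integral>\<^sup>+y. ennreal (gauss_density (mat 1) (v - s *\<^sub>R y)) \<partial>L) \<partial>lborel)"
      by (subst nn_integral_multc) (simp_all add: mult.commute)
    finally show ?thesis .
  qed
  have lim: "(\<lambda>k. \<integral>p. f (fst p + snd p /\<^sub>R real (Suc k)) \<partial>(L \<Otimes>\<^sub>M ?G)) \<longlonglongrightarrow> (\<integral>x. f x \<partial>L)"
    if "prob_space L" and [measurable_cong]: "sets L = sets borel" for L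
  proof -
    interpret L: prob_space L by fact
    interpret pair_prob_space L ?G ..
    have "(\<lambda>k. \<integral>p. f (fst p + snd p /\<^sub>R real (Suc k)) \<partial>(L \<Otimes>\<^sub>M ?G)) \<longlonglongrightarrow> (\<integral>p. f (fst p) \<partial>(L \<Otimes>\<^sub>M ?G))"
    proof (rule integral_dominated_convergence[where w = "\<lambda>_. 1"])
      show "AE p in L \<Otimes>\<^sub>M ?G. (\<lambda>k. f (fst p + snd p /\<^sub>R real (Suc k))) \<longlonglongrightarrow> f (fst p)"
      proof (rule AE_I2)
        fix p :: "(real^'n) \<times> (real^'n)"
        have "(\<lambda>k. fst p + snd p /\<^sub>R real (Suc k)) \<longlonglongrightarrow> fst p + 0 *\<^sub>R snd p"
          by (intro tendsto_intros LIMSEQ_inverse_real_of_nat)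
        then show "(\<lambda>k. f (fst p + snd p /\<^sub>R real (Suc k))) \<longlonglongrightarrow> f (fst p)"
          using f(1) by (auto intro: isCont_tendsto_compose simp: continuous_on_eq_continuous_at)
      qed
    qed (use f in auto)
    moreover have "(\<integral>p. f (fst p) \<partial>(L \<Otimes>\<^sub>M ?G)) = (\<integral>x. f x \<partial>L)"
      using G.distr_pair_fst[of L] integral_distr[of fst "L \<Otimes>\<^sub>M ?G" L f] by simp
    ultimately show ?thesis by simp
  qed
  have "(\<integral>p. f (fst p + snd p /\<^sub>R real (Suc k)) \<partial>(M \<Otimes>\<^sub>M ?G)) = (\<integral>p. f (fst p + snd p /\<^sub>R real (Suc k)) \<partial>(N \<Otimes>\<^sub>M ?G))" for k
    using smooth[OF assms(1) sets(1), of "real (Suc k)"] smooth[OF assms(2) sets(2), of "real (Suc k)"]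
    by (simp add: integral_eq_nn_integral f(2) eq)
  then show "(\<integral>x. f x \<partial>M) = (\<integral>x. f x \<partial>N)"
    using lim[OF assms(1) sets(1)] lim[OF assms(2) sets(2)] by (simp add: LIMSEQ_unique)
qed (use assms in auto)

text \<open>The matrix with the two blocks \<open>K\<close> and \<open>L\<close> side by side has
  orthonormal rows, so it maps a standard Gaussian pair to a standard Gaussian vector. By the
  smoothing criterion two convolutions suffice: both sides end with covariance \<open>mat 1\<close>
  plus \<open>s * s\<close> times \<open>mat 1\<close>.\<close>

lemma distr_std_gaussian_rows_orthonormal:
  fixes K L :: "real^'n^'n"
  assumes KL: "K ** transpose K + L ** transpose L = mat 1"
  shows "distr (std_gaussian \<Otimes>\<^sub>M std_gaussian) borel (\<lambda>(z, z'). K *v z + L *v z') = std_gaussian" (is "?D = _")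
proof (rule measure_eqI_gauss_density)
  let ?G = "std_gaussian :: (real^'n) measure"
  interpret G: prob_space ?G by simp
  interpret pair_prob_space ?G ?G ..
  have gram: "(s *\<^sub>R A) ** transpose (s *\<^sub>R A) = (s * s) *\<^sub>R (A ** transpose A)" for s and A :: "real^'n^'n"
    by (simp add: transpose_scalar scalar_matrix_assoc matrix_scalar_ac scalar_mult_eq_scaleR[symmetric])
  show "prob_space ?D" by (rule prob_space_distr) measurable
  show "(\<integral>\<^sup>+y. ennreal (gauss_density (mat 1) (v - s *\<^sub>R y)) \<partial>?D)
      = (\<integral>\<^sup>+y. ennreal (gauss_density (mat 1) (v - s *\<^sub>R y)) \<partial>?G)" for s v
  proof -
    have zero: "pos_semidef (0 :: real^'n^'n)" by (simp add: pos_semidef_def transpose_def vec_eq_iff)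
    have "(\<integral>\<^sup>+y. ennreal (gauss_density (mat 1) (v - s *\<^sub>R y)) \<partial>?D)
        = (\<integral>\<^sup>+z. \<integral>\<^sup>+z'. ennreal (gauss_density (mat 1) (v - s *\<^sub>R (K *v z + L *v z'))) \<partial>?G \<partial>?G)"
      by (subst nn_integral_distr) (simp_all add: G.nn_integral_fst[symmetric])
    also have "\<dots> = (\<integral>\<^sup>+z. \<integral>\<^sup>+z'. ennreal (gauss_density (mat 1 + 0) ((v - (s *\<^sub>R K) *v z) - (s *\<^sub>R L) *v z')) \<partial>?G \<partial>?G)"
      by (simp add: scaleR_add_right scaleR_matrix_vector_assoc[symmetric] diff_diff_eq)
    also have "\<dots> = (\<integral>\<^sup>+z. ennreal (gauss_density (mat 1 + (s *\<^sub>R L) ** transpose (s *\<^sub>R L)) (v - (s *\<^sub>R K) *v z)) \<partial>?G)"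
      using nn_integral_gauss_density_convolution[OF zero, of _ "s *\<^sub>R L"] by simp
    also have "\<dots> = ennreal (gauss_density (mat 1 + (s *\<^sub>R L) ** transpose (s *\<^sub>R L) + (s *\<^sub>R K) ** transpose (s *\<^sub>R K)) v)"
      by (rule nn_integral_gauss_density_convolution[OF pos_semidef_gram])
    also have "(s *\<^sub>R L) ** transpose (s *\<^sub>R L) + (s *\<^sub>R K) ** transpose (s *\<^sub>R K) = (s *\<^sub>R mat 1) ** transpose (s *\<^sub>R mat 1)"
      unfolding gram using KL by (simp add: scaleR_add_right[symmetric] add.commute transpose_mat)
    then have "mat 1 + (s *\<^sub>R L) ** transpose (s *\<^sub>R L) + (s *\<^sub>R K) ** transpose (s *\<^sub>R K)
      = mat 1 + 0 + (s *\<^sub>R mat 1) ** transpose (s *\<^sub>R mat 1)" by (simp add: add.assoc)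
    also have "ennreal (gauss_density (mat 1 + 0 + (s *\<^sub>R mat 1) ** transpose (s *\<^sub>R mat 1)) v)
      = (\<integral>\<^sup>+y. ennreal (gauss_density (mat 1) (v - s *\<^sub>R y)) \<partial>?G)"
      using nn_integral_gauss_density_convolution[OF zero, of v "s *\<^sub>R mat 1"]
      by (simp add: scaleR_matrix_vector_assoc[symmetric])
    finally show ?thesis .
  qed
qed auto

section \<open>A Fano inequality for Gaussian noise\<close>

abbreviation gblock :: "nat \<Rightarrow> (nat \<Rightarrow> real^'r) measure" where
  "gblock n \<equiv> \<Pi>\<^sub>M j\<in>{..<n}. std_gaussian"

lemma prob_space_gblock [simp, intro]: "prob_space (gblock n)"
  by (intro prob_space_PiM) simp

lemma sets_gblock [measurable_cong]: "sets (gblock n) = sets (\<Pi>\<^sub>M j\<in>{..<n}. borel)"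
  by (intro sets_PiM_cong) auto

lemma gblock_component:
  fixes f :: "real^'r \<Rightarrow> real"
  assumes j: "j < n" and f: "integrable std_gaussian f"
  shows "integrable (gblock n) (\<lambda>z. f (z j))" "(\<integral>z. f (z j) \<partial>gblock n) = (\<integral>x. f x \<partial>std_gaussian)"
proof -
  have d: "distr (gblock n) std_gaussian (\<lambda>z :: nat \<Rightarrow> real^'r. z j) = std_gaussian"
    using j by (intro distr_PiM_component) auto
  have [measurable]: "(\<lambda>z. z j) \<in> measurable (gblock n) (std_gaussian :: (real^'r) measure)"
    using j by (intro measurable_component_singleton) simp
  have [measurable]: "f \<in> borel_measurable std_gaussian" using f by auto
  show "integrable (gblock n) (\<lambda>z. f (z j))"
    using f by (subst (asm) d[symmetric]) (simp add: integrable_distr_eq)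
  show "(\<integral>z. f (z j) \<partial>gblock n) = (\<integral>x. f x \<partial>std_gaussian)"
    by (subst (2) d[symmetric]) (simp add: integral_distr)
qed

definition codeword_mean :: "'m set \<Rightarrow> ('m \<Rightarrow> nat \<Rightarrow> real^'r) \<Rightarrow> nat \<Rightarrow> real^'r" where
  "codeword_mean I s j = (1 / real (card I)) *\<^sub>R (\<Sum>m\<in>I. s m j)"

text \<open>The mean is removed in each use separately, while the average runs over messages and
  uses. Averaging over the uses yields one covariance for the whole block, to which the log
  determinant is applied once.\<close>

definition codeword_cov :: "'m set \<Rightarrow> nat \<Rightarrow> ('m \<Rightarrow> nat \<Rightarrow> real^'r) \<Rightarrow> real^'r^'r" where
  "codeword_cov I n s = (1 / (real (card I) * real n)) *\<^sub>R
     (\<Sum>m\<in>I. \<Sum>j<n. outer (s m j - codeword_mean I s j))"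

lemma pos_semidef_codeword_cov: "pos_semidef (codeword_cov I n s)"
  unfolding codeword_cov_def by (intro pos_semidef_scaleR pos_semidef_sum pos_semidef_outer) auto

lemma inner_matrix_outer: "d \<bullet> (X *v d) = trace (X ** outer d)"
  by (simp add: outer_def trace_def matrix_matrix_mult_def matrix_vector_mult_def inner_vec_def
      sum_distrib_left mult_ac)

lemma trace_mult_scaleR_sum:
  fixes X :: "real^'n^'n"
  shows "trace (X ** (c *\<^sub>R (\<Sum>i\<in>I. f i))) = c * (\<Sum>i\<in>I. trace (X ** f i))"
  by (induction I rule: infinite_finite_induct)
    (simp_all add: matrix_add_ldistrib trace_add scaleR_add_right distrib_left trace_def
      matrix_matrix_mult_def sum_distrib_left mult_ac sum.distrib)

lemma trace_mult_codeword_cov: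
  fixes X :: "real^'r^'r"
  assumes "finite I" "I \<noteq> {}" "0 < n"
  shows "(\<Sum>m\<in>I. \<Sum>j<n. (s m j - codeword_mean I s j) \<bullet> (X *v (s m j - codeword_mean I s j)))
    = real (card I) * real n * trace (X ** codeword_cov I n s)"
proof -
  have "codeword_cov I n s = (1 / (real (card I) * real n)) *\<^sub>R
     (\<Sum>p\<in>I \<times> {..<n}. outer (s (fst p) (snd p) - codeword_mean I s (snd p)))"
    unfolding codeword_cov_def by (simp add: sum.cartesian_product split_def)
  then have "trace (X ** codeword_cov I n s) = (1 / (real (card I) * real n)) *
    (\<Sum>p\<in>I \<times> {..<n}. trace (X ** outer (s (fst p) (snd p) - codeword_mean I s (snd p))))"
    by (simp only: trace_mult_scaleR_sum)
  then show ?thesis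
    using assms by (simp add: inner_matrix_outer sum.cartesian_product split_def)
qed

lemma ln_gauss_density:
  fixes S :: "real^'n^'n"
  assumes "pos_def S"
  shows "ln (gauss_density S y) = - (y \<bullet> (matrix_inv S *v y)) / 2 - ln ((2 * pi) ^ CARD('n) * det S) / 2"
  using pos_def_det[OF assms] by (simp add: gauss_density_def ln_div ln_sqrt)

lemma ln_gauss_density_ratio:
  fixes S :: "real^'n^'n" and z :: "real^'n"
  assumes "pos_def S"
  shows "ln (gauss_density S y / gauss_density (mat 1) z) = - (y \<bullet> (matrix_inv S *v y)) / 2 + z \<bullet> z / 2 - ln (det S) / 2"
proof -
  have "ln (gauss_density S y / gauss_density (mat 1) z) = ln (gauss_density S y) - ln (gauss_density (mat 1) z)"
    using gauss_density_pos[OF assms, of y] gauss_density_pos[OF pos_def_mat_1, of z] by (simp add: ln_div)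
  then show ?thesis
    using pos_def_det[OF assms]
    by (simp add: ln_gauss_density assms matrix_inv_unique ln_mult add_divide_distrib)
qed

lemma std_gaussian_quadratic_shift:
  fixes X :: "real^'n^'n"
  shows "integrable std_gaussian (\<lambda>z. (d + z) \<bullet> (X *v (d + z)))"
    and "(\<integral>z. (d + z) \<bullet> (X *v (d + z)) \<partial>std_gaussian) = d \<bullet> (X *v d) + trace X"
proof -
  interpret prob_space "std_gaussian :: (real^'n) measure" by simp
  have eq: "(d + z) \<bullet> (X *v (d + z)) = d \<bullet> (X *v d) + (transpose X *v d) \<bullet> z + (X *v d) \<bullet> z + z \<bullet> (X *v z)" for z
    using inner_matrix_transpose[of "transpose X" d z]
    by (simp add: matrix_vector_right_distrib inner_add_left inner_add_right inner_commute)
  show "integrable std_gaussian (\<lambda>z. (d + z) \<bullet> (X *v (d + z)))"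
    unfolding eq by (intro Bochner_Integration.integrable_add std_gaussian_linear std_gaussian_quadratic) simp
  show "(\<integral>z. (d + z) \<bullet> (X *v (d + z)) \<partial>std_gaussian) = d \<bullet> (X *v d) + trace X"
    unfolding eq by (simp add: std_gaussian_linear std_gaussian_quadratic prob_space[simplified])
qed

text \<open>As a function of the noise, the quotient is the density of the reference output law with
  mean \<open>c\<close> relative to the true output law with signal \<open>a\<close>; weighting by
  it changes the latter into the former in a single use.\<close>

lemma std_gaussian_shift_density:
  fixes P :: "real^'n^'n"
  assumes P: "pos_semidef P" and [measurable]: "h \<in> borel_measurable borel"
  shows "(\<integral>\<^sup>+z. h (a + z) * ennreal (gauss_density (mat 1 + P) (a + z - c) / gauss_density (mat 1) z) \<partial>std_gaussian)
    = (\<integral>\<^sup>+y. h y * ennreal (gauss_density (mat 1 + P) (y - c)) \<partial>lborel)"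
proof -
  have S: "pos_def (mat 1 + P)" using P by (intro pos_def_add) auto
  have pt: "ennreal (gauss_density (mat 1) z) * (h (a + z) * ennreal (gauss_density (mat 1 + P) (a + z - c) / gauss_density (mat 1) z))
    = h (a + z) * ennreal (gauss_density (mat 1 + P) (a + z - c))" for z
  proof -
    have "ennreal (gauss_density (mat 1) z) * ennreal (gauss_density (mat 1 + P) (a + z - c) / gauss_density (mat 1) z)
      = ennreal (gauss_density (mat 1 + P) (a + z - c))"
      using gauss_density_pos[OF pos_def_mat_1, of z] gauss_density_pos[OF S, of "a + z - c"]
      by (subst ennreal_mult[symmetric]) auto
    then show ?thesis by (metis mult.left_commute)
  qed
  have "(\<integral>\<^sup>+z. h (a + z) * ennreal (gauss_density (mat 1 + P) (a + z - c) / gauss_density (mat 1) z) \<partial>std_gaussian)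
    = (\<integral>\<^sup>+z. h (a + z) * ennreal (gauss_density (mat 1 + P) (a + z - c)) \<partial>lborel)"
    by (simp add: nn_integral_std_gaussian pt)
  also have "\<dots> = (\<integral>\<^sup>+y. h y * ennreal (gauss_density (mat 1 + P) (y - c)) \<partial>lborel)"
    by (rule nn_integral_lborel_translate) simp
  finally show ?thesis .
qed

lemma emeasure_distr_density:
  assumes "T \<in> measurable M N" "A \<in> sets N" "f \<in> borel_measurable M"
  shows "emeasure (distr (density M f) N T) A = (\<integral>\<^sup>+x. f x * indicator A (T x) \<partial>M)"
proof -
  have "emeasure (distr (density M f) N T) A = emeasure (density M f) (T -` A \<inter> space M)"
    using assms by (subst emeasure_distr) auto
  also have "\<dots> = (\<integral>\<^sup>+x. f x * indicator (T -` A \<inter> space M) x \<partial>M)"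
    using assms by (intro emeasure_density) auto
  also have "\<dots> = (\<integral>\<^sup>+x. f x * indicator A (T x) \<partial>M)"
    by (intro nn_integral_cong) (auto simp: indicator_def)
  finally show ?thesis .
qed

text \<open>\<open>Lam m\<close> is the likelihood ratio of an output law \<open>Q\<close>, which
  does not depend on the codeword, to the law produced by codeword \<open>m\<close>. Under
  \<open>Q\<close> the probabilities of deciding for \<open>m\<close> sum to at most 1. The price
  for returning to the true law is the mean of \<open>- ln (Lam m z)\<close>, whose average over
  \<open>m\<close> is \<open>real n / 2 * ln (det S)\<close>.\<close>

lemma fano_gaussian:
  fixes s :: "'m \<Rightarrow> nat \<Rightarrow> real^'r" and I :: "'m set" and n :: nat and D :: "(nat \<Rightarrow> real^'r) \<Rightarrow> 'm"
  assumes I: "finite I" "I \<noteq> {}" and n: "0 < n"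
    and D [measurable]: "D \<in> measurable (\<Pi>\<^sub>M j\<in>{..<n}. borel) (count_space UNIV)"
  shows "(\<Sum>m\<in>I. measure (gblock n) {z \<in> space (gblock n). D (\<lambda>j\<in>{..<n}. s m j + z j) = m}) / real (card I) * ln (real (card I))
    \<le> ln 2 + real n / 2 * ln (det (mat 1 + codeword_cov I n s))"
proof -
  let ?G = "gblock n :: (nat \<Rightarrow> real^'r) measure"
  interpret G: prob_space ?G by simp
  interpret PG: product_sigma_finite "\<lambda>_::nat. std_gaussian :: (real^'r) measure"
    by (simp add: product_sigma_finite_def prob_space_imp_sigma_finite)
  define M where "M = real (card I)"
  have M: "1 \<le> M" using I by (simp add: M_def Suc_le_eq card_gt_0_iff)
  define P where "P = codeword_cov I n s"
  define S where "S = mat 1 + P"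
  define X where "X = matrix_inv S"
  have P: "pos_semidef P" unfolding P_def by (rule pos_semidef_codeword_cov)
  have S: "pos_def S" unfolding S_def by (intro pos_def_add P) simp
  define mu where "mu = codeword_mean I s"
  define rat where "rat m j z = gauss_density S (s m j + z - mu j) / gauss_density (mat 1) z" for m j and z :: "real^'r"
  have rat: "0 < rat m j z" for m j z
    unfolding rat_def by (intro divide_pos_pos gauss_density_pos S) auto
  have [measurable]: "rat m j \<in> borel_measurable borel" for m j unfolding rat_def by measurable
  define Lam where "Lam m z = (\<Prod>j<n. rat m j (z j))" for m and z :: "nat \<Rightarrow> real^'r"
  have Lam: "0 < Lam m z" for m z unfolding Lam_def by (intro prod_pos rat)
  have [measurable]: "Lam m \<in> borel_measurable ?G" for m unfolding Lam_def by measurable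
  define sh where "sh m z = (\<lambda>j\<in>{..<n}. s m j + z j)" for m and z :: "nat \<Rightarrow> real^'r"
  have [measurable]: "sh m \<in> measurable ?G (\<Pi>\<^sub>M j\<in>{..<n}. borel)" for m unfolding sh_def by measurable
  define Qj where "Qj j = density lborel (\<lambda>y. ennreal (gauss_density S (y - mu j)))" for j
  have Qj: "prob_space (Qj j)" for j
    by (rule prob_spaceI) (simp add: Qj_def emeasure_density S_def nn_integral_gauss_density_shift P)
  interpret PQ: product_sigma_finite Qj
    by (simp add: product_sigma_finite_def prob_space_imp_sigma_finite Qj)
  \<comment> \<open>The means \<open>mu j\<close> follow the codewords from use to use, whereas the
    covariance \<open>S\<close> is the same in all uses.\<close>
  define Q where "Q = (\<Pi>\<^sub>M j\<in>{..<n}. Qj j)"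
  interpret Q: prob_space Q unfolding Q_def by (intro prob_space_PiM Qj)
  have setsQ: "sets Q = sets (\<Pi>\<^sub>M j\<in>{..<n}. borel :: (real^'r) measure)"
    unfolding Q_def by (intro sets_PiM_cong) (auto simp: Qj_def)
  note [measurable_cong] = setsQ
  \<comment> \<open>Under the noise law weighted by \<open>Lam m\<close> the output for codeword
    \<open>m\<close> has law \<open>Q\<close>, whatever \<open>m\<close>. It suffices to check
    boxes, on which everything factorises over the uses.\<close>
  have change: "distr (density ?G (\<lambda>z. ennreal (Lam m z))) Q (sh m) = Q" for m
    unfolding Q_def
  proof (rule PQ.PiM_eqI)
    fix A assume A: "\<And>j. j \<in> {..<n} \<Longrightarrow> A j \<in> sets (Qj j)"
    then have [measurable]: "j < n \<Longrightarrow> A j \<in> sets borel" for j by (auto simp: Qj_def)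
    have APi: "Pi\<^sub>E {..<n} A \<in> sets (Pi\<^sub>M {..<n} Qj)" using A by (intro sets_PiM_I_finite) auto
    have [measurable]: "sh m \<in> measurable ?G (Pi\<^sub>M {..<n} Qj)"
      using setsQ unfolding Q_def by (metis measurable_cong_sets \<open>sh m \<in> ?G \<rightarrow>\<^sub>M _\<close>)
    have "emeasure (distr (density ?G (\<lambda>z. ennreal (Lam m z))) (Pi\<^sub>M {..<n} Qj) (sh m)) (Pi\<^sub>E {..<n} A)
      = (\<integral>\<^sup>+z. ennreal (Lam m z) * indicator (Pi\<^sub>E {..<n} A) (sh m z) \<partial>?G)"
      by (rule emeasure_distr_density[OF _ APi]; measurable)
    also have "\<dots> = (\<integral>\<^sup>+z. (\<Prod>j<n. indicator (A j) (s m j + z j) * ennreal (rat m j (z j))) \<partial>?G)"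
    proof (rule nn_integral_cong)
      fix z
      have "indicator (Pi\<^sub>E {..<n} A) (sh m z) = (\<Prod>j<n. indicator (A j) (s m j + z j) :: ennreal)"
      proof (cases "\<forall>j<n. s m j + z j \<in> A j")
        case True
        then show ?thesis by (auto simp: sh_def indicator_def PiE_iff)
      next
        case False
        then show ?thesis by (auto simp: sh_def indicator_def PiE_iff intro!: prod_zero)
      qed
      then show "ennreal (Lam m z) * indicator (Pi\<^sub>E {..<n} A) (sh m z)
        = (\<Prod>j<n. indicator (A j) (s m j + z j) * ennreal (rat m j (z j)))"
        by (simp add: Lam_def prod.distrib prod_ennreal[symmetric] less_imp_le[OF rat] mult.commute)
    qed
    also have "\<dots> = (\<Prod>j<n. \<integral>\<^sup>+z. indicator (A j) (s m j + z) * ennreal (rat m j z) \<partial>std_gaussian)"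
      by (intro PG.product_nn_integral_prod) auto
    also have "\<dots> = (\<Prod>j<n. emeasure (Qj j) (A j))"
    proof (rule prod.cong[OF refl])
      fix j assume "j \<in> {..<n}"
      then show "(\<integral>\<^sup>+z. indicator (A j) (s m j + z) * ennreal (rat m j z) \<partial>std_gaussian) = emeasure (Qj j) (A j)"
        using std_gaussian_shift_density[OF P, of "indicator (A j)" "s m j" "mu j"]
        by (simp add: rat_def S_def Qj_def emeasure_density mult.commute)
    qed
    finally show "emeasure (distr (density ?G (\<lambda>z. ennreal (Lam m z))) (Pi\<^sub>M {..<n} Qj) (sh m)) (Pi\<^sub>E {..<n} A)
      = (\<Prod>j<n. emeasure (Qj j) (A j))" .
  qed auto
  define ok where "ok m z = (indicator {z. D (sh m z) = m} z :: real)" for m z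
  have [measurable]: "ok m \<in> borel_measurable ?G" for m unfolding ok_def by measurable
  have Dm [measurable]: "{y \<in> space Q. D y = m} \<in> sets Q" for m by measurable
  have LamQ: "(\<integral>\<^sup>+z. ennreal (Lam m z) * indicator A (sh m z) \<partial>?G) = emeasure Q A" if [measurable]: "A \<in> sets Q" for A m
  proof -
    have "emeasure Q A = emeasure (distr (density ?G (\<lambda>z. ennreal (Lam m z))) Q (sh m)) A" by (simp add: change)
    also have "\<dots> = (\<integral>\<^sup>+z. ennreal (Lam m z) * indicator A (sh m z) \<partial>?G)"
      by (rule emeasure_distr_density; measurable)
    finally show ?thesis by simp
  qed
  have spQ: "sh m z \<in> space Q" for m z
    using sets_eq_imp_space_eq[OF setsQ] by (simp add: space_PiM sh_def)
  have nnL: "(\<integral>\<^sup>+z. ennreal (Lam m z) \<partial>?G) = 1" for m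
    using LamQ[of "space Q" m] Q.emeasure_space_1 spQ by simp
  have nnokL: "(\<integral>\<^sup>+z. ennreal (ok m z * Lam m z) \<partial>?G) = ennreal (measure Q {y \<in> space Q. D y = m})" for m
  proof -
    have "(\<integral>\<^sup>+z. ennreal (ok m z * Lam m z) \<partial>?G) = (\<integral>\<^sup>+z. ennreal (Lam m z) * indicator {y \<in> space Q. D y = m} (sh m z) \<partial>?G)"
      by (intro nn_integral_cong) (auto simp: ok_def indicator_def spQ)
    then show ?thesis by (simp add: LamQ Q.emeasure_eq_measure)
  qed
  have intL: "integrable ?G (Lam m)" "(\<integral>z. Lam m z \<partial>?G) = 1" for m
    using nnL[of m] Lam by (auto intro!: integrableI_nonneg simp: less_imp_le integral_eq_nn_integral)
  have intokL: "integrable ?G (\<lambda>z. ok m z * Lam m z)" "(\<integral>z. ok m z * Lam m z \<partial>?G) = measure Q {y \<in> space Q. D y = m}" for m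
  proof -
    have nn: "0 \<le> ok m z * Lam m z" for z using Lam[of m z] by (simp add: ok_def)
    show "integrable ?G (\<lambda>z. ok m z * Lam m z)"
      using nnokL[of m] nn by (intro integrableI_nonneg) auto
    show "(\<integral>z. ok m z * Lam m z \<partial>?G) = measure Q {y \<in> space Q. D y = m}"
      using nn by (subst integral_eq_nn_integral) (auto simp: nnokL)
  qed
  have intok: "integrable ?G (ok m)" "(\<integral>z. ok m z \<partial>?G) = measure ?G {z \<in> space ?G. D (sh m z) = m}" for m
  proof -
    show "integrable ?G (ok m)" by (rule G.integrable_const_bound[where B = 1]) (auto simp: ok_def indicator_def)
    have "(\<integral>z. ok m z \<partial>?G) = (\<integral>z. indicator {z \<in> space ?G. D (sh m z) = m} z \<partial>?G)"
      by (intro Bochner_Integration.integral_cong) (auto simp: ok_def indicator_def)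
    then show "(\<integral>z. ok m z \<partial>?G) = measure ?G {z \<in> space ?G. D (sh m z) = m}" by simp
  qed
  have sumQ: "(\<Sum>m\<in>I. measure Q {y \<in> space Q. D y = m}) \<le> 1"
  proof -
    have "(\<Sum>m\<in>I. measure Q {y \<in> space Q. D y = m}) = measure Q (\<Union>m\<in>I. {y \<in> space Q. D y = m})"
      using I by (subst Q.finite_measure_finite_Union) (auto simp: disjoint_family_on_def)
    then show ?thesis by simp
  qed
  define l where "l m j z = ln (rat m j z)" for m j z
  have l_eq: "l m j z = - (((s m j - mu j) + z) \<bullet> (X *v ((s m j - mu j) + z))) / 2 + z \<bullet> z / 2 - ln (det S) / 2" for m j z
    unfolding l_def rat_def ln_gauss_density_ratio[OF S] X_def by (simp add: algebra_simps)
  have intl: "integrable std_gaussian (l m j)"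
    "(\<integral>z. l m j z \<partial>std_gaussian) = - ((s m j - mu j) \<bullet> (X *v (s m j - mu j)) + trace X) / 2 + real CARD('r) / 2 - ln (det S) / 2" for m j
  proof -
    interpret prob_space "std_gaussian :: (real^'r) measure" by simp
    have n2: "integrable std_gaussian (\<lambda>z :: real^'r. z \<bullet> z)" "(\<integral>z. z \<bullet> z \<partial>(std_gaussian :: (real^'r) measure)) = real CARD('r)"
      using std_gaussian_quadratic[of "mat 1 :: real^'r^'r"] by (simp_all add: trace_I)
    show "integrable std_gaussian (l m j)"
      unfolding l_eq using n2 std_gaussian_quadratic_shift(1)[of "s m j - mu j" X]
      by (intro Bochner_Integration.integrable_add Bochner_Integration.integrable_diff
          integrable_divide Bochner_Integration.integrable_minus) auto
    show "(\<integral>z. l m j z \<partial>std_gaussian) = - ((s m j - mu j) \<bullet> (X *v (s m j - mu j)) + trace X) / 2 + real CARD('r) / 2 - ln (det S) / 2"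
      unfolding l_eq by (simp add: n2 std_gaussian_quadratic_shift prob_space[simplified] add_divide_distrib)
  qed
  have lnLam: "ln (Lam m z) = (\<Sum>j<n. l m j (z j))" for m z
    unfolding Lam_def l_def by (rule ln_prod) (auto simp: less_imp_neq[OF rat, symmetric])
  have intlnL: "integrable ?G (\<lambda>z. ln (Lam m z))"
     "(\<integral>z. ln (Lam m z) \<partial>?G) = (\<Sum>j<n. (\<integral>z. l m j z \<partial>std_gaussian))" for m
    unfolding lnLam using gblock_component[OF _ intl(1)] by (auto simp: integral_sum)
  \<comment> \<open>Summed over messages and uses, the quadratic forms of the deviations give
    \<open>M * real n * trace (X ** P)\<close>. As \<open>X\<close> inverts
    \<open>S = mat 1 + P\<close>, this trace and \<open>trace X\<close> add up to the dimension and
    cancel the mean of \<open>z \<bullet> z\<close>.\<close>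
  have sumln: "(\<Sum>m\<in>I. \<integral>z. ln (Lam m z) \<partial>?G) = - (M * real n / 2 * ln (det S))"
  proof -
    have "(\<Sum>m\<in>I. \<integral>z. ln (Lam m z) \<partial>?G)
      = (\<Sum>m\<in>I. \<Sum>j<n. - (1/2) * ((s m j - mu j) \<bullet> (X *v (s m j - mu j))) + (- trace X / 2 + real CARD('r) / 2 - ln (det S) / 2))"
      by (simp add: intlnL intl add_divide_distrib diff_divide_distrib algebra_simps)
    also have "\<dots> = - (1/2) * (\<Sum>m\<in>I. \<Sum>j<n. (s m j - mu j) \<bullet> (X *v (s m j - mu j)))
       + M * real n * (- trace X / 2 + real CARD('r) / 2 - ln (det S) / 2)"
      by (simp only: sum.distrib sum_distrib_left[symmetric]) (simp add: M_def)
    also have "\<dots> = - (1/2) * (M * real n * trace (X ** P)) + M * real n * (- trace X / 2 + real CARD('r) / 2 - ln (det S) / 2)"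
      using trace_mult_codeword_cov[OF I n, of s X] by (simp add: mu_def P_def M_def)
    also have "trace (X ** P) = real CARD('r) - trace X"
    proof -
      have "X ** S = mat 1" unfolding X_def by (rule matrix_inv_left[OF pos_def_invertible[OF S]])
      then have "trace (X ** S) = real CARD('r)" by (simp add: trace_I)
      then show ?thesis by (simp add: S_def matrix_add_ldistrib trace_add)
    qed
    finally show ?thesis by (simp add: field_simps)
  qed
  \<comment> \<open>Pointwise \<open>ln x \<le> x - 1\<close>, with
    \<open>x = M * Lam m z / 2\<close> if the decoder is right and \<open>x = Lam m z / 2\<close>
    otherwise; the integrand on the right covers both cases. The factor 1/2 is the origin of
    \<open>ln 2\<close>: with it, the two terms of the bound contribute at most \<open>M / 2\<close>
    each when summed over the messages, so the right-hand sides total at most 0.\<close>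
  have each: "ln M * measure ?G {z \<in> space ?G. D (sh m z) = m} + (\<integral>z. ln (Lam m z) \<partial>?G) - ln 2
    \<le> (M * measure Q {y \<in> space Q. D y = m} + 1) / 2 - 1" for m
  proof -
    have "(\<integral>z. ln M * ok m z + ln (Lam m z) - ln 2 \<partial>?G) \<le> (\<integral>z. (M * (ok m z * Lam m z) + Lam m z) / 2 - 1 \<partial>?G)"
    proof (rule integral_mono)
      show "integrable ?G (\<lambda>z. ln M * ok m z + ln (Lam m z) - ln 2)" using intok intlnL by simp
      show "integrable ?G (\<lambda>z. (M * (ok m z * Lam m z) + Lam m z) / 2 - 1)" using intokL intL by simp
      fix z
      show "ln M * ok m z + ln (Lam m z) - ln 2 \<le> (M * (ok m z * Lam m z) + Lam m z) / 2 - 1"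
      proof (cases "D (sh m z) = m")
        case True
        have "ln (M * Lam m z / 2) \<le> M * Lam m z / 2 - 1" using M Lam[of m z] by (intro ln_le_minus_one) simp
        moreover have "ln (M * Lam m z / 2) = ln M + ln (Lam m z) - ln 2"
          using M Lam[of m z] by (simp add: ln_div ln_mult)
        moreover have "0 < Lam m z / 2" using Lam[of m z] by simp
        moreover have "(M * (ok m z * Lam m z) + Lam m z) / 2 - 1 = M * Lam m z / 2 + Lam m z / 2 - 1"
          using True by (simp add: ok_def add_divide_distrib)
        ultimately show ?thesis using True by (simp add: ok_def add_divide_distrib)
      next
        case False
        have "ln (Lam m z / 2) \<le> Lam m z / 2 - 1" using Lam[of m z] by (intro ln_le_minus_one) simp
        then show ?thesis using False Lam[of m z] by (simp add: ok_def ln_div)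
      qed
    qed
    then show ?thesis using intok intlnL intokL intL by (simp add: G.prob_space)
  qed
  have "(\<Sum>m\<in>I. ln M * measure ?G {z \<in> space ?G. D (sh m z) = m} + (\<integral>z. ln (Lam m z) \<partial>?G) - ln 2)
    \<le> (\<Sum>m\<in>I. (M * measure Q {y \<in> space Q. D y = m} + 1) / 2 - 1)"
    by (intro sum_mono each)
  also have "\<dots> = M / 2 * (\<Sum>m\<in>I. measure Q {y \<in> space Q. D y = m}) - M / 2"
    by (simp add: sum.distrib sum_subtractf sum_divide_distrib[symmetric] sum_distrib_left[symmetric] M_def field_simps)
  also have "\<dots> \<le> M / 2 * 1 - M / 2" using sumQ M by (intro diff_right_mono mult_left_mono) auto
  finally have "(\<Sum>m\<in>I. ln M * measure ?G {z \<in> space ?G. D (sh m z) = m}) \<le> M * (ln 2 + real n / 2 * ln (det S))"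
    by (simp add: sum.distrib sum_subtractf sumln M_def[symmetric] algebra_simps)
  then have "(\<Sum>m\<in>I. measure ?G {z \<in> space ?G. D (sh m z) = m}) * ln M \<le> M * (ln 2 + real n / 2 * ln (det S))"
    by (simp add: sum_distrib_left[symmetric] mult.commute)
  then show ?thesis
    using M by (simp add: S_def P_def sh_def M_def[symmetric] divide_simps mult.commute)
qed

section \<open>Product measures\<close>

text \<open>Two independent i.i.d. blocks, paired use by use, form an i.i.d. block of pairs. A
  finite product law is determined by boxes; since a factor of such a box need not be a rectangle in
  \<open>M \<Otimes>\<^sub>M N\<close>, its indicator is integrated over one variable after the
  other.\<close>

lemma distr_zip_PiM:
  assumes I: "finite I" and M: "prob_space M" and N: "prob_space N"
  shows "distr ((\<Pi>\<^sub>M i\<in>I. M) \<Otimes>\<^sub>M (\<Pi>\<^sub>M i\<in>I. N)) (\<Pi>\<^sub>M i\<in>I. M \<Otimes>\<^sub>M N) (\<lambda>(x, y). \<lambda>i\<in>I. (x i, y i))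
    = (\<Pi>\<^sub>M i\<in>I. M \<Otimes>\<^sub>M N)"
proof -
  interpret M: prob_space M by fact
  interpret N: prob_space N by fact
  interpret MN: pair_prob_space M N ..
  interpret PM: product_sigma_finite "\<lambda>_. M" by (simp add: product_sigma_finite_def prob_space_imp_sigma_finite M)
  interpret PN: product_sigma_finite "\<lambda>_. N" by (simp add: product_sigma_finite_def prob_space_imp_sigma_finite N)
  interpret PMN: product_sigma_finite "\<lambda>_. M \<Otimes>\<^sub>M N"
    by (simp add: product_sigma_finite_def MN.sigma_finite_measure_axioms)
  interpret XN: prob_space "\<Pi>\<^sub>M i\<in>I. N" by (intro prob_space_PiM N)
  let ?T = "\<lambda>(x, y). \<lambda>i\<in>I. (x i, y i)"
  have T [measurable]: "?T \<in> measurable ((\<Pi>\<^sub>M i\<in>I. M) \<Otimes>\<^sub>M (\<Pi>\<^sub>M i\<in>I. N)) (\<Pi>\<^sub>M i\<in>I. M \<Otimes>\<^sub>M N)"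
    by measurable
  show ?thesis
  proof (rule PMN.PiM_eqI[OF I])
    fix A assume A: "\<And>i. i \<in> I \<Longrightarrow> A i \<in> sets (M \<Otimes>\<^sub>M N)"
    have [measurable]: "Pi\<^sub>E I A \<in> sets (\<Pi>\<^sub>M i\<in>I. M \<Otimes>\<^sub>M N)" using I A by (intro sets_PiM_I_finite) auto
    have m [measurable]: "(\<lambda>p. indicator (A i) p :: ennreal) \<in> borel_measurable (M \<Otimes>\<^sub>M N)" if "i \<in> I" for i
      using A[OF that] by (rule borel_measurable_indicator)
    have "emeasure (distr ((\<Pi>\<^sub>M i\<in>I. M) \<Otimes>\<^sub>M (\<Pi>\<^sub>M i\<in>I. N)) (\<Pi>\<^sub>M i\<in>I. M \<Otimes>\<^sub>M N) ?T) (Pi\<^sub>E I A)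
      = (\<integral>\<^sup>+p. indicator (Pi\<^sub>E I A) (?T p) \<partial>((\<Pi>\<^sub>M i\<in>I. M) \<Otimes>\<^sub>M (\<Pi>\<^sub>M i\<in>I. N)))"
      using emeasure_distr_density[of ?T "(\<Pi>\<^sub>M i\<in>I. M) \<Otimes>\<^sub>M (\<Pi>\<^sub>M i\<in>I. N)" "\<Pi>\<^sub>M i\<in>I. M \<Otimes>\<^sub>M N" "Pi\<^sub>E I A" "\<lambda>_. 1"]
      by (simp add: density_1)
    also have "\<dots> = (\<integral>\<^sup>+x. \<integral>\<^sup>+y. indicator (Pi\<^sub>E I A) (?T (x, y)) \<partial>(\<Pi>\<^sub>M i\<in>I. N) \<partial>(\<Pi>\<^sub>M i\<in>I. M))"
      by (rule XN.nn_integral_fst[symmetric]) measurable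
    also have "\<dots> = (\<integral>\<^sup>+x. \<integral>\<^sup>+y. (\<Prod>i\<in>I. indicator (A i) (x i, y i)) \<partial>(\<Pi>\<^sub>M i\<in>I. N) \<partial>(\<Pi>\<^sub>M i\<in>I. M))"
    proof (intro nn_integral_cong)
      fix x y
      show "indicator (Pi\<^sub>E I A) (?T (x, y)) = (\<Prod>i\<in>I. indicator (A i) (x i, y i) :: ennreal)"
      proof (cases "\<forall>i\<in>I. (x i, y i) \<in> A i")
        case True
        then show ?thesis by (simp add: PiE_iff)
      next
        case False
        then have "(\<Prod>i\<in>I. indicator (A i) (x i, y i) :: ennreal) = 0"
          by (intro prod_zero[OF I]) (metis indicator_simps(2))
        moreover have "?T (x, y) \<notin> Pi\<^sub>E I A" using False by (auto simp: PiE_iff)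
        ultimately show ?thesis by simp
      qed
    qed
    also have "\<dots> = (\<integral>\<^sup>+x. (\<Prod>i\<in>I. \<integral>\<^sup>+y. indicator (A i) (x i, y) \<partial>N) \<partial>(\<Pi>\<^sub>M i\<in>I. M))"
    proof (rule nn_integral_cong)
      fix x assume x: "x \<in> space (\<Pi>\<^sub>M i\<in>I. M)"
      show "(\<integral>\<^sup>+y. (\<Prod>i\<in>I. indicator (A i) (x i, y i)) \<partial>(\<Pi>\<^sub>M i\<in>I. N)) = (\<Prod>i\<in>I. \<integral>\<^sup>+y. indicator (A i) (x i, y) \<partial>N)"
      proof (rule PN.product_nn_integral_prod[OF I])
        fix i assume i: "i \<in> I"
        then have "x i \<in> space M" using x by (auto simp: space_PiM)
        from measurable_compose[OF measurable_Pair1'[OF this] m[OF i]] show "(\<lambda>y. indicator (A i) (x i, y) :: ennreal) \<in> borel_measurable N"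
          .
      qed
    qed
    also have "\<dots> = (\<Prod>i\<in>I. \<integral>\<^sup>+x. \<integral>\<^sup>+y. indicator (A i) (x, y) \<partial>N \<partial>M)"
      by (rule PM.product_nn_integral_prod[OF I], rule N.borel_measurable_nn_integral_fst) (use m in auto)
    also have "\<dots> = (\<Prod>i\<in>I. emeasure (M \<Otimes>\<^sub>M N) (A i))"
      by (intro prod.cong refl) (simp add: N.nn_integral_fst m A)
    finally show "emeasure (distr ((\<Pi>\<^sub>M i\<in>I. M) \<Otimes>\<^sub>M (\<Pi>\<^sub>M i\<in>I. N)) (\<Pi>\<^sub>M i\<in>I. M \<Otimes>\<^sub>M N) ?T) (Pi\<^sub>E I A)
      = (\<Prod>i\<in>I. emeasure (M \<Otimes>\<^sub>M N) (A i))" .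
  qed simp
qed

lemma distr_pair_PiM_map:
  assumes I: "finite I" and M: "prob_space M" and N: "prob_space N"
    and T [measurable]: "T \<in> measurable (M \<Otimes>\<^sub>M N) K" and K: "prob_space K"
  shows "distr ((\<Pi>\<^sub>M i\<in>I. M) \<Otimes>\<^sub>M (\<Pi>\<^sub>M i\<in>I. N)) (\<Pi>\<^sub>M i\<in>I. K) (\<lambda>(x, y). \<lambda>i\<in>I. T (x i, y i))
    = (\<Pi>\<^sub>M i\<in>I. distr (M \<Otimes>\<^sub>M N) K T)"
proof -
  interpret MN: pair_prob_space M N using M N by (simp add: pair_prob_space_def pair_sigma_finite_def prob_space_imp_sigma_finite)
  have "(\<Pi>\<^sub>M i\<in>I. distr (M \<Otimes>\<^sub>M N) K T) = distr (\<Pi>\<^sub>M i\<in>I. M \<Otimes>\<^sub>M N) (\<Pi>\<^sub>M i\<in>I. K) (compose I T)"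
    using I K MN.prob_space_axioms by (intro distr_PiM_finite_prob_space'[symmetric]) auto
  also have "\<dots> = distr (distr ((\<Pi>\<^sub>M i\<in>I. M) \<Otimes>\<^sub>M (\<Pi>\<^sub>M i\<in>I. N)) (\<Pi>\<^sub>M i\<in>I. M \<Otimes>\<^sub>M N) (\<lambda>(x, y). \<lambda>i\<in>I. (x i, y i))) (\<Pi>\<^sub>M i\<in>I. K) (compose I T)"
    by (simp add: distr_zip_PiM[OF I M N])
  also have "\<dots> = distr ((\<Pi>\<^sub>M i\<in>I. M) \<Otimes>\<^sub>M (\<Pi>\<^sub>M i\<in>I. N)) (\<Pi>\<^sub>M i\<in>I. K) (\<lambda>(x, y). \<lambda>i\<in>I. T (x i, y i))"
    unfolding compose_def
    by (subst distr_distr) (auto intro!: distr_cong simp: fun_eq_iff)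
  finally show ?thesis ..
qed

text \<open>First-moment method: replaces the randomness of a decoder or of a codebook by one fixed
  realisation.\<close>

lemma (in prob_space) ex_le_of_nn_integral_le:
  assumes [measurable]: "f \<in> borel_measurable M" and c: "(\<integral>\<^sup>+x. f x \<partial>M) \<le> ennreal c"
  shows "\<exists>x\<in>space M. f x \<le> ennreal c"
proof (rule ccontr)
  assume "\<not> ?thesis"
  then have less: "\<And>x. x \<in> space M \<Longrightarrow> ennreal c < f x" by auto
  have "(\<integral>\<^sup>+x. ennreal c \<partial>M) < (\<integral>\<^sup>+x. f x \<partial>M)"
  proof (rule nn_integral_less)
    show "\<not> (AE x in M. f x \<le> ennreal c)"
    proof
      assume "AE x in M. f x \<le> ennreal c"
      then have "AE x in M. False" using less by (auto elim!: AE_mp intro!: AE_I2 simp: not_le[symmetric])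
      then show False by simp
    qed
    show "AE x in M. ennreal c \<le> f x" using less by (auto intro!: AE_I2 less_imp_le)
  qed (auto simp: emeasure_space_1)
  then show False using c by (simp add: emeasure_space_1)
qed

text \<open>Pairwise independence of the components, which suffices for random codebooks: no term of
  the error bound involves more than two codewords of one user.\<close>

lemma distr_PiM_pair_components:
  assumes M: "prob_space M" and ij: "i \<in> I" "j \<in> I" "i \<noteq> j"
  shows "distr (\<Pi>\<^sub>M i\<in>I. M) (M \<Otimes>\<^sub>M M) (\<lambda>x. (x i, x j)) = M \<Otimes>\<^sub>M M"
proof -
  interpret M: prob_space M by fact
  interpret MM: pair_prob_space M M ..
  let ?P = "\<Pi>\<^sub>M i\<in>I. M"
  have mi [measurable]: "(\<lambda>x. x i) \<in> measurable ?P M" "(\<lambda>x. x j) \<in> measurable ?P M"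
    using ij by (auto intro!: measurable_component_singleton)
  show ?thesis
  proof (rule pair_measure_eqI[symmetric])
    show "sigma_finite_measure M" "sigma_finite_measure M" by unfold_locales
    fix A B assume A [measurable]: "A \<in> sets M" and B [measurable]: "B \<in> sets M"
    let ?X = "\<lambda>k. if k = i then A else B"
    have "emeasure (distr ?P (M \<Otimes>\<^sub>M M) (\<lambda>x. (x i, x j))) (A \<times> B)
      = emeasure ?P (prod_emb I (\<lambda>_. M) {i, j} (\<Pi>\<^sub>E k\<in>{i, j}. ?X k))"
      using ij A B by (subst emeasure_distr) (auto intro!: arg_cong[where f = "emeasure ?P"] simp: prod_emb_def space_PiM PiE_iff)
    also have "\<dots> = (\<Prod>k\<in>{i, j}. emeasure M (?X k))"
      using ij A B M by (intro emeasure_PiM_emb) auto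
    also have "\<dots> = emeasure M A * emeasure M B" using ij by auto
    finally show "emeasure M A * emeasure M B = emeasure (distr ?P (M \<Otimes>\<^sub>M M) (\<lambda>x. (x i, x j))) (A \<times> B)" ..
  qed simp
qed

section \<open>Error probabilities\<close>

lemma finite_messages [simp]: "finite (messages R n)"
  by (simp add: messages_def)

lemma card_messages_ge: "exp (real n * R) \<le> real (card (messages R n))"
  by (simp add: messages_def)

lemma card_messages_pos: "0 < card (messages R n)"
proof -
  have "0 < real (card (messages R n))" using card_messages_ge[of n R] by (meson exp_gt_zero less_le_trans)
  then show ?thesis by simp
qed

lemma messages_nonempty [simp]: "messages R n \<noteq> {}"
  by (metis card_messages_pos card.empty less_irrefl)

lemma nn_integral_message_law:
  "(\<integral>\<^sup>+m. f m \<partial>measure_pmf (message_law R n)) = (\<Sum>m\<in>messages R n. f m) / ennreal (card (messages R n))"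
  unfolding message_law_def by (subst nn_integral_pmf_of_set) (auto simp: ennreal_of_nat_eq_real_of_nat)

lemma expectation_message_law:
  "measure_pmf.expectation (message_law R n) f = (\<Sum>m\<in>messages R n. f m) / real (card (messages R n))"
  for f :: "nat \<Rightarrow> real"
  unfolding message_law_def by (subst integral_pmf_of_set) auto

lemma received_measurable [measurable]:
  "(\<lambda>z. received A B n x1 x2 z) \<in> measurable (\<Pi>\<^sub>M j\<in>{..<n}. borel) (\<Pi>\<^sub>M j\<in>{..<n}. borel)"
  unfolding received_def by measurable

lemma received_gblock [measurable]:
  "(\<lambda>z. received A B n x1 x2 z) \<in> measurable (gblock n) (\<Pi>\<^sub>M j\<in>{..<n}. borel)"
  by measurable

text \<open>\<open>pr\<close> will be \<open>fst\<close> or \<open>snd\<close>. Projecting every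
  noise pair of the block to one receiver gives independent standard Gaussians, however the two
  parts of a pair are correlated.\<close>

lemma emeasure_noise_block:
  fixes N :: "((real^'r1) \<times> (real^'r2)) measure" and pr :: "(real^'r1) \<times> (real^'r2) \<Rightarrow> real^'r"
  assumes N: "noise_law N" and [measurable]: "pr \<in> borel_measurable borel"
    and pr: "distr N borel pr = std_gaussian" and A [measurable]: "A \<in> sets (\<Pi>\<^sub>M j\<in>{..<n}. borel)"
  shows "emeasure (\<Pi>\<^sub>M j\<in>{..<n}. N) {z \<in> space (\<Pi>\<^sub>M j\<in>{..<n}. N). (\<lambda>j\<in>{..<n}. pr (z j)) \<in> A} = emeasure (gblock n) A"
proof -
  have N': "prob_space N" and [measurable_cong]: "sets N = sets borel" using N by (auto simp: noise_law_def)
  have "gblock n = (\<Pi>\<^sub>M j\<in>{..<n}. distr N std_gaussian pr)"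
    by (intro PiM_cong refl) (simp add: pr[symmetric] cong: distr_cong)
  also have "\<dots> = distr (\<Pi>\<^sub>M j\<in>{..<n}. N) (gblock n) (compose {..<n} pr)"
    by (intro distr_PiM_finite_prob_space'[symmetric]) (auto simp: N')
  finally have d: "gblock n = distr (\<Pi>\<^sub>M j\<in>{..<n}. N) (gblock n) (compose {..<n} pr)" .
  have "A \<in> sets (gblock n)" using A by (simp add: sets_gblock)
  moreover have "compose {..<n} pr \<in> measurable (\<Pi>\<^sub>M j\<in>{..<n}. N) (gblock n)"
    unfolding compose_def by measurable
  ultimately have "emeasure (gblock n) A = emeasure (\<Pi>\<^sub>M j\<in>{..<n}. N) (compose {..<n} pr -` A \<inter> space (\<Pi>\<^sub>M j\<in>{..<n}. N))"
    by (subst d) (simp add: emeasure_distr)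
  also have "compose {..<n} pr -` A \<inter> space (\<Pi>\<^sub>M j\<in>{..<n}. N) = {z \<in> space (\<Pi>\<^sub>M j\<in>{..<n}. N). (\<lambda>j\<in>{..<n}. pr (z j)) \<in> A}"
    by (auto simp: compose_def)
  finally show ?thesis ..
qed

lemma emeasure_block_law:
  fixes N :: "((real^'r1) \<times> (real^'r2)) measure"
  assumes N: "noise_law N"
    and S: "\<And>m1 m2. S m1 m2 \<in> sets (\<Pi>\<^sub>M j\<in>{..<n}. N)"
  shows "emeasure (block_law N R1 R2 n) {((m1, m2), z) \<in> space (block_law N R1 R2 n). z \<in> S m1 m2}
    = (\<Sum>m1\<in>messages R1 n. \<Sum>m2\<in>messages R2 n. emeasure (\<Pi>\<^sub>M j\<in>{..<n}. N) (S m1 m2))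
      / ennreal (real (card (messages R1 n)) * real (card (messages R2 n)))" (is "emeasure _ ?A = _")
proof -
  let ?P = "\<Pi>\<^sub>M j\<in>{..<n}. N"
  have "prob_space N" using N by (simp add: noise_law_def)
  then interpret P: prob_space ?P by (intro prob_space_PiM)
  let ?p = "pair_pmf (message_law R1 n) (message_law R2 n)"
  have A: "?A = (\<Union>m\<in>UNIV. {m} \<times> S (fst m) (snd m))"
    using S[THEN sets.sets_into_space] by (fastforce simp: block_law_def space_pair_measure)
  have Am: "?A \<in> sets (measure_pmf ?p \<Otimes>\<^sub>M ?P)"
    unfolding A by (intro sets.countable_UN'' pair_measureI S) auto
  have "emeasure (block_law N R1 R2 n) ?A = (\<integral>\<^sup>+m. emeasure ?P (Pair m -` ?A) \<partial>measure_pmf ?p)"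
    using Am unfolding block_law_def by (subst P.emeasure_pair_measure_alt) auto
  also have "\<dots> = (\<integral>\<^sup>+m. emeasure ?P (S (fst m) (snd m)) \<partial>measure_pmf ?p)"
    unfolding A by (intro nn_integral_cong arg_cong[where f = "emeasure ?P"]) auto
  also have "\<dots> = (\<Sum>m1\<in>messages R1 n. (\<Sum>m2\<in>messages R2 n. emeasure ?P (S m1 m2)) / ennreal (card (messages R2 n)))
      / ennreal (card (messages R1 n))"
    by (simp add: nn_integral_pair_pmf' nn_integral_message_law)
  also have "\<dots> = (\<Sum>m1\<in>messages R1 n. \<Sum>m2\<in>messages R2 n. emeasure ?P (S m1 m2))
     / ennreal (real (card (messages R1 n)) * real (card (messages R2 n)))"
    using card_messages_pos[of R1 n] card_messages_pos[of R2 n]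
    by (simp add: divide_ennreal_def sum_distrib_right[symmetric] sum_distrib_left[symmetric] ennreal_mult'' ennreal_inverse_mult mult_ac)
  finally show ?thesis .
qed

text \<open>\<open>bad\<close> may refer to both messages, so that one expression serves for either
  receiver, with the users in either order, and for a decoder of the pair of messages.\<close>

definition average_error :: "real^'t1^'r \<Rightarrow> real^'t2^'r \<Rightarrow> nat \<Rightarrow> nat set \<Rightarrow> nat set \<Rightarrow>
    (nat \<Rightarrow> nat \<Rightarrow> real^'t1) \<Rightarrow> (nat \<Rightarrow> nat \<Rightarrow> real^'t2) \<Rightarrow> ((nat \<Rightarrow> real^'r) \<Rightarrow> nat \<Rightarrow> nat \<Rightarrow> bool) \<Rightarrow> real" where
  "average_error A B n I1 I2 f1 f2 bad = (\<Sum>m1\<in>I1. \<Sum>m2\<in>I2.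
     measure (gblock n) {z \<in> space (gblock n). bad (received A B n (f1 m1) (f2 m2) z) m1 m2})
     / (real (card I1) * real (card I2))"

lemma received_restrict: "received A B n x1 x2 (\<lambda>j\<in>{..<n}. z j) = received A B n x1 x2 z"
  by (auto simp: received_def)

lemma measure_block_law_received:
  fixes N :: "((real^'r1) \<times> (real^'r2)) measure" and pr :: "(real^'r1) \<times> (real^'r2) \<Rightarrow> real^'r"
  assumes N: "noise_law N" and prm: "pr \<in> borel_measurable borel"
    and pr: "distr N borel pr = std_gaussian"
    and bad: "\<And>m1 m2. {y \<in> space (\<Pi>\<^sub>M j\<in>{..<n}. borel). bad y m1 m2} \<in> sets (\<Pi>\<^sub>M j\<in>{..<n}. borel)"
  shows "measure (block_law N R1 R2 n)
       {((m1, m2), z) \<in> space (block_law N R1 R2 n). bad (received A B n (f1 m1) (f2 m2) (\<lambda>j. pr (z j))) m1 m2}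
    = average_error A B n (messages R1 n) (messages R2 n) f1 f2 bad"
proof -
  let ?B = "\<Pi>\<^sub>M j\<in>{..<n}. borel :: (real^'r) measure"
  let ?P = "\<Pi>\<^sub>M j\<in>{..<n}. N"
  interpret G: prob_space "gblock n :: (nat \<Rightarrow> real^'r) measure" by simp
  have [measurable_cong]: "sets N = sets borel" using N by (auto simp: noise_law_def)
  note [measurable] = prm
  define E where "E m1 m2 = {z \<in> space (gblock n). bad (received A B n (f1 m1) (f2 m2) z) m1 m2}" for m1 m2
  define S where "S m1 m2 = {z \<in> space ?P. (\<lambda>j\<in>{..<n}. pr (z j)) \<in> E m1 m2}" for m1 m2
  have recv_space: "received A B n x1 x2 z \<in> space ?B" for x1 x2 z
    by (simp add: received_def space_PiM)
  have E [measurable]: "E m1 m2 \<in> sets ?B" for m1 m2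
  proof -
    have "E m1 m2 = (\<lambda>z. received A B n (f1 m1) (f2 m2) z) -` {y \<in> space ?B. bad y m1 m2} \<inter> space (gblock n)"
      by (auto simp: E_def recv_space)
    also have "\<dots> \<in> sets (gblock n)" using bad by (intro measurable_sets[OF received_gblock])
    finally show ?thesis by (simp add: sets_gblock)
  qed
  have S: "S m1 m2 \<in> sets ?P" for m1 m2 unfolding S_def by measurable
  have "{((m1, m2), z) \<in> space (block_law N R1 R2 n). bad (received A B n (f1 m1) (f2 m2) (\<lambda>j. pr (z j))) m1 m2}
    = {((m1, m2), z) \<in> space (block_law N R1 R2 n). z \<in> S m1 m2}"
    by (auto simp: S_def E_def block_law_def space_pair_measure received_restrict space_PiM)
  then have "emeasure (block_law N R1 R2 n)
       {((m1, m2), z) \<in> space (block_law N R1 R2 n). bad (received A B n (f1 m1) (f2 m2) (\<lambda>j. pr (z j))) m1 m2}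
    = (\<Sum>m1\<in>messages R1 n. \<Sum>m2\<in>messages R2 n. emeasure ?P (S m1 m2))
      / ennreal (real (card (messages R1 n)) * real (card (messages R2 n)))"
    using emeasure_block_law[OF N S] by simp
  also have "\<dots> = (\<Sum>m1\<in>messages R1 n. \<Sum>m2\<in>messages R2 n. ennreal (measure (gblock n) (E m1 m2)))
      / ennreal (real (card (messages R1 n)) * real (card (messages R2 n)))"
    unfolding S_def by (simp add: emeasure_noise_block[OF N prm pr E] G.emeasure_eq_measure)
  also have "\<dots> = ennreal (average_error A B n (messages R1 n) (messages R2 n) f1 f2 bad)"
    unfolding average_error_def E_def[symmetric]
    using card_messages_pos[of R1 n] card_messages_pos[of R2 n]
    by (subst divide_ennreal[symmetric]) (auto simp: sum_nonneg sum_ennreal)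
  finally show ?thesis
    by (simp add: measure_def average_error_def sum_nonneg)
qed

lemma decoder_measurable:
  assumes "decoder R n g"
  shows "g \<in> measurable (\<Pi>\<^sub>M j\<in>{..<n}. borel) (count_space UNIV)"
proof -
  have "id \<in> measurable (count_space (messages R n)) (count_space UNIV)" by simp
  from measurable_comp[OF assms[unfolded decoder_def] this] show ?thesis by simp
qed

lemma error1_average:
  assumes "noise_law N" "decoder R1 n g1"
  shows "error1 H1 H2 N R1 R2 n f1 f2 g1
    = average_error H1 H2 n (messages R1 n) (messages R2 n) f1 f2 (\<lambda>y m1 m2. g1 y \<noteq> m1)"
proof -
  note [measurable] = decoder_measurable[OF assms(2)]
  show ?thesis
    unfolding error1_def
    by (rule measure_block_law_received[OF assms(1)]) (use assms(1) in \<open>auto simp: noise_law_def borel_prod[symmetric]\<close>)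
qed

lemma error2_average:
  assumes "noise_law N" "decoder R2 n g2"
  shows "error2 H3 H4 N R1 R2 n f1 f2 g2
    = average_error H3 H4 n (messages R1 n) (messages R2 n) f1 f2 (\<lambda>y m1 m2. g2 y \<noteq> m2)"
proof -
  note [measurable] = decoder_measurable[OF assms(2)]
  show ?thesis
    unfolding error2_def
    by (rule measure_block_law_received[OF assms(1)]) (use assms(1) in \<open>auto simp: noise_law_def borel_prod[symmetric]\<close>)
qed

section \<open>The converse\<close>

lemma codeword_deviation_sum:
  assumes "finite I" "I \<noteq> {}"
  shows "(\<Sum>m\<in>I. s m j - codeword_mean I s j) = 0"
  using assms by (simp add: sum_subtractf codeword_mean_def sum_constant_scaleR del: sum_constant)

lemma codeword_cov_mult_vec:
  "codeword_cov I n s *v v = (1 / (real (card I) * real n)) *\<^sub>R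
     (\<Sum>m\<in>I. \<Sum>j<n. ((s m j - codeword_mean I s j) \<bullet> v) *\<^sub>R (s m j - codeword_mean I s j))"
  by (simp add: codeword_cov_def scaleR_matrix_vector_assoc[symmetric] sum_matrix_vector_mult outer_mult_vec)

lemma matrix_vector_mult_sum: "A *v (\<Sum>i\<in>I. f i) = (\<Sum>i\<in>I. A *v f i)" for A :: "real^'n^'m"
  by (induction I rule: infinite_finite_induct) (auto simp: matrix_vector_right_distrib)

text \<open>The offset \<open>c\<close> depends on the use but not on the message, so it disappears
  with the mean. It will be the interferer's signal for a fixed message.\<close>

lemma codeword_cov_affine:
  fixes A :: "real^'t^'r"
  assumes I: "finite I" "I \<noteq> {}"
  shows "codeword_cov I n (\<lambda>m j. A *v x m j + c j) = A ** codeword_cov I n x ** transpose A"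
proof -
  have mean: "codeword_mean I (\<lambda>m j. A *v x m j + c j) j = A *v codeword_mean I x j + c j" for j
    using I by (simp add: codeword_mean_def sum.distrib scaleR_add_right matrix_vector_mult_sum
        matrix_vector_mult_scaleR sum_constant_scaleR del: sum_constant)
  have "codeword_cov I n (\<lambda>m j. A *v x m j + c j) *v v = (A ** codeword_cov I n x ** transpose A) *v v" for v
    by (simp add: codeword_cov_mult_vec mean matrix_vector_mult_scaleR matrix_vector_mult_sum
        inner_matrix_transpose matrix_vector_mult_diff_distrib[symmetric] flip: matrix_vector_mul_assoc)
  then show ?thesis by (simp add: matrix_eq)
qed

text \<open>The deviations of either user sum to 0 over that user's messages, so the cross terms
  vanish on the product of the message sets: independent users send uncorrelated signals.\<close>

lemma codeword_cov_Times:
  fixes u w :: "'m \<Rightarrow> nat \<Rightarrow> real^'r"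
  assumes I: "finite I" "I \<noteq> {}" and J: "finite J" "J \<noteq> {}"
  shows "codeword_cov (I \<times> J) n (\<lambda>p j. u (fst p) j + w (snd p) j) = codeword_cov I n u + codeword_cov J n w"
proof -
  define a where "a m j = u m j - codeword_mean I u j" for m j
  define b where "b m j = w m j - codeword_mean J w j" for m j
  have c: "real (card I) \<noteq> 0" "real (card J) \<noteq> 0" using I J by auto
  have sa: "(\<Sum>m\<in>I. a m j) = 0" and sb: "(\<Sum>m\<in>J. b m j) = 0" for j
    unfolding a_def b_def using codeword_deviation_sum I J by blast+
  have mean: "codeword_mean (I \<times> J) (\<lambda>p j. u (fst p) j + w (snd p) j) j = codeword_mean I u j + codeword_mean J w j" for j
  proof -
    have "(\<Sum>p\<in>I \<times> J. u (fst p) j + w (snd p) j) = real (card J) *\<^sub>R (\<Sum>m\<in>I. u m j) + real (card I) *\<^sub>R (\<Sum>m\<in>J. w m j)"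
    proof -
      have "(\<Sum>p\<in>I \<times> J. u (fst p) j + w (snd p) j) = (\<Sum>m\<in>I. \<Sum>m'\<in>J. u m j + w m' j)"
        by (simp add: sum.cartesian_product split_def)
      then show ?thesis by (simp add: sum.distrib sum_constant_scaleR scaleR_sum_right del: sum_constant)
    qed
    then show ?thesis using c by (simp add: codeword_mean_def card_cartesian_product scaleR_add_right)
  qed
  have dev: "u (fst p) j + w (snd p) j - (codeword_mean I u j + codeword_mean J w j) = a (fst p) j + b (snd p) j" for p j
    by (simp add: a_def b_def)
  have cross1: "(\<Sum>m\<in>I. \<Sum>m'\<in>J. (a m j \<bullet> v) *\<^sub>R b m' j) = 0" for j v
    by (simp add: scaleR_sum_right[symmetric] sb)
  have cross2: "(\<Sum>m\<in>I. \<Sum>m'\<in>J. (b m' j \<bullet> v) *\<^sub>R a m j) = 0" for j v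
    by (subst sum.swap) (simp add: scaleR_sum_right[symmetric] sa)
  have "codeword_cov (I \<times> J) n (\<lambda>p j. u (fst p) j + w (snd p) j) *v v = (codeword_cov I n u + codeword_cov J n w) *v v" for v
  proof -
    have "(\<Sum>p\<in>I \<times> J. \<Sum>j<n. ((a (fst p) j + b (snd p) j) \<bullet> v) *\<^sub>R (a (fst p) j + b (snd p) j))
      = (\<Sum>j<n. \<Sum>m\<in>I. \<Sum>m'\<in>J. ((a m j + b m' j) \<bullet> v) *\<^sub>R (a m j + b m' j))"
      by (subst sum.swap) (simp add: sum.cartesian_product split_def)
    also have "\<dots> = (\<Sum>j<n. real (card J) *\<^sub>R (\<Sum>m\<in>I. (a m j \<bullet> v) *\<^sub>R a m j) + real (card I) *\<^sub>R (\<Sum>m\<in>J. (b m j \<bullet> v) *\<^sub>R b m j))"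
      by (intro sum.cong refl)
        (simp add: inner_add_left scaleR_add_left scaleR_add_right sum.distrib cross1 cross2 sum_constant_scaleR scaleR_sum_right del: sum_constant)
    also have "\<dots> = real (card J) *\<^sub>R (\<Sum>m\<in>I. \<Sum>j<n. (a m j \<bullet> v) *\<^sub>R a m j) + real (card I) *\<^sub>R (\<Sum>m\<in>J. \<Sum>j<n. (b m j \<bullet> v) *\<^sub>R b m j)"
      by (simp add: sum.distrib scaleR_sum_right sum.swap[of _ I "{..<n}"] sum.swap[of _ J "{..<n}"])
    finally show ?thesis
      using c by (simp add: codeword_cov_mult_vec mean dev matrix_vector_mult_add_rdistrib card_cartesian_product
          scaleR_add_right flip: a_def b_def)
  qed
  then show ?thesis by (simp add: matrix_eq)
qed

text \<open>Subtracting the mean only lowers a second moment. The right-hand side is the power of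
  the code, so power constraints become trace constraints.\<close>

lemma trace_codeword_cov_le:
  fixes x :: "'m \<Rightarrow> nat \<Rightarrow> real^'t"
  assumes I: "finite I" "I \<noteq> {}"
  shows "trace (codeword_cov I n x) \<le> 1 / real n * (\<Sum>j<n. (\<Sum>m\<in>I. (norm (x m j))\<^sup>2) / real (card I))"
proof -
  have tr: "trace (codeword_cov I n x) = (1 / (real (card I) * real n)) *
     (\<Sum>j<n. \<Sum>m\<in>I. (norm (x m j - codeword_mean I x j))\<^sup>2)"
  proof -
    have "trace (c *\<^sub>R (\<Sum>m\<in>I. \<Sum>j<n. outer (d m j))) = c * (\<Sum>j<n. \<Sum>m\<in>I. (norm (d m j))\<^sup>2)"
      for c and d :: "'m \<Rightarrow> nat \<Rightarrow> real^'t"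
      by (subst sum.swap) (simp add: trace_def outer_def dot_square_norm[symmetric] inner_vec_def sum_distrib_left
          sum.swap[of _ _ UNIV])
    from this[where c = "1 / (real (card I) * real n)" and d = "\<lambda>m j. x m j - codeword_mean I x j"]
    show ?thesis unfolding codeword_cov_def .
  qed
  have "(\<Sum>m\<in>I. (norm (x m j - codeword_mean I x j))\<^sup>2) \<le> (\<Sum>m\<in>I. (norm (x m j))\<^sup>2)" for j
  proof -
    let ?mu = "codeword_mean I x j"
    have 0: "(\<Sum>m\<in>I. (x m j - ?mu) \<bullet> ?mu) = 0"
      using codeword_deviation_sum[OF I, of x j] by (simp add: inner_sum_left[symmetric])
    have "(norm (x m j))\<^sup>2 = (norm (x m j - ?mu))\<^sup>2 + 2 * ((x m j - ?mu) \<bullet> ?mu) + (norm ?mu)\<^sup>2" for m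
      by (simp add: power2_norm_eq_inner inner_diff_left inner_diff_right inner_commute)
    then have "(\<Sum>m\<in>I. (norm (x m j))\<^sup>2) = (\<Sum>m\<in>I. (norm (x m j - ?mu))\<^sup>2) + 2 * (\<Sum>m\<in>I. (x m j - ?mu) \<bullet> ?mu) + (\<Sum>m\<in>I. (norm ?mu)\<^sup>2)"
      by (simp only: sum.distrib sum_distrib_left)
    then show ?thesis using 0 by (simp add: sum_nonneg)
  qed
  then have "(\<Sum>j<n. \<Sum>m\<in>I. (norm (x m j - codeword_mean I x j))\<^sup>2) \<le> (\<Sum>j<n. \<Sum>m\<in>I. (norm (x m j))\<^sup>2)"
    by (rule sum_mono)
  then show ?thesis unfolding tr
    by (simp add: sum_divide_distrib[symmetric] mult.commute divide_right_mono)
qed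

section \<open>Converse bounds for one message and for the pair\<close>

lemma average_error_swap:
  "average_error A B n I1 I2 f1 f2 bad = average_error B A n I2 I1 f2 f1 (\<lambda>y m2 m1. bad y m1 m2)"
  unfolding average_error_def by (subst sum.swap) (simp add: received_def add.commute[of "A *v _"] mult.commute)

lemma average_error_le_1:
  fixes A :: "real^'t1^'r" and B :: "real^'t2^'r"
  assumes "finite I1" "finite I2"
  shows "average_error A B n I1 I2 f1 f2 bad \<le> 1"
proof -
  interpret G: prob_space "gblock n :: (nat \<Rightarrow> real^'r) measure" by simp
  have "(\<Sum>m1\<in>I1. \<Sum>m2\<in>I2. measure (gblock n) {z \<in> space (gblock n). bad (received A B n (f1 m1) (f2 m2) z) m1 m2})
    \<le> (\<Sum>m1\<in>I1. \<Sum>m2\<in>I2. 1)" by (intro sum_mono) simp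
  then show ?thesis by (auto simp: average_error_def divide_le_eq_1 zero_less_mult_iff)
qed

lemma measure_gblock_not:
  fixes A :: "real^'t1^'r" and B :: "real^'t2^'r"
  assumes [measurable]: "D \<in> measurable (\<Pi>\<^sub>M j\<in>{..<n}. borel) (count_space UNIV)"
  shows "measure (gblock n) {z \<in> space (gblock n). D (received A B n x1 x2 z) \<noteq> m}
    = 1 - measure (gblock n) {z \<in> space (gblock n). D (received A B n x1 x2 z) = m}"
proof -
  interpret G: prob_space "gblock n :: (nat \<Rightarrow> real^'r) measure" by simp
  have "{z \<in> space (gblock n). D (received A B n x1 x2 z) \<noteq> m}
    = space (gblock n) - {z \<in> space (gblock n). D (received A B n x1 x2 z) = m}" by auto
  then show ?thesis by (simp add: G.prob_compl)
qed

lemma received_eq_shift: "received A B n x1 x2 z = (\<lambda>j\<in>{..<n}. (A *v x1 j + B *v x2 j) + z j)"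
  by (simp add: received_def)

text \<open>For a fixed message of the interferer its signal is a known offset, so the Fano bound
  holds with the covariance of the user alone. The bound is the same for all messages of the
  interferer and survives averaging over them.\<close>

lemma converse_single:
  fixes A :: "real^'t1^'r" and B :: "real^'t2^'r"
  assumes I: "finite I1" "I1 \<noteq> {}" "finite I2" "I2 \<noteq> {}" and n: "0 < n"
    and g: "g \<in> measurable (\<Pi>\<^sub>M j\<in>{..<n}. borel) (count_space UNIV)"
  shows "(1 - average_error A B n I1 I2 f1 f2 (\<lambda>y m1 m2. g y \<noteq> m1)) * ln (real (card I1))
    \<le> ln 2 + real n / 2 * ln (det (mat 1 + A ** codeword_cov I1 n f1 ** transpose A))" (is "?l \<le> ?r")
proof -
  have c: "0 < real (card I1)" "0 < real (card I2)" using I by (auto simp: card_gt_0_iff)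
  define p where "p m1 m2 = measure (gblock n) {z \<in> space (gblock n). g (received A B n (f1 m1) (f2 m2) z) = m1}" for m1 m2
  have fano: "(\<Sum>m1\<in>I1. p m1 m2) / real (card I1) * ln (real (card I1)) \<le> ?r" for m2
    using fano_gaussian[OF I(1,2) n g, of "\<lambda>m1 j. A *v f1 m1 j + B *v f2 m2 j"]
    by (simp add: p_def codeword_cov_affine[OF I(1,2)] received_eq_shift)
  have e: "average_error A B n I1 I2 f1 f2 (\<lambda>y m1 m2. g y \<noteq> m1)
    = 1 - (\<Sum>m2\<in>I2. (\<Sum>m1\<in>I1. p m1 m2) / real (card I1)) / real (card I2)"
    using c unfolding average_error_def measure_gblock_not[OF g] p_def[symmetric]
    by (subst sum.swap) (simp add: sum_subtractf sum_divide_distrib[symmetric] diff_divide_distrib mult.commute)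
  have "?l = (\<Sum>m2\<in>I2. (\<Sum>m1\<in>I1. p m1 m2) / real (card I1) * ln (real (card I1))) / real (card I2)"
    unfolding e by (simp add: sum_distrib_right sum_divide_distrib)
  also have "\<dots> \<le> (\<Sum>m2\<in>I2. ?r) / real (card I2)"
    by (intro divide_right_mono sum_mono fano) auto
  also have "\<dots> = ?r" using c by simp
  finally show ?thesis .
qed

text \<open>The Fano bound for the message set \<open>I1 \<times> I2\<close>, with the noiseless
  outputs as codewords; their covariance is the sum of the contributions of the users.\<close>

lemma converse_joint:
  fixes A :: "real^'t1^'r" and B :: "real^'t2^'r" and I1 I2 :: "nat set"
  assumes I: "finite I1" "I1 \<noteq> {}" "finite I2" "I2 \<noteq> {}" and n: "0 < n"
    and D: "D \<in> measurable (\<Pi>\<^sub>M j\<in>{..<n}. borel) (count_space UNIV)"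
  shows "(1 - average_error A B n I1 I2 f1 f2 (\<lambda>y m1 m2. D y \<noteq> (m1, m2))) * ln (real (card I1) * real (card I2))
    \<le> ln 2 + real n / 2 * ln (det (mat 1 + A ** codeword_cov I1 n f1 ** transpose A + B ** codeword_cov I2 n f2 ** transpose B))"
proof -
  have c: "0 < real (card I1)" "0 < real (card I2)" using I by (auto simp: card_gt_0_iff)
  define p where "p m = measure (gblock n) {z \<in> space (gblock n). D (received A B n (f1 (fst m)) (f2 (snd m)) z) = m}" for m
  have cov: "codeword_cov (I1 \<times> I2) n (\<lambda>m j. A *v f1 (fst m) j + B *v f2 (snd m) j)
    = A ** codeword_cov I1 n f1 ** transpose A + B ** codeword_cov I2 n f2 ** transpose B"
    using codeword_cov_Times[OF I, of n "\<lambda>m j. A *v f1 m j" "\<lambda>m j. B *v f2 m j"]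
      codeword_cov_affine[OF I(1,2), of n A f1 "\<lambda>_. 0"] codeword_cov_affine[OF I(3,4), of n B f2 "\<lambda>_. 0"] by simp
  have "(\<Sum>m\<in>I1 \<times> I2. p m) / real (card (I1 \<times> I2)) * ln (real (card (I1 \<times> I2)))
    \<le> ln 2 + real n / 2 * ln (det (mat 1 + (A ** codeword_cov I1 n f1 ** transpose A + B ** codeword_cov I2 n f2 ** transpose B)))"
    using fano_gaussian[OF _ _ n D, of "I1 \<times> I2" "\<lambda>m j. A *v f1 (fst m) j + B *v f2 (snd m) j"] I
    by (simp add: p_def cov received_eq_shift)
  moreover have "average_error A B n I1 I2 f1 f2 (\<lambda>y m1 m2. D y \<noteq> (m1, m2)) = 1 - (\<Sum>m\<in>I1 \<times> I2. p m) / real (card (I1 \<times> I2))"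
  proof -
    have "(\<Sum>m1\<in>I1. \<Sum>m2\<in>I2. 1 - p (m1, m2)) = real (card I1) * real (card I2) - (\<Sum>m\<in>I1 \<times> I2. p m)"
      by (simp add: sum_subtractf sum.cartesian_product)
    then show ?thesis
      using c unfolding average_error_def measure_gblock_not[OF D]
      by (simp add: p_def diff_divide_distrib card_cartesian_product)
  qed
  ultimately show ?thesis by (simp add: card_cartesian_product add.assoc)
qed

text \<open>The receiver that knows the first message subtracts the first signal from its output and passes
  the rest through the matrix \<open>K\<close>. Fresh Gaussian noise \<open>L z'\<close> turns the result into the output of
  the other channel, to which the decoder of that channel can be applied.\<close>

lemma degraded_joint_decoder:
  fixes H1 H3 :: "real^'t1^'r" and H2 H4 :: "real^'t2^'r" and K :: "real^'r^'r"
  assumes H4: "H4 = K ** H2" and K: "pos_semidef (mat 1 - K ** transpose K)"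
    and I: "finite I1" "I1 \<noteq> {}" "finite I2" "I2 \<noteq> {}"
    and g1 [measurable]: "g1 \<in> measurable (\<Pi>\<^sub>M j\<in>{..<n}. borel) (count_space UNIV)"
    and g2 [measurable]: "g2 \<in> measurable (\<Pi>\<^sub>M j\<in>{..<n}. borel) (count_space UNIV)"
  obtains D where "D \<in> measurable (\<Pi>\<^sub>M j\<in>{..<n}. borel) (count_space UNIV)"
    "average_error H1 H2 n I1 I2 f1 f2 (\<lambda>y m1 m2. D y \<noteq> (m1, m2))
      \<le> average_error H1 H2 n I1 I2 f1 f2 (\<lambda>y m1 m2. g1 y \<noteq> m1) + average_error H3 H4 n I1 I2 f1 f2 (\<lambda>y m1 m2. g2 y \<noteq> m2)"
proof -
  let ?B = "\<Pi>\<^sub>M j\<in>{..<n}. borel :: (real^'r) measure"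
  let ?G = "gblock n :: (nat \<Rightarrow> real^'r) measure"
  interpret G: prob_space ?G by simp
  interpret GG: pair_prob_space ?G ?G ..
  have c: "0 < real (card I1)" "0 < real (card I2)" using I by (auto simp: card_gt_0_iff)
  obtain L :: "real^'r^'r" where L: "mat 1 - K ** transpose K = L ** transpose L" using pos_semidef_factor[OF K] .
  then have KL: "K ** transpose K + L ** transpose L = mat 1" by (metis add.commute diff_add_cancel)
  define mix where "mix = (\<lambda>(z, z'). \<lambda>j\<in>{..<n}. K *v z j + L *v z' j :: real^'r)"
  have mix [measurable]: "mix \<in> measurable (?G \<Otimes>\<^sub>M ?G) ?G" unfolding mix_def by measurable
  have mix_law: "distr (?G \<Otimes>\<^sub>M ?G) ?G mix = ?G"
  proof -
    have "distr (?G \<Otimes>\<^sub>M ?G) ?G mix = (\<Pi>\<^sub>M j\<in>{..<n}. distr (std_gaussian \<Otimes>\<^sub>M std_gaussian) std_gaussian (\<lambda>(z, z'). K *v z + L *v z'))"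
      using distr_pair_PiM_map[of "{..<n}" "std_gaussian :: (real^'r) measure" "std_gaussian :: (real^'r) measure"
          "\<lambda>(z, z'). K *v z + L *v z'" "std_gaussian :: (real^'r) measure"]
      by (simp add: mix_def split_def)
    also have "distr (std_gaussian \<Otimes>\<^sub>M std_gaussian) std_gaussian (\<lambda>(z, z'). K *v z + L *v z') = std_gaussian"
      using distr_std_gaussian_rows_orthonormal[OF KL] by (simp cong: distr_cong)
    finally show ?thesis .
  qed
  define h where "h m1 p = (\<lambda>j\<in>{..<n}. H3 *v f1 m1 j + K *v (fst p j - H1 *v f1 m1 j) + L *v (snd p j))" for m1 and p :: "(nat \<Rightarrow> real^'r) \<times> (nat \<Rightarrow> real^'r)"
  have h1 [measurable]: "(\<lambda>p. h m1 (f p, g p)) \<in> measurable M ?B" if [measurable]: "f \<in> measurable M ?B" "g \<in> measurable M ?B" for m1 f g and M :: "'z measure"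
    unfolding h_def by measurable
  \<comment> \<open>The receiver's own decision \<open>g1 y\<close> also selects the signal that
    \<open>h\<close> removes. If it is wrong, an error of the first decoder has been counted
    already, so the analysis of the second component may assume that the correct signal was
    removed.\<close>
  define D where "D z' y = (g1 y, g2 (h (g1 y) (y, z')))" for z' y
  have Dm: "(\<lambda>p. D (g p) (f p)) \<in> measurable M (count_space UNIV)" if [measurable]: "f \<in> measurable M ?B" "g \<in> measurable M ?B" for f g and M :: "'z measure"
  proof -
    have "(\<lambda>p. (\<lambda>m1 p. (m1, g2 (h m1 (f p, g p)))) (g1 (f p)) p) \<in> measurable M (count_space UNIV)"
    proof (rule measurable_compose_countable[where g = "\<lambda>p. g1 (f p)" and f = "\<lambda>m1 p. (m1, g2 (h m1 (f p, g p)))"])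
      show "(\<lambda>p. g1 (f p)) \<in> measurable M (count_space UNIV)" by measurable
      fix m1 :: nat
      have "(\<lambda>p. g2 (h m1 (f p, g p))) \<in> measurable M (count_space UNIV)" by measurable
      then show "(\<lambda>p. (m1, g2 (h m1 (f p, g p)))) \<in> measurable M (count_space UNIV)"
        by (rule measurable_compose) simp
    qed
    then show ?thesis by (simp add: D_def)
  qed
  have D1: "D z' \<in> measurable ?B (count_space UNIV)" if "z' \<in> space ?B" for z'
    using Dm[of "\<lambda>y. y" ?B "\<lambda>_. z'"] that by simp
  define r where "r m1 m2 z = received H1 H2 n (f1 m1) (f2 m2) z" for m1 m2 z
  have [measurable]: "r m1 m2 \<in> measurable ?G ?B" for m1 m2 unfolding r_def by measurable
  have D2 [measurable]: "(\<lambda>p. D (fst p) (r m1 m2 (snd p))) \<in> measurable (?G \<Otimes>\<^sub>M ?G) (count_space UNIV)" for m1 m2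
    by (rule Dm) measurable
  define E where "E m1 m2 = {p \<in> space (?G \<Otimes>\<^sub>M ?G). D (fst p) (r m1 m2 (snd p)) \<noteq> (m1, m2)}" for m1 m2
  have E [measurable]: "E m1 m2 \<in> sets (?G \<Otimes>\<^sub>M ?G)" for m1 m2 unfolding E_def by measurable
  define e1 where "e1 m1 m2 = measure ?G {z \<in> space ?G. g1 (r m1 m2 z) \<noteq> m1}" for m1 m2
  define e2 where "e2 m1 m2 = measure ?G {z \<in> space ?G. g2 (received H3 H4 n (f1 m1) (f2 m2) z) \<noteq> m2}" for m1 m2
  \<comment> \<open>For the correct \<open>m1\<close> the subtraction leaves
    \<open>H2 *v f2 m2 j\<close> plus noise, and \<open>H4 = K ** H2\<close> turns this into exactly
    the output of the other receiver, with noise \<open>mix (z, z')\<close>.\<close>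
  have hr: "h m1 (r m1 m2 z, z') = received H3 H4 n (f1 m1) (f2 m2) (mix (z, z'))" for m1 m2 z z'
    by (auto simp: h_def r_def received_def mix_def H4 matrix_vector_right_distrib matrix_vector_mul_assoc fun_eq_iff)
  have Ele: "emeasure (?G \<Otimes>\<^sub>M ?G) (E m1 m2) \<le> ennreal (e1 m1 m2 + e2 m1 m2)" for m1 m2
  proof -
    let ?E1 = "{p \<in> space (?G \<Otimes>\<^sub>M ?G). g1 (r m1 m2 (snd p)) \<noteq> m1}"
    let ?E2 = "{p \<in> space (?G \<Otimes>\<^sub>M ?G). g2 (received H3 H4 n (f1 m1) (f2 m2) (mix (snd p, fst p))) \<noteq> m2}"
    have mixs: "(\<lambda>p. mix (snd p, fst p)) \<in> measurable (?G \<Otimes>\<^sub>M ?G) ?G" by measurable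
    have [measurable]: "?E1 \<in> sets (?G \<Otimes>\<^sub>M ?G)" by measurable
    have [measurable]: "?E2 \<in> sets (?G \<Otimes>\<^sub>M ?G)" using mixs by measurable
    have "E m1 m2 \<subseteq> ?E1 \<union> ?E2" by (auto simp: E_def D_def hr)
    then have "measure (?G \<Otimes>\<^sub>M ?G) (E m1 m2) \<le> measure (?G \<Otimes>\<^sub>M ?G) (?E1 \<union> ?E2)"
      by (intro GG.finite_measure_mono) auto
    also have "\<dots> \<le> measure (?G \<Otimes>\<^sub>M ?G) ?E1 + measure (?G \<Otimes>\<^sub>M ?G) ?E2"
      by (rule measure_Un_le) auto
    also have "measure (?G \<Otimes>\<^sub>M ?G) ?E1 = e1 m1 m2"
    proof -
      have "?E1 = space ?G \<times> {z \<in> space ?G. g1 (r m1 m2 z) \<noteq> m1}" by (auto simp: space_pair_measure)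
      moreover have "{z \<in> space ?G. g1 (r m1 m2 z) \<noteq> m1} \<in> sets ?G" by measurable
      ultimately show ?thesis
        by (simp add: e1_def measure_def G.emeasure_pair_measure_Times G.emeasure_space_1)
    qed
    also have "measure (?G \<Otimes>\<^sub>M ?G) ?E2 = e2 m1 m2"
    proof -
      let ?F = "{z \<in> space ?G. g2 (received H3 H4 n (f1 m1) (f2 m2) z) \<noteq> m2}"
      have F: "?F \<in> sets ?G" by measurable
      have "distr (?G \<Otimes>\<^sub>M ?G) ?G (\<lambda>p. mix (snd p, fst p)) = distr (distr (?G \<Otimes>\<^sub>M ?G) (?G \<Otimes>\<^sub>M ?G) (\<lambda>(x, y). (y, x))) ?G mix"
        by (subst distr_distr) (auto simp: comp_def split_def)
      also have "\<dots> = ?G" using GG.distr_pair_swap mix_law by simp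
      finally have "measure ?G ?F = measure (distr (?G \<Otimes>\<^sub>M ?G) ?G (\<lambda>p. mix (snd p, fst p))) ?F" by simp
      also have "\<dots> = measure (?G \<Otimes>\<^sub>M ?G) ((\<lambda>p. mix (snd p, fst p)) -` ?F \<inter> space (?G \<Otimes>\<^sub>M ?G))"
        using F mixs by (intro measure_distr) auto
      also have "(\<lambda>p. mix (snd p, fst p)) -` ?F \<inter> space (?G \<Otimes>\<^sub>M ?G) = ?E2"
        using measurable_space[OF mixs] by auto
      finally show ?thesis by (simp add: e2_def)
    qed
    finally show ?thesis by (simp add: GG.emeasure_eq_measure ennreal_leI)
  qed
  \<comment> \<open>So far the decoder is randomised by \<open>z'\<close>. Its error, summed over
    the message pairs, is bounded in the mean over \<open>z'\<close>, so some fixed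
    \<open>z'\<close> satisfies the same bound and gives an ordinary decoder.\<close>
  define F where "F z' = (\<Sum>m1\<in>I1. \<Sum>m2\<in>I2. emeasure ?G (Pair z' -` E m1 m2))" for z'
  have em [measurable]: "(\<lambda>z'. emeasure ?G (Pair z' -` E m1 m2)) \<in> borel_measurable ?G" for m1 m2
    by (rule G.measurable_emeasure_Pair) (rule E)
  have "(\<integral>\<^sup>+z'. F z' \<partial>?G) = (\<Sum>m1\<in>I1. \<Sum>m2\<in>I2. emeasure (?G \<Otimes>\<^sub>M ?G) (E m1 m2))"
    unfolding F_def by (simp add: nn_integral_sum borel_measurable_sum em G.emeasure_pair_measure_alt)
  also have "\<dots> \<le> (\<Sum>m1\<in>I1. \<Sum>m2\<in>I2. ennreal (e1 m1 m2 + e2 m1 m2))" by (intro sum_mono Ele)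
  also have "\<dots> = ennreal (\<Sum>m1\<in>I1. \<Sum>m2\<in>I2. e1 m1 m2 + e2 m1 m2)"
  proof -
    have "0 \<le> e1 m1 m2 + e2 m1 m2" for m1 m2 by (simp add: e1_def e2_def)
    then show ?thesis by (simp add: sum_ennreal sum_nonneg del: ennreal_plus)
  qed
  finally have intF: "(\<integral>\<^sup>+z'. F z' \<partial>?G) \<le> ennreal (\<Sum>m1\<in>I1. \<Sum>m2\<in>I2. e1 m1 m2 + e2 m1 m2)" .
  have "F \<in> borel_measurable ?G" unfolding F_def by (intro borel_measurable_sum em)
  from G.ex_le_of_nn_integral_le[OF this intF]
  obtain z' where z': "z' \<in> space ?G" "F z' \<le> ennreal (\<Sum>m1\<in>I1. \<Sum>m2\<in>I2. e1 m1 m2 + e2 m1 m2)"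
    by blast
  have "F z' = ennreal (\<Sum>m1\<in>I1. \<Sum>m2\<in>I2. measure ?G {z \<in> space ?G. D z' (r m1 m2 z) \<noteq> (m1, m2)})"
  proof -
    have "Pair z' -` E m1 m2 = {z \<in> space ?G. D z' (r m1 m2 z) \<noteq> (m1, m2)}" for m1 m2
      using z'(1) by (auto simp: E_def space_pair_measure)
    then show ?thesis by (simp add: F_def G.emeasure_eq_measure sum_nonneg)
  qed
  then have "(\<Sum>m1\<in>I1. \<Sum>m2\<in>I2. measure ?G {z \<in> space ?G. D z' (r m1 m2 z) \<noteq> (m1, m2)})
    \<le> (\<Sum>m1\<in>I1. \<Sum>m2\<in>I2. e1 m1 m2) + (\<Sum>m1\<in>I1. \<Sum>m2\<in>I2. e2 m1 m2)"
  proof -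
    assume eq: "F z' = ennreal (\<Sum>m1\<in>I1. \<Sum>m2\<in>I2. measure ?G {z \<in> space ?G. D z' (r m1 m2 z) \<noteq> (m1, m2)})"
    have "0 \<le> (\<Sum>m1\<in>I1. \<Sum>m2\<in>I2. e1 m1 m2 + e2 m1 m2)"
      by (intro sum_nonneg add_nonneg_nonneg) (simp_all add: e1_def e2_def)
    from ennreal_le_iff[OF this] show ?thesis using z'(2) unfolding eq by (simp add: sum.distrib)
  qed
  then have "average_error H1 H2 n I1 I2 f1 f2 (\<lambda>y m1 m2. D z' y \<noteq> (m1, m2))
      \<le> average_error H1 H2 n I1 I2 f1 f2 (\<lambda>y m1 m2. g1 y \<noteq> m1) + average_error H3 H4 n I1 I2 f1 f2 (\<lambda>y m1 m2. g2 y \<noteq> m2)"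
    using c by (simp add: average_error_def r_def e1_def e2_def add_divide_distrib[symmetric] divide_right_mono)
  moreover have "z' \<in> space ?B" using z'(1) by (simp add: space_PiM)
  ultimately show thesis using that D1 by blast
qed

section \<open>The rate region and its closedness\<close>

abbreviation (input) rate1 :: "real^'m^'n \<Rightarrow> real^'m^'m \<Rightarrow> real" where
  "rate1 A S \<equiv> 1/2 * ln (det (mat 1 + A ** S ** transpose A))"

abbreviation (input) rate2 :: "real^'m^'n \<Rightarrow> real^'m^'m \<Rightarrow> real^'k^'n \<Rightarrow> real^'k^'k \<Rightarrow> real" where
  "rate2 A S B T \<equiv> 1/2 * ln (det (mat 1 + A ** S ** transpose A + B ** T ** transpose B))"

definition rate_region :: "real^'t^'r \<Rightarrow> real^'r^'r \<Rightarrow> real^'t^'r \<Rightarrow> real^'r^'r \<Rightarrow> real \<Rightarrow> real \<Rightarrow> (real \<times> real) set" where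
  "rate_region H1 H2 H3 H4 P1 P2 =
    (\<Union>(S1, S2) \<in> {(S1 :: real^'t^'t, S2 :: real^'r^'r).
          pos_semidef S1 \<and> pos_semidef S2 \<and> trace S1 \<le> P1 \<and> trace S2 \<le> P2}.
       {(R1, R2). 0 \<le> R1 \<and> 0 \<le> R2 \<and>
          R1 \<le> rate1 H1 S1 \<and>
          R2 \<le> rate1 H4 S2 \<and>
          R1 + R2 \<le> rate2 H1 S1 H2 S2 \<and>
          R1 + R2 \<le> rate2 H3 S1 H4 S2})"

lemma rate_region_iff:
  fixes H1 H3 :: "real^'t^'r" and H2 H4 :: "real^'r^'r"
  shows "(R1, R2) \<in> rate_region H1 H2 H3 H4 P1 P2 \<longleftrightarrow> (\<exists>(S1 :: real^'t^'t) (S2 :: real^'r^'r).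
    pos_semidef S1 \<and> pos_semidef S2 \<and> trace S1 \<le> P1 \<and> trace S2 \<le> P2 \<and> 0 \<le> R1 \<and> 0 \<le> R2 \<and>
    R1 \<le> rate1 H1 S1 \<and>
    R2 \<le> rate1 H4 S2 \<and>
    R1 + R2 \<le> rate2 H1 S1 H2 S2 \<and>
    R1 + R2 \<le> rate2 H3 S1 H4 S2)"
  unfolding rate_region_def UN_iff Bex_def split_paired_Ex mem_Collect_eq case_prod_conv by blast

text \<open>Rates that obey the four constraints up to vanishing errors, with covariances varying
  along the sequence, still lie in the region. The sequences \<open>a\<close>, \<open>b\<close>,
  \<open>c\<close>, \<open>d\<close> are kept general so that the lemma gives both closedness and
  the converse, where the covariances come from codes of growing length.\<close>

lemma rate_region_limit:
  fixes H1 H3 :: "real^'t^'r" and H2 H4 :: "real^'r^'r"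
  assumes S1: "\<And>k. pos_semidef (S1 k)" "\<And>k. trace (S1 k) \<le> P1"
    and S2: "\<And>k. pos_semidef (S2 k)" "\<And>k. trace (S2 k) \<le> P2"
    and R: "0 \<le> R1" "0 \<le> R2"
    and a: "a \<longlonglongrightarrow> R1" "\<And>k. a k \<le> rate1 H1 (S1 k)"
    and b: "b \<longlonglongrightarrow> R2" "\<And>k. b k \<le> rate1 H4 (S2 k)"
    and c: "c \<longlonglongrightarrow> R1 + R2" "\<And>k. c k \<le> rate2 H1 (S1 k) H2 (S2 k)"
    and d: "d \<longlonglongrightarrow> R1 + R2" "\<And>k. d k \<le> rate2 H3 (S1 k) H4 (S2 k)"
  shows "(R1, R2) \<in> rate_region H1 H2 H3 H4 P1 P2"
proof -
  define K where "K = {S :: real^'t^'t. pos_semidef S \<and> trace S \<le> P1} \<times> {S :: real^'r^'r. pos_semidef S \<and> trace S \<le> P2}"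
  have "compact K" unfolding K_def by (intro compact_Times compact_pos_semidef_trace)
  then have "seq_compact K" by (simp add: compact_eq_seq_compact_metric)
  moreover have "\<forall>k. (\<lambda>k. (S1 k, S2 k)) k \<in> K" using S1 S2 by (auto simp: K_def)
  ultimately obtain l and r :: "nat \<Rightarrow> nat" where l: "l \<in> K" and r: "strict_mono r" and lim: "((\<lambda>k. (S1 k, S2 k)) \<circ> r) \<longlonglongrightarrow> l"
    by (rule seq_compactE)
  have limit: "R \<le> F l" if F: "continuous_on K F" and q: "q \<longlonglongrightarrow> R" "\<And>k. q k \<le> F (S1 k, S2 k)" for F :: "_ \<Rightarrow> real" and q R
  proof (rule LIMSEQ_le)
    show "(q \<circ> r) \<longlonglongrightarrow> R" by (rule LIMSEQ_subseq_LIMSEQ[OF q(1) r])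
    show "(\<lambda>k. F (((\<lambda>k. (S1 k, S2 k)) \<circ> r) k)) \<longlonglongrightarrow> F l"
      by (rule continuous_on_tendsto_compose[OF F lim l]) (use S1 S2 in \<open>auto simp: K_def\<close>)
    show "\<exists>N. \<forall>n\<ge>N. (q \<circ> r) n \<le> F (((\<lambda>k. (S1 k, S2 k)) \<circ> r) n)" using q(2) by simp
  qed
  have cont: "continuous_on K (\<lambda>p. rate1 H1 (fst p))"
      "continuous_on K (\<lambda>p. rate1 H4 (snd p))"
      "continuous_on K (\<lambda>p. rate2 H1 (fst p) H2 (snd p))"
      "continuous_on K (\<lambda>p. rate2 H3 (fst p) H4 (snd p))"
  proof -
    have pd1: "det (mat 1 + A ** fst p ** transpose A) \<noteq> 0" if "p \<in> K" for p and A :: "real^'t^'r"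
      using that unfolding K_def
      by (auto intro!: less_imp_neq[symmetric] pos_def_det pos_def_add pos_semidef_congruence)
    have pd2: "det (mat 1 + A ** snd p ** transpose A) \<noteq> 0" if "p \<in> K" for p and A :: "real^'r^'r"
      using that unfolding K_def
      by (auto intro!: less_imp_neq[symmetric] pos_def_det pos_def_add pos_semidef_congruence)
    have pd3: "det (mat 1 + A ** fst p ** transpose A + B ** snd p ** transpose B) \<noteq> 0" if "p \<in> K" for p and A :: "real^'t^'r" and B :: "real^'r^'r"
      using that unfolding K_def
      by (auto intro!: less_imp_neq[symmetric] pos_def_det pos_def_add pos_semidef_congruence)
    show "continuous_on K (\<lambda>p. rate1 H1 (fst p))"
      "continuous_on K (\<lambda>p. rate1 H4 (snd p))"
      "continuous_on K (\<lambda>p. rate2 H1 (fst p) H2 (snd p))"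
      "continuous_on K (\<lambda>p. rate2 H3 (fst p) H4 (snd p))"
      by (intro continuous_intros ballI pd1 pd2 pd3; assumption)+
  qed
  note l1 = limit[OF cont(1) a(1)] and l2 = limit[OF cont(2) b(1)]
    and l3 = limit[OF cont(3) c(1)] and l4 = limit[OF cont(4) d(1)]
  have "pos_semidef (fst l)" "pos_semidef (snd l)" "trace (fst l) \<le> P1" "trace (snd l) \<le> P2"
    using l by (auto simp: K_def)
  moreover have "R1 \<le> rate1 H1 (fst l)" using l1 a(2) by simp
  moreover have "R2 \<le> rate1 H4 (snd l)" using l2 b(2) by simp
  moreover have "R1 + R2 \<le> rate2 H1 (fst l) H2 (snd l)"
    using l3 c(2) by simp
  moreover have "R1 + R2 \<le> rate2 H3 (fst l) H4 (snd l)"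
    using l4 d(2) by simp
  ultimately show ?thesis using R unfolding rate_region_iff by blast
qed

lemma closed_rate_region:
  fixes H1 H3 :: "real^'t^'r" and H2 H4 :: "real^'r^'r"
  shows "closed (rate_region H1 H2 H3 H4 P1 P2)"
  unfolding closed_sequential_limits
proof (intro allI impI, elim conjE)
  fix x :: "nat \<Rightarrow> real \<times> real" and l
  assume x: "\<forall>k. x k \<in> rate_region H1 H2 H3 H4 P1 P2" and lim: "x \<longlonglongrightarrow> l"
  have "\<forall>k. (fst (x k), snd (x k)) \<in> rate_region H1 H2 H3 H4 P1 P2" using x by simp
  then obtain S1 :: "nat \<Rightarrow> real^'t^'t" and S2 :: "nat \<Rightarrow> real^'r^'r" where
    S: "\<And>k. pos_semidef (S1 k)" "\<And>k. pos_semidef (S2 k)" "\<And>k. trace (S1 k) \<le> P1" "\<And>k. trace (S2 k) \<le> P2"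
      "\<And>k. 0 \<le> fst (x k)" "\<And>k. 0 \<le> snd (x k)"
      "\<And>k. fst (x k) \<le> rate1 H1 (S1 k)"
      "\<And>k. snd (x k) \<le> rate1 H4 (S2 k)"
      "\<And>k. fst (x k) + snd (x k) \<le> rate2 H1 (S1 k) H2 (S2 k)"
      "\<And>k. fst (x k) + snd (x k) \<le> rate2 H3 (S1 k) H4 (S2 k)"
    unfolding rate_region_iff choice_iff by blast
  have f: "(\<lambda>k. fst (x k)) \<longlonglongrightarrow> fst l" and s: "(\<lambda>k. snd (x k)) \<longlonglongrightarrow> snd l"
    using lim by (auto intro: tendsto_fst tendsto_snd)
  have fs: "(\<lambda>k. fst (x k) + snd (x k)) \<longlonglongrightarrow> fst l + snd l" by (intro tendsto_add f s)
  have "0 \<le> fst l" using f S(5) by (intro LIMSEQ_le_const) auto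
  moreover have "0 \<le> snd l" using s S(6) by (intro LIMSEQ_le_const) auto
  ultimately have "(fst l, snd l) \<in> rate_region H1 H2 H3 H4 P1 P2"
    using rate_region_limit[OF S(1,3,2,4) _ _ f S(7) s S(8) fs S(9) fs S(10)] by blast
  then show "l \<in> rate_region H1 H2 H3 H4 P1 P2" by simp
qed

lemma achievable_imp_rate_region:
  fixes H1 H3 :: "real^'t^'r" and H2 H4 :: "real^'r^'r"
    and N :: "((real^'r) \<times> (real^'r)) measure"
  assumes N: "noise_law N"
    and ge24: "transpose H2 ** H2 \<succeq> transpose H4 ** H4"
    and ge31: "transpose H3 ** H3 \<succeq> transpose H1 ** H1"
    and ach: "achievable H1 H2 H3 H4 N P1 P2 R1 R2"
  shows "(R1, R2) \<in> rate_region H1 H2 H3 H4 P1 P2"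
proof -
  obtain f1 f2 g1 g2 where R: "0 \<le> R1" "0 \<le> R2"
    and code: "\<And>n. n > 0 \<Longrightarrow> power_constraint P1 R1 n (f1 n)" "\<And>n. n > 0 \<Longrightarrow> power_constraint P2 R2 n (f2 n)"
      "\<And>n. n > 0 \<Longrightarrow> decoder R1 n (g1 n)" "\<And>n. n > 0 \<Longrightarrow> decoder R2 n (g2 n)"
    and err: "(\<lambda>n. error1 H1 H2 N R1 R2 n (f1 n) (f2 n) (g1 n)) \<longlonglongrightarrow> 0"
      "(\<lambda>n. error2 H3 H4 N R1 R2 n (f1 n) (f2 n) (g2 n)) \<longlonglongrightarrow> 0"
    using ach unfolding achievable_def by blast
  obtain K where K: "H4 = K ** H2" "pos_semidef (mat 1 - K ** transpose K)"
    using loewner_ge_gram_factor[OF ge24] .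
  obtain K' where K': "H1 = K' ** H3" "pos_semidef (mat 1 - K' ** transpose K')"
    using loewner_ge_gram_factor[OF ge31] .
  define I1 where "I1 n = messages R1 n" for n
  define I2 where "I2 n = messages R2 n" for n
  have I: "finite (I1 n)" "I1 n \<noteq> {}" "finite (I2 n)" "I2 n \<noteq> {}" for n by (auto simp: I1_def I2_def)
  define S1 where "S1 n = codeword_cov (I1 n) n (f1 n)" for n
  define S2 where "S2 n = codeword_cov (I2 n) n (f2 n)" for n
  define e1 where "e1 n = error1 H1 H2 N R1 R2 n (f1 n) (f2 n) (g1 n)" for n
  define e2 where "e2 n = error2 H3 H4 N R1 R2 n (f1 n) (f2 n) (g2 n)" for n
  have e1: "e1 n = average_error H1 H2 n (I1 n) (I2 n) (f1 n) (f2 n) (\<lambda>y m1 m2. g1 n y \<noteq> m1)" if "n > 0" for n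
    unfolding e1_def I1_def I2_def by (rule error1_average[OF N code(3)[OF that]])
  have e2: "e2 n = average_error H3 H4 n (I1 n) (I2 n) (f1 n) (f2 n) (\<lambda>y m1 m2. g2 n y \<noteq> m2)" if "n > 0" for n
    unfolding e2_def I1_def I2_def by (rule error2_average[OF N code(4)[OF that]])
  have e2': "e2 n = average_error H4 H3 n (I2 n) (I1 n) (f2 n) (f1 n) (\<lambda>y m2 m1. g2 n y \<noteq> m2)" if "n > 0" for n
    by (simp add: e2[OF that] average_error_swap[of H3 H4])
  have e1': "e1 n = average_error H2 H1 n (I2 n) (I1 n) (f2 n) (f1 n) (\<lambda>y m2 m1. g1 n y \<noteq> m1)" if "n > 0" for n
    by (simp add: e1[OF that] average_error_swap[of H1 H2])
  have tr: "trace (S1 n) \<le> P1" "trace (S2 n) \<le> P2" if "n > 0" for n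
    using order_trans[OF trace_codeword_cov_le[OF I(1,2)[of n], of n "f1 n"]] code(1)[OF that]
      order_trans[OF trace_codeword_cov_le[OF I(3,4)[of n], of n "f2 n"]] code(2)[OF that]
    unfolding S1_def S2_def power_constraint_def I1_def I2_def expectation_message_law by blast+
  have lnM: "real n * R1 \<le> ln (real (card (I1 n)))" "real n * R2 \<le> ln (real (card (I2 n)))" for n
    using card_messages_ge[of n R1] card_messages_ge[of n R2] card_messages_pos[of R1 n] card_messages_pos[of R2 n]
    by (simp_all add: I1_def I2_def ln_ge_iff)
  have lnMM: "real n * (R1 + R2) \<le> ln (real (card (I1 n)) * real (card (I2 n)))" for n
    using lnM[of n] card_messages_pos[of R1 n] card_messages_pos[of R2 n]
    by (simp add: I1_def I2_def ln_mult distrib_left)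
  \<comment> \<open>\<open>e'\<close> is the error of the decoder at hand and \<open>e\<close> an
    upper bound for it; for the joint decoders only the bound \<open>e1 n + e2 n\<close> is known,
    and it may exceed 1. Weakening \<open>e'\<close> to \<open>e\<close> relies on
    \<open>0 \<le> R\<close>, weakening \<open>y\<close> to \<open>real n * R\<close> on
    \<open>e' \<le> 1\<close>.\<close>
  have scale: "(1 - e) * R - ln 2 / real n \<le> 1/2 * x"
    if "n > 0" "e' \<le> e" "e' \<le> 1" "0 \<le> R" "real n * R \<le> y" "(1 - e') * y \<le> ln 2 + real n / 2 * x" for n e e' R x y
  proof -
    have "(1 - e) * (real n * R) \<le> (1 - e') * (real n * R)" using that by (intro mult_right_mono) auto
    also have "\<dots> \<le> (1 - e') * y" using that by (intro mult_left_mono) auto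
    also have "\<dots> \<le> ln 2 + real n / 2 * x" by fact
    finally show ?thesis using that(1) by (simp add: field_simps)
  qed
  have A: "(1 - e1 n) * R1 - ln 2 / real n \<le> rate1 H1 (S1 n)" if n: "n > 0" for n
  proof (rule scale[OF n order.refl _ R(1) lnM(1)[of n]])
    show "e1 n \<le> 1" unfolding e1[OF n] by (rule average_error_le_1[OF I(1,3)[of n]])
    show "(1 - e1 n) * ln (real (card (I1 n))) \<le> ln 2 + real n / 2 * ln (det (mat 1 + H1 ** S1 n ** transpose H1))"
      unfolding e1[OF n] S1_def by (rule converse_single[OF I[of n] n decoder_measurable[OF code(3)[OF n]]])
  qed
  have B: "(1 - e2 n) * R2 - ln 2 / real n \<le> rate1 H4 (S2 n)" if n: "n > 0" for n
  proof (rule scale[OF n order.refl _ R(2) lnM(2)[of n]])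
    show "e2 n \<le> 1" unfolding e2[OF n] by (rule average_error_le_1[OF I(1,3)[of n]])
    show "(1 - e2 n) * ln (real (card (I2 n))) \<le> ln 2 + real n / 2 * ln (det (mat 1 + H4 ** S2 n ** transpose H4))"
      unfolding e2'[OF n] S2_def by (rule converse_single[OF I(3,4,1,2)[of n] n decoder_measurable[OF code(4)[OF n]]])
  qed
  have RR: "0 \<le> R1 + R2" using R by simp
  have C: "(1 - (e1 n + e2 n)) * (R1 + R2) - ln 2 / real n
      \<le> rate2 H1 (S1 n) H2 (S2 n)" if n: "n > 0" for n
  proof -
    obtain D where D: "D \<in> measurable (\<Pi>\<^sub>M j\<in>{..<n}. borel) (count_space UNIV)"
      "average_error H1 H2 n (I1 n) (I2 n) (f1 n) (f2 n) (\<lambda>y m1 m2. D y \<noteq> (m1, m2)) \<le> e1 n + e2 n"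
      using degraded_joint_decoder[OF K I[of n] decoder_measurable[OF code(3)[OF n]] decoder_measurable[OF code(4)[OF n]],
          of H1 "f1 n" "f2 n" H3] unfolding e1[OF n] e2[OF n] by metis
    show ?thesis
      by (rule scale[OF n D(2) average_error_le_1[OF I(1,3)[of n]] RR lnMM[of n] converse_joint[OF I[of n] n D(1), of H1 H2 "f1 n" "f2 n", folded S1_def S2_def]])
  qed
  have D: "(1 - (e1 n + e2 n)) * (R1 + R2) - ln 2 / real n
      \<le> rate2 H3 (S1 n) H4 (S2 n)" if n: "n > 0" for n
  proof -
    \<comment> \<open>The other Loewner inequality, with the users exchanged: receiver 2 removes the
      second user's signal and degrades the rest to the output of receiver 1.\<close>
    obtain D where D: "D \<in> measurable (\<Pi>\<^sub>M j\<in>{..<n}. borel) (count_space UNIV)"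
      "average_error H4 H3 n (I2 n) (I1 n) (f2 n) (f1 n) (\<lambda>y m2 m1. D y \<noteq> (m2, m1)) \<le> e2 n + e1 n"
      using degraded_joint_decoder[OF K' I(3,4,1,2)[of n] decoder_measurable[OF code(4)[OF n]] decoder_measurable[OF code(3)[OF n]],
          of H4 "f2 n" "f1 n" H2] unfolding e1'[OF n] e2'[OF n] by metis
    have "(1 - (e1 n + e2 n)) * (R1 + R2) - ln 2 / real n
      \<le> rate2 H4 (S2 n) H3 (S1 n)"
      using lnMM[of n] D(2)
      by (intro scale[OF n _ average_error_le_1[OF I(3,1)[of n]] RR _ converse_joint[OF I(3,4,1,2)[of n] n D(1), of H4 H3 "f2 n" "f1 n", folded S1_def S2_def]])
        (simp_all add: mult.commute add.commute)
    then show ?thesis by (simp add: ac_simps)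
  qed
  have e: "(\<lambda>k. e1 (Suc k)) \<longlonglongrightarrow> 0" "(\<lambda>k. e2 (Suc k)) \<longlonglongrightarrow> 0"
    using LIMSEQ_Suc[OF err(1)] LIMSEQ_Suc[OF err(2)] unfolding e1_def e2_def by simp_all
  have l2: "(\<lambda>k. ln 2 / real (Suc k)) \<longlonglongrightarrow> 0"
    using tendsto_mult_right_zero[OF LIMSEQ_inverse_real_of_nat, of "ln 2"] by (simp add: divide_inverse)
  show ?thesis
  \<comment> \<open>Codes are constrained only for positive block lengths, hence the shift to
    \<open>Suc k\<close>.\<close>
  proof (rule rate_region_limit[where ?S1.0 = "\<lambda>k. S1 (Suc k)" and ?S2.0 = "\<lambda>k. S2 (Suc k)"
        and a = "\<lambda>k. (1 - e1 (Suc k)) * R1 - ln 2 / real (Suc k)" and b = "\<lambda>k. (1 - e2 (Suc k)) * R2 - ln 2 / real (Suc k)"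
        and c = "\<lambda>k. (1 - (e1 (Suc k) + e2 (Suc k))) * (R1 + R2) - ln 2 / real (Suc k)"
        and d = "\<lambda>k. (1 - (e1 (Suc k) + e2 (Suc k))) * (R1 + R2) - ln 2 / real (Suc k)"])
    have "(\<lambda>k. (1 - e1 (Suc k)) * R1 - ln 2 / real (Suc k)) \<longlonglongrightarrow> (1 - 0) * R1 - 0"
      by (intro tendsto_intros e l2)
    then show "(\<lambda>k. (1 - e1 (Suc k)) * R1 - ln 2 / real (Suc k)) \<longlonglongrightarrow> R1" by simp
    have "(\<lambda>k. (1 - e2 (Suc k)) * R2 - ln 2 / real (Suc k)) \<longlonglongrightarrow> (1 - 0) * R2 - 0"
      by (intro tendsto_intros e l2)
    then show "(\<lambda>k. (1 - e2 (Suc k)) * R2 - ln 2 / real (Suc k)) \<longlonglongrightarrow> R2" by simp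
    have "(\<lambda>k. (1 - (e1 (Suc k) + e2 (Suc k))) * (R1 + R2) - ln 2 / real (Suc k)) \<longlonglongrightarrow> (1 - (0 + 0)) * (R1 + R2) - 0"
      by (intro tendsto_intros e l2)
    then show "(\<lambda>k. (1 - (e1 (Suc k) + e2 (Suc k))) * (R1 + R2) - ln 2 / real (Suc k)) \<longlonglongrightarrow> R1 + R2" by simp
    then show "(\<lambda>k. (1 - (e1 (Suc k) + e2 (Suc k))) * (R1 + R2) - ln 2 / real (Suc k)) \<longlonglongrightarrow> R1 + R2" .
  qed (use R tr A B C D in \<open>auto simp: S1_def S2_def pos_semidef_codeword_cov simp del: of_nat_Suc\<close>)
qed

section \<open>Random coding\<close>

lemma nn_integral_PiM_component:
  assumes "prob_space M" "i \<in> I" "f \<in> borel_measurable M"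
  shows "(\<integral>\<^sup>+c. f (c i) \<partial>(\<Pi>\<^sub>M i\<in>I. M)) = (\<integral>\<^sup>+x. f x \<partial>M)"
proof -
  have "(\<integral>\<^sup>+x. f x \<partial>M) = (\<integral>\<^sup>+x. f x \<partial>distr (\<Pi>\<^sub>M i\<in>I. M) M (\<lambda>c. c i))"
    using distr_PiM_component[of I "\<lambda>_. M" i] assms by simp
  also have "\<dots> = (\<integral>\<^sup>+c. f (c i) \<partial>(\<Pi>\<^sub>M i\<in>I. M))"
    using assms by (subst nn_integral_distr) (auto intro: measurable_component_singleton)
  finally show ?thesis ..
qed

lemma nn_integral_PiM_pair_components:
  assumes M: "prob_space M" and ij: "i \<in> I" "j \<in> I" "i \<noteq> j" and f: "case_prod f \<in> borel_measurable (M \<Otimes>\<^sub>M M)"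
  shows "(\<integral>\<^sup>+c. f (c i) (c j) \<partial>(\<Pi>\<^sub>M i\<in>I. M)) = (\<integral>\<^sup>+x. \<integral>\<^sup>+y. f x y \<partial>M \<partial>M)"
proof -
  interpret M: prob_space M by fact
  have "(\<integral>\<^sup>+x. \<integral>\<^sup>+y. f x y \<partial>M \<partial>M) = (\<integral>\<^sup>+p. case_prod f p \<partial>(M \<Otimes>\<^sub>M M))"
    using f by (subst M.nn_integral_fst[symmetric]) auto
  also have "\<dots> = (\<integral>\<^sup>+p. case_prod f p \<partial>distr (\<Pi>\<^sub>M i\<in>I. M) (M \<Otimes>\<^sub>M M) (\<lambda>c. (c i, c j)))"
    using distr_PiM_pair_components[OF M ij] by simp
  also have "\<dots> = (\<integral>\<^sup>+c. f (c i) (c j) \<partial>(\<Pi>\<^sub>M i\<in>I. M))"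
    using ij f by (subst nn_integral_distr) (auto intro!: measurable_Pair measurable_component_singleton)
  finally show ?thesis ..
qed

lemma nn_integral_add_sums:
  assumes A: "A \<in> borel_measurable M" and B: "\<And>i. i \<in> I \<Longrightarrow> B i \<in> borel_measurable M"
    and D: "\<And>i j. i \<in> I \<Longrightarrow> j \<in> J \<Longrightarrow> D i j \<in> borel_measurable M"
  shows "(\<integral>\<^sup>+x. A x + (\<Sum>i\<in>I. B i x) + (\<Sum>i\<in>I. \<Sum>j\<in>J. D i j x) \<partial>M)
    = (\<integral>\<^sup>+x. A x \<partial>M) + (\<Sum>i\<in>I. \<integral>\<^sup>+x. B i x \<partial>M) + (\<Sum>i\<in>I. \<Sum>j\<in>J. \<integral>\<^sup>+x. D i j x \<partial>M)"
proof -
  have "(\<integral>\<^sup>+x. A x + (\<Sum>i\<in>I. B i x) + (\<Sum>i\<in>I. \<Sum>j\<in>J. D i j x) \<partial>M)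
    = (\<integral>\<^sup>+x. A x \<partial>M) + (\<integral>\<^sup>+x. (\<Sum>i\<in>I. B i x) \<partial>M) + (\<integral>\<^sup>+x. (\<Sum>i\<in>I. \<Sum>j\<in>J. D i j x) \<partial>M)"
    by (subst nn_integral_add, (intro borel_measurable_add borel_measurable_sum A B D; assumption)+,
        subst nn_integral_add, (intro borel_measurable_add borel_measurable_sum A B D; assumption)+, rule refl)
  also have "(\<integral>\<^sup>+x. (\<Sum>i\<in>I. B i x) \<partial>M) = (\<Sum>i\<in>I. \<integral>\<^sup>+x. B i x \<partial>M)"
    by (intro nn_integral_sum B)
  also have "(\<integral>\<^sup>+x. (\<Sum>i\<in>I. \<Sum>j\<in>J. D i j x) \<partial>M) = (\<Sum>i\<in>I. \<integral>\<^sup>+x. (\<Sum>j\<in>J. D i j x) \<partial>M)"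
    by (intro nn_integral_sum borel_measurable_sum D)
  also have "\<dots> = (\<Sum>i\<in>I. \<Sum>j\<in>J. \<integral>\<^sup>+x. D i j x \<partial>M)"
    by (intro sum.cong refl nn_integral_sum D)
  finally show ?thesis .
qed

text \<open>A user with codebook \<open>c1\<close> is decoded in the presence of an interferer with codebook \<open>c2\<close>:
  the decoder looks for a codeword of the user that passes the tests together with some codeword of the
  interferer. Test \<open>T1\<close> excludes wrong user codewords paired with the transmitted interferer codeword,
  test \<open>T2\<close> those paired with another one; the interferer's message itself is not decoded.\<close>

locale joint_decoding = X: prob_space X + V: prob_space V + Z: prob_space Z
  for X :: "'x measure" and V :: "'v measure" and Z :: "'z measure" +
  fixes Y :: "'y measure" and channel :: "'x \<Rightarrow> 'v \<Rightarrow> 'z \<Rightarrow> 'y" and T1 T2 :: "'x \<Rightarrow> 'v \<Rightarrow> 'y \<Rightarrow> bool"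
    and a b \<eta> :: ennreal
  assumes channel_measurable: "(\<lambda>(x, v, z). channel x v z) \<in> measurable (X \<Otimes>\<^sub>M V \<Otimes>\<^sub>M Z) Y"
    and T1_measurable: "Measurable.pred (X \<Otimes>\<^sub>M V \<Otimes>\<^sub>M Y) (\<lambda>(x, v, y). T1 x v y)"
    and T2_measurable: "Measurable.pred (X \<Otimes>\<^sub>M V \<Otimes>\<^sub>M Y) (\<lambda>(x, v, y). T2 x v y)"
    and T1_bound: "v \<in> space V \<Longrightarrow> y \<in> space Y \<Longrightarrow> emeasure X {x \<in> space X. T1 x v y} \<le> a"
    and T2_bound: "y \<in> space Y \<Longrightarrow> emeasure (X \<Otimes>\<^sub>M V) {q \<in> space (X \<Otimes>\<^sub>M V). T2 (fst q) (snd q) y} \<le> b"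
    and true_bound: "emeasure (X \<Otimes>\<^sub>M V \<Otimes>\<^sub>M Z) {q \<in> space (X \<Otimes>\<^sub>M V \<Otimes>\<^sub>M Z).
      \<not> (T1 (fst q) (fst (snd q)) (channel (fst q) (fst (snd q)) (snd (snd q))) \<and>
         T2 (fst q) (fst (snd q)) (channel (fst q) (fst (snd q)) (snd (snd q))))} \<le> \<eta>"
begin

sublocale VZ: pair_prob_space V Z ..
sublocale XV: pair_prob_space X V ..
sublocale XVZ: pair_sigma_finite X "V \<Otimes>\<^sub>M Z" ..

lemma channel_comp:
  "f \<in> measurable K X \<Longrightarrow> g \<in> measurable K V \<Longrightarrow> h \<in> measurable K Z \<Longrightarrow> (\<lambda>k. channel (f k) (g k) (h k)) \<in> measurable K Y"
  using measurable_compose[OF _ channel_measurable, of "\<lambda>k. (f k, g k, h k)" K] by simp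

lemma T1_comp [measurable (raw)]:
  "f \<in> measurable K X \<Longrightarrow> g \<in> measurable K V \<Longrightarrow> h \<in> measurable K Y \<Longrightarrow> Measurable.pred K (\<lambda>k. T1 (f k) (g k) (h k))"
  using measurable_compose[OF _ T1_measurable, of "\<lambda>k. (f k, g k, h k)" K] by simp

lemma T2_comp [measurable (raw)]:
  "f \<in> measurable K X \<Longrightarrow> g \<in> measurable K V \<Longrightarrow> h \<in> measurable K Y \<Longrightarrow> Measurable.pred K (\<lambda>k. T2 (f k) (g k) (h k))"
  using measurable_compose[OF _ T2_measurable, of "\<lambda>k. (f k, g k, h k)" K] by simp

text \<open>Indicators of the causes of an error, valued in \<open>ennreal\<close> so that their
  integrals are probabilities: the transmitted pair fails a test, or a wrong codeword of the user
  passes, with the true codeword of the interferer (\<open>clash1\<close>) or with a wrong one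
  (\<open>clash2\<close>).\<close>

definition "miss x v z = (if T1 x v (channel x v z) \<and> T2 x v (channel x v z) then 0 else 1 :: ennreal)"
definition "clash1 x x' v z = (if T1 x' v (channel x v z) then 1 else 0 :: ennreal)"
definition "clash2 x x' v v' z = (if T2 x' v' (channel x v z) then 1 else 0 :: ennreal)"

lemma miss_measurable [measurable (raw)]:
  assumes [measurable]: "f \<in> measurable K X" "g \<in> measurable K V" "h \<in> measurable K Z"
  shows "(\<lambda>k. miss (f k) (g k) (h k)) \<in> borel_measurable K"
proof -
  note [measurable] = channel_comp[OF assms]
  show ?thesis unfolding miss_def by measurable
qed

lemma clash1_measurable [measurable (raw)]:
  assumes [measurable]: "f \<in> measurable K X" "f' \<in> measurable K X" "g \<in> measurable K V" "h \<in> measurable K Z"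
  shows "(\<lambda>k. clash1 (f k) (f' k) (g k) (h k)) \<in> borel_measurable K"
proof -
  note [measurable] = channel_comp[OF assms(1,3,4)]
  show ?thesis unfolding clash1_def by measurable
qed

lemma clash2_measurable [measurable (raw)]:
  assumes [measurable]: "f \<in> measurable K X" "f' \<in> measurable K X" "g \<in> measurable K V" "g' \<in> measurable K V" "h \<in> measurable K Z"
  shows "(\<lambda>k. clash2 (f k) (f' k) (g k) (g' k) (h k)) \<in> borel_measurable K"
proof -
  note [measurable] = channel_comp[OF assms(1,3,5)]
  show ?thesis unfolding clash2_def by measurable
qed

lemma channel_space: "x \<in> space X \<Longrightarrow> v \<in> space V \<Longrightarrow> z \<in> space Z \<Longrightarrow> channel x v z \<in> space Y"
  using measurable_space[OF channel_measurable, of "(x, v, z)"] by (simp add: space_pair_measure)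

lemma integral_miss: "(\<integral>\<^sup>+x. \<integral>\<^sup>+v. \<integral>\<^sup>+z. miss x v z \<partial>Z \<partial>V \<partial>X) \<le> \<eta>"
proof -
  let ?E = "{q \<in> space (X \<Otimes>\<^sub>M V \<Otimes>\<^sub>M Z).
      \<not> (T1 (fst q) (fst (snd q)) (channel (fst q) (fst (snd q)) (snd (snd q))) \<and>
         T2 (fst q) (fst (snd q)) (channel (fst q) (fst (snd q)) (snd (snd q))))}"
  have [measurable]: "(\<lambda>q. channel (fst q) (fst (snd q)) (snd (snd q))) \<in> measurable (X \<Otimes>\<^sub>M V \<Otimes>\<^sub>M Z) Y"
    by (intro channel_comp) measurable
  have [measurable]: "?E \<in> sets (X \<Otimes>\<^sub>M V \<Otimes>\<^sub>M Z)" by measurable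
  have "(\<integral>\<^sup>+x. \<integral>\<^sup>+v. \<integral>\<^sup>+z. miss x v z \<partial>Z \<partial>V \<partial>X) = (\<integral>\<^sup>+x. \<integral>\<^sup>+p. miss x (fst p) (snd p) \<partial>(V \<Otimes>\<^sub>M Z) \<partial>X)"
    by (intro nn_integral_cong) (simp add: Z.nn_integral_fst[symmetric])
  also have "\<dots> = (\<integral>\<^sup>+q. miss (fst q) (fst (snd q)) (snd (snd q)) \<partial>(X \<Otimes>\<^sub>M V \<Otimes>\<^sub>M Z))"
    by (simp add: VZ.nn_integral_fst[symmetric])
  also have "\<dots> = (\<integral>\<^sup>+q. indicator ?E q \<partial>(X \<Otimes>\<^sub>M V \<Otimes>\<^sub>M Z))"
    by (intro nn_integral_cong) (auto simp: miss_def indicator_def)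
  also have "\<dots> \<le> \<eta>" using true_bound by simp
  finally show ?thesis .
qed

text \<open>The wrong codeword \<open>x'\<close> is independent of everything that determines the
  output, so it can be integrated first, with \<open>v\<close> and the output fixed, where
  \<open>T1_bound\<close> applies.\<close>

lemma integral_clash1: "(\<integral>\<^sup>+x. \<integral>\<^sup>+x'. \<integral>\<^sup>+v. \<integral>\<^sup>+z. clash1 x x' v z \<partial>Z \<partial>V \<partial>X \<partial>X) \<le> a"
proof -
  have "(\<integral>\<^sup>+x'. \<integral>\<^sup>+v. \<integral>\<^sup>+z. clash1 x x' v z \<partial>Z \<partial>V \<partial>X) \<le> a" if [measurable]: "x \<in> space X" for x
  proof -
    have "(\<integral>\<^sup>+x'. \<integral>\<^sup>+v. \<integral>\<^sup>+z. clash1 x x' v z \<partial>Z \<partial>V \<partial>X)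
      = (\<integral>\<^sup>+x'. \<integral>\<^sup>+p. clash1 x x' (fst p) (snd p) \<partial>(V \<Otimes>\<^sub>M Z) \<partial>X)"
      by (intro nn_integral_cong) (simp add: Z.nn_integral_fst[symmetric])
    also have "\<dots> = (\<integral>\<^sup>+p. \<integral>\<^sup>+x'. clash1 x x' (fst p) (snd p) \<partial>X \<partial>(V \<Otimes>\<^sub>M Z))"
      by (rule XVZ.Fubini'[symmetric]) measurable
    also have "\<dots> \<le> (\<integral>\<^sup>+p. a \<partial>(V \<Otimes>\<^sub>M Z))"
    proof (rule nn_integral_mono)
      fix p assume p: "p \<in> space (V \<Otimes>\<^sub>M Z)"
      then have v: "fst p \<in> space V" "snd p \<in> space Z" by (auto simp: space_pair_measure)
      have y: "channel x (fst p) (snd p) \<in> space Y" using that v by (rule channel_space)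
      have "(\<integral>\<^sup>+x'. clash1 x x' (fst p) (snd p) \<partial>X) = (\<integral>\<^sup>+x'. indicator {x' \<in> space X. T1 x' (fst p) (channel x (fst p) (snd p))} x' \<partial>X)"
        by (intro nn_integral_cong) (auto simp: clash1_def)
      also have "\<dots> = emeasure X {x' \<in> space X. T1 x' (fst p) (channel x (fst p) (snd p))}"
        using v y by (intro nn_integral_indicator) measurable
      also have "\<dots> \<le> a" using v y by (intro T1_bound)
      finally show "(\<integral>\<^sup>+x'. clash1 x x' (fst p) (snd p) \<partial>X) \<le> a" .
    qed
    also have "\<dots> = a" by (simp add: VZ.emeasure_space_1)
    finally show ?thesis .
  qed
  then have "(\<integral>\<^sup>+x. \<integral>\<^sup>+x'. \<integral>\<^sup>+v. \<integral>\<^sup>+z. clash1 x x' v z \<partial>Z \<partial>V \<partial>X \<partial>X) \<le> (\<integral>\<^sup>+x. a \<partial>X)"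
    by (rule nn_integral_mono)
  then show ?thesis by (simp add: X.emeasure_space_1)
qed

text \<open>Here \<open>x'\<close> and \<open>v'\<close> are both independent of the output, and
  \<open>T2_bound\<close> controls the pair for every fixed output.\<close>

lemma integral_clash2: "(\<integral>\<^sup>+x. \<integral>\<^sup>+x'. \<integral>\<^sup>+v. \<integral>\<^sup>+v'. \<integral>\<^sup>+z. clash2 x x' v v' z \<partial>Z \<partial>V \<partial>V \<partial>X \<partial>X) \<le> b"
proof -
  have "(\<integral>\<^sup>+x'. \<integral>\<^sup>+v. \<integral>\<^sup>+v'. \<integral>\<^sup>+z. clash2 x x' v v' z \<partial>Z \<partial>V \<partial>V \<partial>X) \<le> b" if [measurable]: "x \<in> space X" for x
  proof -
    have "(\<integral>\<^sup>+x'. \<integral>\<^sup>+v. \<integral>\<^sup>+v'. \<integral>\<^sup>+z. clash2 x x' v v' z \<partial>Z \<partial>V \<partial>V \<partial>X)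
      = (\<integral>\<^sup>+x'. \<integral>\<^sup>+v. \<integral>\<^sup>+z. \<integral>\<^sup>+v'. clash2 x x' v v' z \<partial>V \<partial>Z \<partial>V \<partial>X)"
      by (intro nn_integral_cong VZ.Fubini'[symmetric]) measurable
    also have "\<dots> = (\<integral>\<^sup>+x'. \<integral>\<^sup>+p. \<integral>\<^sup>+v'. clash2 x x' (fst p) v' (snd p) \<partial>V \<partial>(V \<Otimes>\<^sub>M Z) \<partial>X)"
      by (intro nn_integral_cong) (simp add: Z.nn_integral_fst[symmetric])
    also have "\<dots> = (\<integral>\<^sup>+p. \<integral>\<^sup>+x'. \<integral>\<^sup>+v'. clash2 x x' (fst p) v' (snd p) \<partial>V \<partial>X \<partial>(V \<Otimes>\<^sub>M Z))"
      by (rule XVZ.Fubini'[symmetric]) measurable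
    also have "\<dots> \<le> (\<integral>\<^sup>+p. b \<partial>(V \<Otimes>\<^sub>M Z))"
    proof (rule nn_integral_mono)
      fix p assume p: "p \<in> space (V \<Otimes>\<^sub>M Z)"
      then have v: "fst p \<in> space V" "snd p \<in> space Z" by (auto simp: space_pair_measure)
      define y where "y = channel x (fst p) (snd p)"
      have y [measurable]: "y \<in> space Y" unfolding y_def using that v by (rule channel_space)
      have "(\<integral>\<^sup>+x'. \<integral>\<^sup>+v'. clash2 x x' (fst p) v' (snd p) \<partial>V \<partial>X) = (\<integral>\<^sup>+q. (if T2 (fst q) (snd q) y then 1 else 0) \<partial>(X \<Otimes>\<^sub>M V))"
        by (subst V.nn_integral_fst[symmetric]) (simp_all add: clash2_def y_def[symmetric])
      also have "\<dots> = (\<integral>\<^sup>+q. indicator {q \<in> space (X \<Otimes>\<^sub>M V). T2 (fst q) (snd q) y} q \<partial>(X \<Otimes>\<^sub>M V))"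
        by (intro nn_integral_cong) (auto simp: indicator_def)
      also have "\<dots> = emeasure (X \<Otimes>\<^sub>M V) {q \<in> space (X \<Otimes>\<^sub>M V). T2 (fst q) (snd q) y}"
        by (intro nn_integral_indicator) measurable
      also have "\<dots> \<le> b" using y by (intro T2_bound)
      finally show "(\<integral>\<^sup>+x'. \<integral>\<^sup>+v'. clash2 x x' (fst p) v' (snd p) \<partial>V \<partial>X) \<le> b" .
    qed
    also have "\<dots> = b" by (simp add: VZ.emeasure_space_1)
    finally show ?thesis .
  qed
  then have "(\<integral>\<^sup>+x. \<integral>\<^sup>+x'. \<integral>\<^sup>+v. \<integral>\<^sup>+v'. \<integral>\<^sup>+z. clash2 x x' v v' z \<partial>Z \<partial>V \<partial>V \<partial>X \<partial>X) \<le> (\<integral>\<^sup>+x. b \<partial>X)"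
    by (rule nn_integral_mono)
  then show ?thesis by (simp add: X.emeasure_space_1)
qed

text \<open>Union bound for fixed codebooks and messages. Being a sum of terms with at most two
  codewords of each user, it has a mean over random codebooks that can be bounded term by
  term.\<close>

definition pair_bound :: "nat \<Rightarrow> nat \<Rightarrow> (nat \<Rightarrow> 'x) \<Rightarrow> (nat \<Rightarrow> 'v) \<Rightarrow> nat \<Rightarrow> nat \<Rightarrow> ennreal" where
  "pair_bound M1 M2 c1 c2 m1 m2 = (\<integral>\<^sup>+z. miss (c1 m1) (c2 m2) z \<partial>Z)
     + (\<Sum>m1'\<in>{..<M1} - {m1}. \<integral>\<^sup>+z. clash1 (c1 m1) (c1 m1') (c2 m2) z \<partial>Z)
     + (\<Sum>m1'\<in>{..<M1} - {m1}. \<Sum>m2'\<in>{..<M2} - {m2}. \<integral>\<^sup>+z. clash2 (c1 m1) (c1 m1') (c2 m2) (c2 m2') z \<partial>Z)"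

definition codebook_bound :: "nat \<Rightarrow> nat \<Rightarrow> (nat \<Rightarrow> 'x) \<times> (nat \<Rightarrow> 'v) \<Rightarrow> ennreal" where
  "codebook_bound M1 M2 c = (\<Sum>m1<M1. \<Sum>m2<M2. pair_bound M1 M2 (fst c) (snd c) m1 m2) / ennreal (real M1 * real M2)"

abbreviation "C1 M1 \<equiv> \<Pi>\<^sub>M m\<in>{..<M1 :: nat}. X"
abbreviation "C2 M2 \<equiv> \<Pi>\<^sub>M m\<in>{..<M2 :: nat}. V"

lemma codeword_measurable:
  "m < M1 \<Longrightarrow> (\<lambda>c. c m) \<in> measurable (C1 M1) X"
  "m < M2 \<Longrightarrow> (\<lambda>c. c m) \<in> measurable (C2 M2) V"
  "m < M1 \<Longrightarrow> (\<lambda>c. fst c m) \<in> measurable (C1 M1 \<Otimes>\<^sub>M L) X"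
  "m < M2 \<Longrightarrow> (\<lambda>c. snd c m) \<in> measurable (L' \<Otimes>\<^sub>M C2 M2) V"
  by (auto intro!: measurable_component_singleton measurable_compose[OF measurable_fst, of "\<lambda>c. c m"]
      measurable_compose[OF measurable_snd, of "\<lambda>c. c m"])

lemma pair_bound_measurable [measurable]:
  assumes [measurable]: "m1 < M1" "m2 < M2"
  shows "(\<lambda>c. pair_bound M1 M2 (fst c) (snd c) m1 m2) \<in> borel_measurable (C1 M1 \<Otimes>\<^sub>M C2 M2)"
proof -
  note [measurable] = codeword_measurable
  show ?thesis unfolding pair_bound_def using assms by measurable
qed

lemma codebook_bound_measurable [measurable]: "codebook_bound M1 M2 \<in> borel_measurable (C1 M1 \<Otimes>\<^sub>M C2 M2)"
  unfolding codebook_bound_def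
  by (intro borel_measurable_divide_ennreal borel_measurable_sum pair_bound_measurable) auto

text \<open>Distinct components of a random codebook are independent, so each term averages to one
  of the three integrals above; \<open>a\<close> is then counted at most \<open>M1\<close> times and
  \<open>b\<close> at most \<open>M1 * M2\<close> times.\<close>

lemma integral_pair_bound:
  assumes m: "m1 < M1" "m2 < M2"
  shows "(\<integral>\<^sup>+c. pair_bound M1 M2 (fst c) (snd c) m1 m2 \<partial>(C1 M1 \<Otimes>\<^sub>M C2 M2)) \<le> \<eta> + of_nat M1 * a + of_nat M1 * (of_nat M2 * b)"
proof -
  interpret K2: prob_space "C2 M2" by (intro prob_space_PiM V.prob_space_axioms)
  note [measurable] = codeword_measurable m
  have "(\<integral>\<^sup>+c. (\<integral>\<^sup>+z. miss (fst c m1) (snd c m2) z \<partial>Z) \<partial>(C1 M1 \<Otimes>\<^sub>M C2 M2))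
    = (\<integral>\<^sup>+c1. \<integral>\<^sup>+c2. \<integral>\<^sup>+z. miss (c1 m1) (c2 m2) z \<partial>Z \<partial>C2 M2 \<partial>C1 M1)"
    by (subst K2.nn_integral_fst[symmetric]) (simp_all add: m)
  also have "\<dots> = (\<integral>\<^sup>+c1. \<integral>\<^sup>+v. \<integral>\<^sup>+z. miss (c1 m1) v z \<partial>Z \<partial>V \<partial>C1 M1)"
    using m by (intro nn_integral_cong nn_integral_PiM_component[OF V.prob_space_axioms]) (auto simp: space_PiM)
  also have "\<dots> = (\<integral>\<^sup>+x. \<integral>\<^sup>+v. \<integral>\<^sup>+z. miss x v z \<partial>Z \<partial>V \<partial>X)"
    using m by (intro nn_integral_PiM_component[OF X.prob_space_axioms, of m1 "{..<M1}" "\<lambda>x. \<integral>\<^sup>+v. \<integral>\<^sup>+z. miss x v z \<partial>Z \<partial>V"]) auto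
  finally have 1: "(\<integral>\<^sup>+c. (\<integral>\<^sup>+z. miss (fst c m1) (snd c m2) z \<partial>Z) \<partial>(C1 M1 \<Otimes>\<^sub>M C2 M2)) \<le> \<eta>"
    using integral_miss by simp
  have 2: "(\<integral>\<^sup>+c. (\<integral>\<^sup>+z. clash1 (fst c m1) (fst c m1') (snd c m2) z \<partial>Z) \<partial>(C1 M1 \<Otimes>\<^sub>M C2 M2)) \<le> a"
    if m' [measurable]: "m1' < M1" "m1 \<noteq> m1'" for m1'
  proof -
    have "(\<integral>\<^sup>+c. (\<integral>\<^sup>+z. clash1 (fst c m1) (fst c m1') (snd c m2) z \<partial>Z) \<partial>(C1 M1 \<Otimes>\<^sub>M C2 M2))
      = (\<integral>\<^sup>+c1. \<integral>\<^sup>+c2. \<integral>\<^sup>+z. clash1 (c1 m1) (c1 m1') (c2 m2) z \<partial>Z \<partial>C2 M2 \<partial>C1 M1)"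
      by (subst K2.nn_integral_fst[symmetric]) (simp_all add: m m')
    also have "\<dots> = (\<integral>\<^sup>+c1. \<integral>\<^sup>+v. \<integral>\<^sup>+z. clash1 (c1 m1) (c1 m1') v z \<partial>Z \<partial>V \<partial>C1 M1)"
      using m m' by (intro nn_integral_cong nn_integral_PiM_component[OF V.prob_space_axioms]) (auto simp: space_PiM)
    also have "\<dots> = (\<integral>\<^sup>+x. \<integral>\<^sup>+x'. \<integral>\<^sup>+v. \<integral>\<^sup>+z. clash1 x x' v z \<partial>Z \<partial>V \<partial>X \<partial>X)"
      using m m' by (intro nn_integral_PiM_pair_components[OF X.prob_space_axioms, of m1 "{..<M1}" m1' "\<lambda>x x'. \<integral>\<^sup>+v. \<integral>\<^sup>+z. clash1 x x' v z \<partial>Z \<partial>V"]) auto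
    finally show ?thesis using integral_clash1 by simp
  qed
  have 3: "(\<integral>\<^sup>+c. (\<integral>\<^sup>+z. clash2 (fst c m1) (fst c m1') (snd c m2) (snd c m2') z \<partial>Z) \<partial>(C1 M1 \<Otimes>\<^sub>M C2 M2)) \<le> b"
    if m' [measurable]: "m1' < M1" "m1 \<noteq> m1'" "m2' < M2" "m2 \<noteq> m2'" for m1' m2'
  proof -
    have "(\<integral>\<^sup>+c. (\<integral>\<^sup>+z. clash2 (fst c m1) (fst c m1') (snd c m2) (snd c m2') z \<partial>Z) \<partial>(C1 M1 \<Otimes>\<^sub>M C2 M2))
      = (\<integral>\<^sup>+c1. \<integral>\<^sup>+c2. \<integral>\<^sup>+z. clash2 (c1 m1) (c1 m1') (c2 m2) (c2 m2') z \<partial>Z \<partial>C2 M2 \<partial>C1 M1)"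
      by (subst K2.nn_integral_fst[symmetric]) (simp_all add: m m')
    also have "\<dots> = (\<integral>\<^sup>+c1. \<integral>\<^sup>+v. \<integral>\<^sup>+v'. \<integral>\<^sup>+z. clash2 (c1 m1) (c1 m1') v v' z \<partial>Z \<partial>V \<partial>V \<partial>C1 M1)"
    proof (intro nn_integral_cong)
      fix c1 assume "c1 \<in> space (C1 M1)"
      then have [measurable]: "c1 m1 \<in> space X" "c1 m1' \<in> space X" using m m' by (auto simp: space_PiM)
      show "(\<integral>\<^sup>+c2. \<integral>\<^sup>+z. clash2 (c1 m1) (c1 m1') (c2 m2) (c2 m2') z \<partial>Z \<partial>C2 M2)
        = (\<integral>\<^sup>+v. \<integral>\<^sup>+v'. \<integral>\<^sup>+z. clash2 (c1 m1) (c1 m1') v v' z \<partial>Z \<partial>V \<partial>V)"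
        using m m' by (intro nn_integral_PiM_pair_components[OF V.prob_space_axioms, of m2 "{..<M2}" m2' "\<lambda>v v'. \<integral>\<^sup>+z. clash2 (c1 m1) (c1 m1') v v' z \<partial>Z"]) auto
    qed
    also have "\<dots> = (\<integral>\<^sup>+x. \<integral>\<^sup>+x'. \<integral>\<^sup>+v. \<integral>\<^sup>+v'. \<integral>\<^sup>+z. clash2 x x' v v' z \<partial>Z \<partial>V \<partial>V \<partial>X \<partial>X)"
      using m m' by (intro nn_integral_PiM_pair_components[OF X.prob_space_axioms, of m1 "{..<M1}" m1' "\<lambda>x x'. \<integral>\<^sup>+v. \<integral>\<^sup>+v'. \<integral>\<^sup>+z. clash2 x x' v v' z \<partial>Z \<partial>V \<partial>V"]) auto
    finally show ?thesis using integral_clash2 by simp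
  qed
  have "(\<integral>\<^sup>+c. pair_bound M1 M2 (fst c) (snd c) m1 m2 \<partial>(C1 M1 \<Otimes>\<^sub>M C2 M2))
    = (\<integral>\<^sup>+c. (\<integral>\<^sup>+z. miss (fst c m1) (snd c m2) z \<partial>Z) \<partial>(C1 M1 \<Otimes>\<^sub>M C2 M2))
     + (\<Sum>m1'\<in>{..<M1} - {m1}. \<integral>\<^sup>+c. (\<integral>\<^sup>+z. clash1 (fst c m1) (fst c m1') (snd c m2) z \<partial>Z) \<partial>(C1 M1 \<Otimes>\<^sub>M C2 M2))
     + (\<Sum>m1'\<in>{..<M1} - {m1}. \<Sum>m2'\<in>{..<M2} - {m2}. \<integral>\<^sup>+c. (\<integral>\<^sup>+z. clash2 (fst c m1) (fst c m1') (snd c m2) (snd c m2') z \<partial>Z) \<partial>(C1 M1 \<Otimes>\<^sub>M C2 M2))"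
  proof -
    let ?N = "C1 M1 \<Otimes>\<^sub>M C2 M2"
    note [measurable] = codeword_measurable
    define A where "A c = (\<integral>\<^sup>+z. miss (fst c m1) (snd c m2) z \<partial>Z)" for c
    define B where "B m1' c = (\<integral>\<^sup>+z. clash1 (fst c m1) (fst c m1') (snd c m2) z \<partial>Z)" for m1' c
    define D where "D m1' m2' c = (\<integral>\<^sup>+z. clash2 (fst c m1) (fst c m1') (snd c m2) (snd c m2') z \<partial>Z)" for m1' m2' c
    have A: "A \<in> borel_measurable ?N" unfolding A_def by measurable
    have B: "B m1' \<in> borel_measurable ?N" if "m1' \<in> {..<M1} - {m1}" for m1'
    proof -
      have [measurable]: "m1' < M1" using that by simp
      show ?thesis unfolding B_def by measurable
    qed
    have D: "D m1' m2' \<in> borel_measurable ?N" if "m1' \<in> {..<M1} - {m1}" "m2' \<in> {..<M2} - {m2}" for m1' m2'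
    proof -
      have [measurable]: "m1' < M1" "m2' < M2" using that by auto
      show ?thesis unfolding D_def by measurable
    qed
    from nn_integral_add_sums[OF A B D]
    show ?thesis by (simp only: pair_bound_def A_def B_def D_def)
  qed
  also have "\<dots> \<le> \<eta> + (\<Sum>m1'\<in>{..<M1} - {m1}. a) + (\<Sum>m1'\<in>{..<M1} - {m1}. \<Sum>m2'\<in>{..<M2} - {m2}. b)"
    using 1 2 3 by (intro add_mono sum_mono) auto
  also have "\<dots> \<le> \<eta> + of_nat M1 * a + of_nat M1 * (of_nat M2 * b)"
    using m by (intro add_mono) (auto intro!: mult_mono simp: card_Diff_singleton simp del: of_nat_diff)
  finally show ?thesis .
qed

lemma integral_codebook_bound:
  assumes M: "0 < M1" "0 < M2"
  shows "(\<integral>\<^sup>+c. codebook_bound M1 M2 c \<partial>(C1 M1 \<Otimes>\<^sub>M C2 M2)) \<le> \<eta> + of_nat M1 * a + of_nat M1 * (of_nat M2 * b)" (is "_ \<le> ?t")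
proof -
  have "(\<integral>\<^sup>+c. codebook_bound M1 M2 c \<partial>(C1 M1 \<Otimes>\<^sub>M C2 M2))
    = (\<Sum>m1<M1. \<Sum>m2<M2. \<integral>\<^sup>+c. pair_bound M1 M2 (fst c) (snd c) m1 m2 \<partial>(C1 M1 \<Otimes>\<^sub>M C2 M2)) / ennreal (real M1 * real M2)"
  proof -
    have "(\<integral>\<^sup>+c. (\<Sum>m1<M1. \<Sum>m2<M2. pair_bound M1 M2 (fst c) (snd c) m1 m2) \<partial>(C1 M1 \<Otimes>\<^sub>M C2 M2))
      = (\<Sum>m1<M1. \<integral>\<^sup>+c. (\<Sum>m2<M2. pair_bound M1 M2 (fst c) (snd c) m1 m2) \<partial>(C1 M1 \<Otimes>\<^sub>M C2 M2))"
      by (intro nn_integral_sum borel_measurable_sum pair_bound_measurable) auto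
    also have "\<dots> = (\<Sum>m1<M1. \<Sum>m2<M2. \<integral>\<^sup>+c. pair_bound M1 M2 (fst c) (snd c) m1 m2 \<partial>(C1 M1 \<Otimes>\<^sub>M C2 M2))"
      by (intro sum.cong refl nn_integral_sum pair_bound_measurable) auto
    finally show ?thesis unfolding codebook_bound_def by (subst nn_integral_divide) simp_all
  qed
  also have "\<dots> \<le> (\<Sum>m1<M1. \<Sum>m2<M2. ?t) / ennreal (real M1 * real M2)"
    using integral_pair_bound by (intro divide_right_mono_ennreal sum_mono) auto
  also have "\<dots> = ?t"
  proof -
    have "(\<Sum>m1<M1. \<Sum>m2<M2. ?t) = ?t * ennreal (real M1 * real M2)"
      by (simp add: ennreal_mult' ennreal_of_nat_eq_real_of_nat mult_ac del: ennreal_plus)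
    then show ?thesis using M by (simp only:) (intro ennreal_mult_divide_eq; simp)
  qed
  finally show ?thesis .
qed

text \<open>Any choice among the messages that pass would do for the error bound.
  \<open>LEAST\<close> gives a measurable one, and the default 0 is a message as soon as
  \<open>0 < M1\<close>.\<close>

definition threshold_decoder :: "nat \<Rightarrow> nat \<Rightarrow> (nat \<Rightarrow> 'x) \<Rightarrow> (nat \<Rightarrow> 'v) \<Rightarrow> 'y \<Rightarrow> nat" where
  "threshold_decoder M1 M2 c1 c2 y =
    (if \<exists>m<M1. \<exists>m'<M2. T1 (c1 m) (c2 m') y \<and> T2 (c1 m) (c2 m') y
     then LEAST m. m < M1 \<and> (\<exists>m'<M2. T1 (c1 m) (c2 m') y \<and> T2 (c1 m) (c2 m') y) else 0)"

lemma threshold_decoder_less: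
  assumes "0 < M1"
  shows "threshold_decoder M1 M2 c1 c2 y < M1"
proof (cases "\<exists>m<M1. \<exists>m'<M2. T1 (c1 m) (c2 m') y \<and> T2 (c1 m) (c2 m') y")
  case True
  then have "\<exists>m. m < M1 \<and> (\<exists>m'<M2. T1 (c1 m) (c2 m') y \<and> T2 (c1 m) (c2 m') y)" by blast
  from LeastI_ex[OF this] True show ?thesis by (simp add: threshold_decoder_def)
next
  case False
  then have "threshold_decoder M1 M2 c1 c2 y = 0" unfolding threshold_decoder_def by (rule if_not_P)
  then show ?thesis using assms by simp
qed

lemma threshold_decoder_measurable:
  assumes c: "c1 \<in> space (C1 M1)" "c2 \<in> space (C2 M2)" and M: "0 < M1"
  shows "threshold_decoder M1 M2 c1 c2 \<in> measurable Y (count_space {..<M1})"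
proof -
  have [measurable]: "c1 m \<in> space X" if "m < M1" for m using c that by (auto simp: space_PiM)
  have [measurable]: "c2 m \<in> space V" if "m < M2" for m using c that by (auto simp: space_PiM)
  have p [measurable]: "Measurable.pred Y (\<lambda>y. m < M1 \<and> (\<exists>m'<M2. T1 (c1 m) (c2 m') y \<and> T2 (c1 m) (c2 m') y))" for m
  proof (cases "m < M1")
    case True
    then have [measurable]: "Measurable.pred Y (\<lambda>y. T1 (c1 m) (c2 m') y \<and> T2 (c1 m) (c2 m') y)" if "m' < M2" for m'
      using that by measurable
    have "Measurable.pred Y (\<lambda>y. \<exists>m'\<in>{..<M2}. T1 (c1 m) (c2 m') y \<and> T2 (c1 m) (c2 m') y)"
      by measurable
    then show ?thesis using True by (simp add: Bex_def)
  qed simp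
  have "threshold_decoder M1 M2 c1 c2 \<in> measurable Y (count_space UNIV)"
  proof -
    have "Measurable.pred Y (\<lambda>y. \<exists>m. m < M1 \<and> (\<exists>m'<M2. T1 (c1 m) (c2 m') y \<and> T2 (c1 m) (c2 m') y))" by measurable
    then show ?thesis unfolding threshold_decoder_def by measurable
  qed
  then show ?thesis
    using threshold_decoder_less[OF M] measurable_sets[of "threshold_decoder M1 M2 c1 c2" Y "count_space UNIV"]
    by (subst measurable_count_space_eq_countable) auto
qed

lemma threshold_decoder_error:
  assumes c: "c1 \<in> space (C1 M1)" "c2 \<in> space (C2 M2)" and m: "m1 < M1" "m2 < M2"
  shows "emeasure Z {z \<in> space Z. threshold_decoder M1 M2 c1 c2 (channel (c1 m1) (c2 m2) z) \<noteq> m1}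
    \<le> pair_bound M1 M2 c1 c2 m1 m2"
proof -
  have x [measurable]: "c1 m \<in> space X" if "m < M1" for m using c that by (auto simp: space_PiM)
  have v [measurable]: "c2 m \<in> space V" if "m < M2" for m using c that by (auto simp: space_PiM)
  note [measurable] = x[OF m(1)] v[OF m(2)]
  let ?D = "threshold_decoder M1 M2 c1 c2"
  let ?y = "\<lambda>z. channel (c1 m1) (c2 m2) z"
  have [measurable]: "?D \<in> measurable Y (count_space UNIV)"
    using measurable_compose[OF threshold_decoder_measurable[OF c], of "\<lambda>x. x" "count_space UNIV"] m by auto
  have [measurable]: "?y \<in> measurable Z Y" by (intro channel_comp) measurable
  have "emeasure Z {z \<in> space Z. ?D (?y z) \<noteq> m1} = (\<integral>\<^sup>+z. indicator {z \<in> space Z. ?D (?y z) \<noteq> m1} z \<partial>Z)"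
    by (rule nn_integral_indicator[symmetric]) measurable
  also have "\<dots> \<le> (\<integral>\<^sup>+z. miss (c1 m1) (c2 m2) z
     + (\<Sum>m1'\<in>{..<M1} - {m1}. clash1 (c1 m1) (c1 m1') (c2 m2) z)
     + (\<Sum>m1'\<in>{..<M1} - {m1}. \<Sum>m2'\<in>{..<M2} - {m2}. clash2 (c1 m1) (c1 m1') (c2 m2) (c2 m2') z) \<partial>Z)"
  proof (rule nn_integral_mono)
    fix z assume z: "z \<in> space Z"
    let ?P = "\<lambda>m m'. T1 (c1 m) (c2 m') (?y z) \<and> T2 (c1 m) (c2 m') (?y z)"
    let ?R = "miss (c1 m1) (c2 m2) z
     + (\<Sum>m1'\<in>{..<M1} - {m1}. clash1 (c1 m1) (c1 m1') (c2 m2) z)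
     + (\<Sum>m1'\<in>{..<M1} - {m1}. \<Sum>m2'\<in>{..<M2} - {m2}. clash2 (c1 m1) (c1 m1') (c2 m2) (c2 m2') z)"
    show "indicator {z \<in> space Z. ?D (?y z) \<noteq> m1} z \<le> ?R"
    proof (cases "?D (?y z) = m1 \<or> \<not> ?P m1 m2")
      case True
      then have "indicator {z \<in> space Z. ?D (?y z) \<noteq> m1} z \<le> miss (c1 m1) (c2 m2) z"
        by (auto simp: indicator_def miss_def)
      also have "\<dots> \<le> ?R" unfolding add.assoc by (rule add_increasing2) simp_all
      finally show ?thesis .
    next
      case False
      \<comment> \<open>The transmitted pair passes, so the output was found by the search and some
        \<open>m'\<close> passes together with it. Whether \<open>m'\<close> is the true message of
        the interferer decides which kind of clash has occurred.\<close>
      then have P: "\<exists>m<M1. \<exists>m'<M2. ?P m m'" and ne: "?D (?y z) \<noteq> m1" using m by blast+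
      define l where "l = ?D (?y z)"
      have "l = (LEAST m. m < M1 \<and> (\<exists>m'<M2. ?P m m'))" using P by (simp add: l_def threshold_decoder_def)
      moreover have ex: "\<exists>m. m < M1 \<and> (\<exists>m'<M2. ?P m m')" using P by blast
      ultimately have "l < M1 \<and> (\<exists>m'<M2. ?P l m')" using LeastI_ex[OF ex] by (simp only:)
      then obtain m' where l: "l < M1" "m' < M2" "?P l m'" by blast
      have ne: "l \<noteq> m1" using ne by (simp add: l_def)
      have "1 \<le> ?R"
      proof (cases "m' = m2")
        case True
        have "1 = clash1 (c1 m1) (c1 l) (c2 m2) z" using l True by (simp add: clash1_def)
        also have "\<dots> \<le> (\<Sum>m1'\<in>{..<M1} - {m1}. clash1 (c1 m1) (c1 m1') (c2 m2) z)"
          using l ne by (intro member_le_sum) auto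
        also have "\<dots> \<le> ?R" by (intro add_increasing2[OF _ add_increasing]) simp_all
        finally show ?thesis .
      next
        case False
        have "1 = clash2 (c1 m1) (c1 l) (c2 m2) (c2 m') z" using l by (simp add: clash2_def)
        also have "\<dots> \<le> (\<Sum>m2'\<in>{..<M2} - {m2}. clash2 (c1 m1) (c1 l) (c2 m2) (c2 m2') z)"
          using l False by (intro member_le_sum) auto
        also have "\<dots> \<le> (\<Sum>m1'\<in>{..<M1} - {m1}. \<Sum>m2'\<in>{..<M2} - {m2}. clash2 (c1 m1) (c1 m1') (c2 m2) (c2 m2') z)"
          using l ne by (intro member_le_sum[of l _ "\<lambda>m1'. \<Sum>m2'\<in>{..<M2} - {m2}. clash2 (c1 m1) (c1 m1') (c2 m2) (c2 m2') z"]) auto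
        also have "\<dots> \<le> ?R" by (rule add_increasing) simp_all
        finally show ?thesis .
      qed
      then show ?thesis by (auto simp: indicator_def)
    qed
  qed
  also have "\<dots> = pair_bound M1 M2 c1 c2 m1 m2"
    unfolding pair_bound_def using m x v
    by (intro nn_integral_add_sums miss_measurable clash1_measurable clash2_measurable) auto
  finally show ?thesis .
qed

end

section \<open>Second moments and Chebyshev bounds over a block\<close>

lemma integral_PiM_component:
  fixes f :: "'a \<Rightarrow> real"
  assumes M: "prob_space M" and i: "i \<in> I" and f: "integrable M f"
  shows "integrable (\<Pi>\<^sub>M i\<in>I. M) (\<lambda>x. f (x i))" "(\<integral>x. f (x i) \<partial>(\<Pi>\<^sub>M i\<in>I. M)) = (\<integral>x. f x \<partial>M)"
proof -
  have d: "distr (\<Pi>\<^sub>M i\<in>I. M) M (\<lambda>x. x i) = M" using distr_PiM_component[of I "\<lambda>_. M" i] assms by simp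
  have [measurable]: "(\<lambda>x. x i) \<in> measurable (\<Pi>\<^sub>M i\<in>I. M) M" using i by (rule measurable_component_singleton)
  have [measurable]: "f \<in> borel_measurable M" using f by auto
  show "integrable (\<Pi>\<^sub>M i\<in>I. M) (\<lambda>x. f (x i))"
    using f by (subst (asm) d[symmetric]) (simp add: integrable_distr_eq)
  show "(\<integral>x. f (x i) \<partial>(\<Pi>\<^sub>M i\<in>I. M)) = (\<integral>x. f x \<partial>M)"
    by (subst (2) d[symmetric]) (simp add: integral_distr)
qed

lemma integrable_pair_components:
  fixes f :: "'a \<Rightarrow> real" and g :: "'b \<Rightarrow> real"
  assumes M: "prob_space M" and N: "prob_space N"
  shows "integrable M f \<Longrightarrow> integrable (M \<Otimes>\<^sub>M N) (\<lambda>p. f (fst p))"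
    and "integrable N g \<Longrightarrow> integrable (M \<Otimes>\<^sub>M N) (\<lambda>p. g (snd p))"
proof -
  interpret NM: pair_prob_space N M using M N by (simp add: pair_prob_space_def pair_sigma_finite_def prob_space_imp_sigma_finite)
  show "integrable (M \<Otimes>\<^sub>M N) (\<lambda>p. f (fst p))" if "integrable M f"
    using that integrable_distr_eq[of fst "M \<Otimes>\<^sub>M N" M f] prob_space.distr_pair_fst[OF N, of M] by auto
  show "integrable (M \<Otimes>\<^sub>M N) (\<lambda>p. g (snd p))" if "integrable N g"
  proof -
    have "integrable (N \<Otimes>\<^sub>M M) (\<lambda>p. g (fst p))"
      using that integrable_distr_eq[of fst "N \<Otimes>\<^sub>M M" N g] prob_space.distr_pair_fst[OF M, of N] by auto
    from NM.integrable_product_swap[OF this] show ?thesis by (simp add: split_def)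
  qed
qed

text \<open>Variance of a sum of independent centred variables: by pairwise independence the mixed
  terms integrate to 0, and their integrability follows from that of the squares.\<close>

lemma integral_PiM_square_sum:
  fixes h :: "'a \<Rightarrow> real"
  assumes M: "prob_space M" and h [measurable]: "h \<in> borel_measurable M"
    and sq: "integrable M (\<lambda>x. (h x)\<^sup>2)" and mean: "(\<integral>x. h x \<partial>M) = 0"
  shows "(\<integral>\<^sup>+x. ennreal ((\<Sum>j<n. h (x j))\<^sup>2) \<partial>(\<Pi>\<^sub>M j\<in>{..<n}. M)) = ennreal (real n * (\<integral>x. (h x)\<^sup>2 \<partial>M))"
proof -
  interpret M: prob_space M by fact
  interpret MM: pair_prob_space M M ..
  let ?P = "\<Pi>\<^sub>M j\<in>{..<n}. M"
  define V where "V = (\<integral>x. (h x)\<^sup>2 \<partial>M)"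
  have pint: "integrable (M \<Otimes>\<^sub>M M) (\<lambda>p. h (fst p) * h (snd p))"
  proof (rule Bochner_Integration.integrable_bound)
    have "integrable (M \<Otimes>\<^sub>M M) (\<lambda>p. (h (fst p))\<^sup>2)" "integrable (M \<Otimes>\<^sub>M M) (\<lambda>p. (h (snd p))\<^sup>2)"
      using integrable_pair_components[OF M M] sq by blast+
    then show "integrable (M \<Otimes>\<^sub>M M) (\<lambda>p. (h (fst p))\<^sup>2 + (h (snd p))\<^sup>2)" by simp
    have "\<bar>a * b\<bar> \<le> a\<^sup>2 + b\<^sup>2" for a b :: real
      using sum_squares_bound[of "\<bar>a\<bar>" "\<bar>b\<bar>"] mult_nonneg_nonneg[OF abs_ge_zero[of a] abs_ge_zero[of b]]
      unfolding abs_mult mult.assoc power2_abs by linarith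
    then show "AE p in M \<Otimes>\<^sub>M M. norm (h (fst p) * h (snd p)) \<le> norm ((h (fst p))\<^sup>2 + (h (snd p))\<^sup>2)" by simp
  qed simp
  have pval: "(\<integral>p. h (fst p) * h (snd p) \<partial>(M \<Otimes>\<^sub>M M)) = 0"
    using MM.integral_fst[of "\<lambda>x y. h x * h y"] pint by (simp add: split_def mean)
  have cross: "integrable ?P (\<lambda>x. h (x i) * h (x j)) \<and> (\<integral>x. h (x i) * h (x j) \<partial>?P) = (if i = j then V else 0)"
    if ij: "i < n" "j < n" for i j
  proof (cases "i = j")
    case True
    then show ?thesis
      using integral_PiM_component[OF M _ sq, of i "{..<n}"] ij by (simp add: power2_eq_square V_def)
  next
    case False
    have d: "distr ?P (M \<Otimes>\<^sub>M M) (\<lambda>x. (x i, x j)) = M \<Otimes>\<^sub>M M"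
      using ij False by (intro distr_PiM_pair_components[OF M]) auto
    have [measurable]: "(\<lambda>x. (x i, x j)) \<in> measurable ?P (M \<Otimes>\<^sub>M M)"
      using ij by (intro measurable_Pair measurable_component_singleton) auto
    have "integrable ?P (\<lambda>x. h (x i) * h (x j))"
      using pint by (subst (asm) d[symmetric]) (simp add: integrable_distr_eq)
    moreover have "(\<integral>x. h (x i) * h (x j) \<partial>?P) = (\<integral>p. h (fst p) * h (snd p) \<partial>(M \<Otimes>\<^sub>M M))"
      by (subst d[symmetric]) (simp add: integral_distr)
    ultimately show ?thesis using False pval by simp
  qed
  have sqs: "(\<Sum>j<n. h (x j))\<^sup>2 = (\<Sum>i<n. \<Sum>j<n. h (x i) * h (x j))" for x
    by (simp add: power2_eq_square sum_product)
  have int: "integrable ?P (\<lambda>x. (\<Sum>j<n. h (x j))\<^sup>2)"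
    unfolding sqs using cross by (intro Bochner_Integration.integrable_sum) auto
  have "(\<integral>x. (\<Sum>j<n. h (x j))\<^sup>2 \<partial>?P) = (\<Sum>i<n. \<Sum>j<n. \<integral>x. h (x i) * h (x j) \<partial>?P)"
  proof -
    have "(\<integral>x. (\<Sum>i<n. \<Sum>j<n. h (x i) * h (x j)) \<partial>?P) = (\<Sum>i<n. \<integral>x. (\<Sum>j<n. h (x i) * h (x j)) \<partial>?P)"
      using cross by (intro Bochner_Integration.integral_sum Bochner_Integration.integrable_sum) auto
    also have "\<dots> = (\<Sum>i<n. \<Sum>j<n. \<integral>x. h (x i) * h (x j) \<partial>?P)"
      using cross by (intro sum.cong refl Bochner_Integration.integral_sum) auto
    finally show ?thesis unfolding sqs .
  qed
  also have "\<dots> = (\<Sum>i<n. \<Sum>j<n. if i = j then V else 0)"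
    using cross by (intro sum.cong refl) auto
  also have "\<dots> = real n * V" by simp
  finally show ?thesis using int by (simp add: nn_integral_eq_integral V_def)
qed

text \<open>Chebyshev's inequality for the lower tail, the only one that makes the transmitted
  codewords fail a test.\<close>

lemma emeasure_PiM_sum_tail:
  fixes h :: "'a \<Rightarrow> real"
  assumes M: "prob_space M" and h [measurable]: "h \<in> borel_measurable M"
    and sq: "integrable M (\<lambda>x. (h x)\<^sup>2)" and mean: "(\<integral>x. h x \<partial>M) = 0" and n: "0 < n" and d: "0 < d"
  shows "emeasure (\<Pi>\<^sub>M j\<in>{..<n}. M) {x \<in> space (\<Pi>\<^sub>M j\<in>{..<n}. M). (\<Sum>j<n. h (x j)) \<le> - (real n * d)}
    \<le> ennreal ((\<integral>x. (h x)\<^sup>2 \<partial>M) / (real n * d\<^sup>2))"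
proof -
  let ?P = "\<Pi>\<^sub>M j\<in>{..<n}. M"
  let ?V = "\<integral>x. (h x)\<^sup>2 \<partial>M"
  define c where "c = 1 / (real n * d)\<^sup>2"
  have c: "0 < c" using n d by (simp add: c_def)
  have [measurable]: "(\<lambda>x. h (x j)) \<in> borel_measurable ?P" if "j < n" for j
    using that by (intro measurable_compose[OF _ h] measurable_component_singleton) simp
  have S [measurable]: "(\<lambda>x. \<Sum>j<n. h (x j)) \<in> borel_measurable ?P" by measurable
  have "emeasure ?P {x \<in> space ?P. (\<Sum>j<n. h (x j)) \<le> - (real n * d)}
    = (\<integral>\<^sup>+x. indicator {x \<in> space ?P. (\<Sum>j<n. h (x j)) \<le> - (real n * d)} x \<partial>?P)"
    by (rule nn_integral_indicator[symmetric]) measurable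
  also have "\<dots> \<le> (\<integral>\<^sup>+x. ennreal c * ennreal ((\<Sum>j<n. h (x j))\<^sup>2) \<partial>?P)"
  proof (rule nn_integral_mono)
    fix x
    show "indicator {x \<in> space ?P. (\<Sum>j<n. h (x j)) \<le> - (real n * d)} x \<le> ennreal c * ennreal ((\<Sum>j<n. h (x j))\<^sup>2)"
    proof (cases "(\<Sum>j<n. h (x j)) \<le> - (real n * d)")
      case True
      then have "(real n * d)\<^sup>2 \<le> (\<Sum>j<n. h (x j))\<^sup>2"
        using n d power_mono[of "real n * d" "- (\<Sum>j<n. h (x j))" 2] by simp
      then have "1 \<le> c * (\<Sum>j<n. h (x j))\<^sup>2" using n d by (simp add: c_def)
      then have "1 \<le> ennreal c * ennreal ((\<Sum>j<n. h (x j))\<^sup>2)"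
        using c by (simp add: ennreal_mult[symmetric] flip: ennreal_1)
      then show ?thesis by (simp add: indicator_def)
    qed (simp add: indicator_def)
  qed
  also have "\<dots> = ennreal c * ennreal (real n * ?V)"
    by (simp add: nn_integral_cmult integral_PiM_square_sum[OF M h sq mean])
  also have "\<dots> = ennreal (?V / (real n * d\<^sup>2))"
    using c n d by (simp add: ennreal_mult[symmetric] c_def power2_eq_square)
  finally show ?thesis .
qed

text \<open>Regroups the two input blocks and the noise block into i.i.d. triples, one per use, so
  that the Chebyshev bound applies across the uses.\<close>

lemma distr_zip3_PiM:
  assumes I: "finite I" and M: "prob_space M" and N: "prob_space N" and K: "prob_space K"
  shows "distr ((\<Pi>\<^sub>M i\<in>I. M) \<Otimes>\<^sub>M (\<Pi>\<^sub>M i\<in>I. N) \<Otimes>\<^sub>M (\<Pi>\<^sub>M i\<in>I. K)) (\<Pi>\<^sub>M i\<in>I. M \<Otimes>\<^sub>M N \<Otimes>\<^sub>M K)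
      (\<lambda>p. \<lambda>i\<in>I. (fst p i, fst (snd p) i, snd (snd p) i))
    = (\<Pi>\<^sub>M i\<in>I. M \<Otimes>\<^sub>M N \<Otimes>\<^sub>M K)"
proof -
  let ?M = "\<Pi>\<^sub>M i\<in>I. M" and ?N = "\<Pi>\<^sub>M i\<in>I. N" and ?K = "\<Pi>\<^sub>M i\<in>I. K" and ?NK = "\<Pi>\<^sub>M i\<in>I. N \<Otimes>\<^sub>M K"
  interpret NK: pair_prob_space N K using N K by (simp add: pair_prob_space_def pair_sigma_finite_def prob_space_imp_sigma_finite)
  interpret PM: prob_space ?M using M by (rule prob_space_PiM)
  interpret PNK: prob_space ?NK by (rule prob_space_PiM) (rule NK.prob_space_axioms)
  let ?z = "\<lambda>(x, y). \<lambda>i\<in>I. (x i, y i)"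
  have z [measurable]: "?z \<in> measurable (?N \<Otimes>\<^sub>M ?K) ?NK" by measurable
  have dz: "distr (?N \<Otimes>\<^sub>M ?K) ?NK ?z = ?NK" by (rule distr_zip_PiM[OF I N K])
  have 1: "distr (?M \<Otimes>\<^sub>M ?N \<Otimes>\<^sub>M ?K) (?M \<Otimes>\<^sub>M ?NK) (\<lambda>(x, p). (x, ?z p)) = ?M \<Otimes>\<^sub>M ?NK"
    using pair_measure_distr[of "\<lambda>x. x" ?M ?M ?z "?N \<Otimes>\<^sub>M ?K" ?NK] dz PNK.sigma_finite_measure_axioms by (simp add: distr_id2)
  have "(\<Pi>\<^sub>M i\<in>I. M \<Otimes>\<^sub>M N \<Otimes>\<^sub>M K) = distr (distr (?M \<Otimes>\<^sub>M ?N \<Otimes>\<^sub>M ?K) (?M \<Otimes>\<^sub>M ?NK) (\<lambda>(x, p). (x, ?z p))) (\<Pi>\<^sub>M i\<in>I. M \<Otimes>\<^sub>M N \<Otimes>\<^sub>M K) (\<lambda>(x, y). \<lambda>i\<in>I. (x i, y i))"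
    unfolding 1 by (rule distr_zip_PiM[OF I M NK.prob_space_axioms, symmetric])
  also have "\<dots> = distr (?M \<Otimes>\<^sub>M ?N \<Otimes>\<^sub>M ?K) (\<Pi>\<^sub>M i\<in>I. M \<Otimes>\<^sub>M N \<Otimes>\<^sub>M K) (\<lambda>p. \<lambda>i\<in>I. (fst p i, fst (snd p) i, snd (snd p) i))"
    by (subst distr_distr) (auto intro!: distr_cong simp: fun_eq_iff split_def comp_def)
  finally show ?thesis ..
qed

lemma matrix_vector_mult_norm_bound:
  fixes A :: "real^'m^'n"
  obtains C where "0 \<le> C" "\<And>x. norm (A *v x) \<le> C * norm x"
  using bounded_linear.nonneg_bounded[of "(*v) A"] by (metis matrix_vector_mul_bounded_linear mult.commute)

lemma std_gaussian_quadratic_affine: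
  fixes A :: "real^'m^'n" and X :: "real^'n^'n"
  shows "integrable std_gaussian (\<lambda>z. (d + A *v z) \<bullet> (X *v (d + A *v z)))"
    and "(\<integral>z. (d + A *v z) \<bullet> (X *v (d + A *v z)) \<partial>std_gaussian) = d \<bullet> (X *v d) + trace (X ** (A ** transpose A))"
proof -
  interpret prob_space "std_gaussian :: (real^'m) measure" by simp
  let ?Y = "transpose A ** X ** A"
  have eq: "(d + A *v z) \<bullet> (X *v (d + A *v z))
      = d \<bullet> (X *v d) + (transpose A *v (transpose X *v d)) \<bullet> z + (transpose A *v (X *v d)) \<bullet> z + z \<bullet> (?Y *v z)" for z
  proof -
    have "(transpose A *v (transpose X *v d)) \<bullet> z = d \<bullet> (X *v (A *v z))"
      using inner_matrix_transpose[of "transpose A" "transpose X *v d" z] inner_matrix_transpose[of "transpose X" d "A *v z"] by simp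
    moreover have "(transpose A *v (X *v d)) \<bullet> z = (X *v d) \<bullet> (A *v z)"
      using inner_matrix_transpose[of "transpose A" "X *v d" z] by simp
    moreover have "z \<bullet> (?Y *v z) = (A *v z) \<bullet> (X *v (A *v z))"
      by (simp add: inner_matrix_transpose flip: matrix_vector_mul_assoc)
    ultimately show ?thesis
      by (simp add: matrix_vector_right_distrib inner_add_left inner_add_right inner_commute)
  qed
  have tr: "trace ?Y = trace (X ** (A ** transpose A))"
    using trace_mul_sym[of "transpose A" "X ** A"] by (simp add: matrix_mul_assoc)
  show "integrable std_gaussian (\<lambda>z. (d + A *v z) \<bullet> (X *v (d + A *v z)))"
    unfolding eq by (intro Bochner_Integration.integrable_add std_gaussian_linear std_gaussian_quadratic) simp
  show "(\<integral>z. (d + A *v z) \<bullet> (X *v (d + A *v z)) \<partial>std_gaussian) = d \<bullet> (X *v d) + trace (X ** (A ** transpose A))"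
    unfolding eq by (simp add: std_gaussian_linear std_gaussian_quadratic prob_space[simplified] tr)
qed

lemma power_excess_moments:
  fixes G :: "real^'m^'n"
  defines "k \<equiv> \<lambda>x. (norm (G *v x))\<^sup>2 - trace (G ** transpose G)"
  shows "integrable std_gaussian (\<lambda>x. (k x)\<^sup>2)" "(\<integral>x. k x \<partial>std_gaussian) = 0" "k \<in> borel_measurable std_gaussian"
proof -
  interpret prob_space "std_gaussian :: (real^'m) measure" by simp
  show km [measurable]: "k \<in> borel_measurable std_gaussian" unfolding k_def by measurable
  have "(norm (G *v x))\<^sup>2 = (0 + G *v x) \<bullet> (mat 1 *v (0 + G *v x))" for x by (simp add: dot_square_norm)
  then have n: "integrable std_gaussian (\<lambda>x. (norm (G *v x))\<^sup>2)"
      "(\<integral>x. (norm (G *v x))\<^sup>2 \<partial>std_gaussian) = trace (G ** transpose G)"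
    using std_gaussian_quadratic_affine[of 0 G "mat 1"] by simp_all
  then show "(\<integral>x. k x \<partial>std_gaussian) = 0" unfolding k_def by (simp add: prob_space[simplified])
  obtain C where C: "0 \<le> C" "\<And>x. norm (G *v x) \<le> C * norm x" using matrix_vector_mult_norm_bound[of G] by blast
  let ?t = "trace (G ** transpose G)"
  show "integrable std_gaussian (\<lambda>x. (k x)\<^sup>2)"
  proof (rule Bochner_Integration.integrable_bound)
    show "integrable std_gaussian (\<lambda>x :: real^'m. 2 * (C ^ 4 * (norm x) ^ 4) + 2 * ?t\<^sup>2)"
      by (intro Bochner_Integration.integrable_add integrable_mult_right integrable_std_gaussian_norm4) simp
    show "AE x in std_gaussian. norm ((k x)\<^sup>2) \<le> norm (2 * (C ^ 4 * (norm x) ^ 4) + 2 * ?t\<^sup>2)"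
    proof (rule AE_I2)
      fix x
      have "(norm (G *v x)) ^ 4 \<le> (C * norm x) ^ 4" using C by (intro power_mono) auto
      moreover have "(k x)\<^sup>2 \<le> 2 * ((norm (G *v x))\<^sup>2)\<^sup>2 + 2 * ?t\<^sup>2"
        unfolding k_def using sum_squares_bound[of "(norm (G *v x))\<^sup>2" "- ?t"] by (simp add: power2_diff)
      moreover have "((norm (G *v x))\<^sup>2)\<^sup>2 = (norm (G *v x)) ^ 4" by simp
      ultimately show "norm ((k x)\<^sup>2) \<le> norm (2 * (C ^ 4 * (norm x) ^ 4) + 2 * ?t\<^sup>2)"
        by (simp add: power_mult_distrib)
    qed
  qed measurable
qed

text \<open>Up to the constant \<open>ln (det S) / 2\<close>, \<open>h\<close> is the information
  density between the inputs and the output \<open>u p\<close>: the logarithm of the noise density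
  over the output density \<open>gauss_density S\<close>. Its mean vanishes because both quadratic
  forms have the dimension of the output as mean, the first since \<open>u p\<close> has covariance
  \<open>S\<close> and \<open>matrix_inv S ** S\<close> is the identity.\<close>

lemma info_density_moments:
  fixes A :: "real^'m^'r" and B :: "real^'k^'r"
  defines "S \<equiv> mat 1 + A ** transpose A + B ** transpose B"
  defines "u \<equiv> \<lambda>p. A *v fst p + B *v fst (snd p) + snd (snd p)"
  defines "h \<equiv> \<lambda>p. (u p \<bullet> (matrix_inv S *v u p) - snd (snd p) \<bullet> snd (snd p)) / 2"
  defines "M \<equiv> std_gaussian \<Otimes>\<^sub>M std_gaussian \<Otimes>\<^sub>M std_gaussian"
  shows "h \<in> borel_measurable M" "integrable M (\<lambda>p. (h p)\<^sup>2)" "(\<integral>p. h p \<partial>M) = 0"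
proof -
  let ?G1 = "std_gaussian :: (real^'m) measure" and ?G2 = "std_gaussian :: (real^'k) measure" and ?G3 = "std_gaussian :: (real^'r) measure"
  interpret G1: prob_space ?G1 by simp
  interpret G2: prob_space ?G2 by simp
  interpret G3: prob_space ?G3 by simp
  interpret G23: pair_prob_space ?G2 ?G3 ..
  interpret M: pair_prob_space ?G1 "?G2 \<Otimes>\<^sub>M ?G3" ..
  let ?X = "matrix_inv S"
  have S: "pos_def S" unfolding S_def by (intro pos_def_add pos_semidef_gram) simp
  have M_eq: "M = ?G1 \<Otimes>\<^sub>M ?G2 \<Otimes>\<^sub>M ?G3" by (simp add: M_def)
  show hm [measurable]: "h \<in> borel_measurable M"
    unfolding h_def u_def M_eq by measurable
  note comp = integrable_pair_components[OF G1.prob_space_axioms G23.prob_space_axioms]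
    integrable_pair_components[OF G2.prob_space_axioms G3.prob_space_axioms]
  have i1: "integrable M (\<lambda>p. (norm (fst p)) ^ 4)"
    unfolding M_eq by (rule comp(1)[OF integrable_std_gaussian_norm4])
  have i2: "integrable M (\<lambda>p. (norm (fst (snd p))) ^ 4)"
    unfolding M_eq by (rule comp(2)[OF comp(3)[OF integrable_std_gaussian_norm4]])
  have i3: "integrable M (\<lambda>p. (norm (snd (snd p))) ^ 4)"
    unfolding M_eq by (rule comp(2)[OF comp(4)[OF integrable_std_gaussian_norm4]])
  obtain CA where CA: "0 \<le> CA" "\<And>x. norm (A *v x) \<le> CA * norm x" using matrix_vector_mult_norm_bound[of A] by blast
  obtain CB where CB: "0 \<le> CB" "\<And>x. norm (B *v x) \<le> CB * norm x" using matrix_vector_mult_norm_bound[of B] by blast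
  obtain CX where CX: "0 \<le> CX" "\<And>x. norm (?X *v x) \<le> CX * norm x" using matrix_vector_mult_norm_bound[of "?X"] by blast
  define C where "C = max CA (max CB 1)"
  have C: "0 \<le> C" "CA \<le> C" "CB \<le> C" "1 \<le> C" unfolding C_def using CA(1) by auto
  \<comment> \<open>\<open>3 * C\<^sup>2\<close> comes from the square of a sum of three norms,
    \<open>CX\<close> from the quadratic form in \<open>u p\<close>, and the 1 from the noise term;
    thus \<open>\<bar>h p\<bar>\<close> is at most \<open>D\<close> times the sum of the squared
    norms.\<close>
  define D where "D = CX * (3 * C\<^sup>2) + 1"
  have D: "0 \<le> D" using CX C by (simp add: D_def)
  have sq3: "(a + b + c)\<^sup>2 \<le> 3 * (a\<^sup>2 + b\<^sup>2 + c\<^sup>2)" for a b c :: real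
  proof -
    have "0 \<le> (a - b)\<^sup>2 + (b - c)\<^sup>2 + (a - c)\<^sup>2" by simp
    then show ?thesis by (simp add: power2_eq_square algebra_simps)
  qed
  have bound: "(h p)\<^sup>2 \<le> 3 * D\<^sup>2 * ((norm (fst p)) ^ 4 + (norm (fst (snd p))) ^ 4 + (norm (snd (snd p))) ^ 4)" for p
  proof -
    define x v z where "x = norm (fst p)" and "v = norm (fst (snd p))" and "z = norm (snd (snd p))"
    define s where "s = x\<^sup>2 + v\<^sup>2 + z\<^sup>2"
    have nn: "0 \<le> x" "0 \<le> v" "0 \<le> z" by (simp_all add: x_def v_def z_def)
    have s: "0 \<le> s" by (simp add: s_def)
    have "norm (u p) \<le> norm (A *v fst p) + norm (B *v fst (snd p)) + norm (snd (snd p))"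
      unfolding u_def by (meson norm_triangle_ineq norm_triangle_le add_mono order_refl)
    also have "\<dots> \<le> C * x + C * v + C * z"
    proof (intro add_mono)
      show "norm (A *v fst p) \<le> C * x" using CA(2)[of "fst p"] mult_right_mono[OF C(2) nn(1)] by (simp add: x_def)
      show "norm (B *v fst (snd p)) \<le> C * v" using CB(2)[of "fst (snd p)"] mult_right_mono[OF C(3) nn(2)] by (simp add: v_def)
      show "norm (snd (snd p)) \<le> C * z" using mult_right_mono[OF C(4) nn(3)] by (simp add: z_def)
    qed
    also have "\<dots> = C * (x + v + z)" by (simp add: distrib_left)
    finally have "(norm (u p))\<^sup>2 \<le> (C * (x + v + z))\<^sup>2" by (intro power_mono) auto
    also have "\<dots> \<le> C\<^sup>2 * (3 * s)" unfolding power_mult_distrib s_def by (intro mult_left_mono sq3) simp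
    finally have u2: "(norm (u p))\<^sup>2 \<le> 3 * C\<^sup>2 * s" by simp
    have "\<bar>u p \<bullet> (?X *v u p)\<bar> \<le> norm (u p) * norm (?X *v u p)" by (rule Cauchy_Schwarz_ineq2)
    also have "\<dots> \<le> norm (u p) * (CX * norm (u p))" by (intro mult_left_mono CX) simp
    also have "\<dots> = CX * (norm (u p))\<^sup>2" by (simp add: power2_eq_square)
    also have "\<dots> \<le> CX * (3 * C\<^sup>2 * s)" by (intro mult_left_mono u2 CX)
    finally have 1: "\<bar>u p \<bullet> (?X *v u p)\<bar> \<le> CX * (3 * C\<^sup>2 * s)" .
    have 2: "\<bar>snd (snd p) \<bullet> snd (snd p)\<bar> \<le> s" by (simp add: dot_square_norm s_def z_def)
    have half: "\<bar>(x - y) / 2\<bar> \<le> a + b" if "\<bar>x\<bar> \<le> a" "\<bar>y\<bar> \<le> b" for x y a b :: real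
    proof -
      have "\<bar>(x - y) / 2\<bar> \<le> \<bar>x - y\<bar>" by simp
      then show ?thesis using abs_triangle_ineq4[of x y] that by linarith
    qed
    have "D * s = CX * (3 * C\<^sup>2 * s) + s" by (simp add: D_def algebra_simps)
    then have "\<bar>h p\<bar> \<le> D * s"
      using half[OF 1 2] unfolding h_def by simp
    then have "(h p)\<^sup>2 \<le> (D * s)\<^sup>2" using D s by (intro power2_le_iff_abs_le[THEN iffD2]) auto
    also have "\<dots> \<le> D\<^sup>2 * (3 * ((x\<^sup>2)\<^sup>2 + (v\<^sup>2)\<^sup>2 + (z\<^sup>2)\<^sup>2))"
      unfolding power_mult_distrib s_def by (intro mult_left_mono sq3) simp
    finally show ?thesis by (simp add: x_def v_def z_def algebra_simps)
  qed
  show sq: "integrable M (\<lambda>p. (h p)\<^sup>2)"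
  proof (rule Bochner_Integration.integrable_bound)
    show "integrable M (\<lambda>p. 3 * D\<^sup>2 * ((norm (fst p)) ^ 4 + (norm (fst (snd p))) ^ 4 + (norm (snd (snd p))) ^ 4))"
      by (intro integrable_mult_right Bochner_Integration.integrable_add i1 i2 i3)
    show "AE p in M. norm ((h p)\<^sup>2) \<le> norm (3 * D\<^sup>2 * ((norm (fst p)) ^ 4 + (norm (fst (snd p))) ^ 4 + (norm (snd (snd p))) ^ 4))"
      using bound by (intro AE_I2) (auto intro: order_trans[OF _ abs_ge_self])
  qed measurable
  have int: "integrable M h"
  proof -
    have "finite_measure M" unfolding M_eq by (rule M.finite_measure_axioms)
    from finite_measure.square_integrable_imp_integrable[OF this hm sq] show ?thesis .
  qed
  have AEi: "AE x in ?G1. integrable (?G2 \<Otimes>\<^sub>M ?G3) (\<lambda>q. h (x, q))"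
    by (rule M.AE_integrable_fst'[OF int[unfolded M_eq]])
  have z: "(\<integral>z. (d + z) \<bullet> (?X *v (d + z)) - z \<bullet> z \<partial>?G3) = d \<bullet> (?X *v d) + trace ?X - real CARD('r)" for d
    using std_gaussian_quadratic_shift[of d ?X] std_gaussian_quadratic[of "mat 1 :: real^'r^'r"] by (simp add: trace_I)
  have "(\<integral>p. h p \<partial>M) = (\<integral>x. (\<integral>q. h (x, q) \<partial>(?G2 \<Otimes>\<^sub>M ?G3)) \<partial>?G1)"
    unfolding M_eq by (rule M.integral_fst'[OF int[unfolded M_eq], symmetric])
  also have "\<dots> = (\<integral>x. ((A *v x) \<bullet> (?X *v (A *v x)) + trace (?X ** (B ** transpose B)) + trace ?X - real CARD('r)) / 2 \<partial>?G1)"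
  proof (rule integral_cong_AE)
    show "AE x in ?G1. (\<integral>q. h (x, q) \<partial>(?G2 \<Otimes>\<^sub>M ?G3)) = ((A *v x) \<bullet> (?X *v (A *v x)) + trace (?X ** (B ** transpose B)) + trace ?X - real CARD('r)) / 2"
      using AEi
    proof eventually_elim
      fix x assume i: "integrable (?G2 \<Otimes>\<^sub>M ?G3) (\<lambda>q. h (x, q))"
      have "(\<integral>q. h (x, q) \<partial>(?G2 \<Otimes>\<^sub>M ?G3)) = (\<integral>v. (\<integral>z. h (x, v, z) \<partial>?G3) \<partial>?G2)"
        by (rule G23.integral_fst'[OF i, symmetric])
      also have "\<dots> = (\<integral>v. ((A *v x + B *v v) \<bullet> (?X *v (A *v x + B *v v)) + trace ?X - real CARD('r)) / 2 \<partial>?G2)"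
        unfolding h_def u_def by (simp add: z)
      also have "\<dots> = ((A *v x) \<bullet> (?X *v (A *v x)) + trace (?X ** (B ** transpose B)) + trace ?X - real CARD('r)) / 2"
        using std_gaussian_quadratic_affine[of "A *v x" B ?X] by (simp add: G2.prob_space[simplified])
      finally show "(\<integral>q. h (x, q) \<partial>(?G2 \<Otimes>\<^sub>M ?G3)) = ((A *v x) \<bullet> (?X *v (A *v x)) + trace (?X ** (B ** transpose B)) + trace ?X - real CARD('r)) / 2" .
    qed
    show "(\<lambda>x. \<integral>q. h (x, q) \<partial>(?G2 \<Otimes>\<^sub>M ?G3)) \<in> borel_measurable ?G1"
      using hm unfolding M_eq by measurable
  qed measurable
  also have "\<dots> = (trace (?X ** (A ** transpose A)) + trace (?X ** (B ** transpose B)) + trace ?X - real CARD('r)) / 2"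
    using std_gaussian_quadratic_affine[of 0 A ?X] by (simp add: G1.prob_space[simplified])
  also have "trace (?X ** (A ** transpose A)) + trace (?X ** (B ** transpose B)) + trace ?X = trace (?X ** S)"
    by (simp add: S_def matrix_add_ldistrib trace_add)
  also have "trace (?X ** S) = real CARD('r)"
    by (simp add: matrix_inv_left[OF pos_def_invertible[OF S]] trace_I)
  finally show "(\<integral>p. h p \<partial>M) = 0" by simp
qed

section \<open>Gaussian codebooks\<close>

text \<open>Markov's inequality. With \<open>p x\<close> the density of a given output when
  \<open>x\<close> is sent and \<open>q\<close> its average over random codewords, a codeword drawn
  independently of the output exceeds the likelihood-ratio threshold \<open>c\<close> with
  probability at most \<open>1 / c\<close>.\<close>

lemma emeasure_likelihood_ratio_bound:
  assumes [measurable]: "p \<in> borel_measurable M" and p: "\<And>x. 0 \<le> p x" and q: "0 < q" and c: "0 < c"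
    and int: "(\<integral>\<^sup>+x. ennreal (p x) \<partial>M) \<le> ennreal q"
  shows "emeasure M {x \<in> space M. c * q < p x} \<le> ennreal (1 / c)"
proof -
  have "emeasure M {x \<in> space M. c * q < p x} = (\<integral>\<^sup>+x. indicator {x \<in> space M. c * q < p x} x \<partial>M)"
    by (rule nn_integral_indicator[symmetric]) measurable
  also have "\<dots> \<le> (\<integral>\<^sup>+x. ennreal (1 / (c * q)) * ennreal (p x) \<partial>M)"
  proof (rule nn_integral_mono)
    fix x
    show "indicator {x \<in> space M. c * q < p x} x \<le> ennreal (1 / (c * q)) * ennreal (p x)"
    proof (cases "c * q < p x")
      case True
      then have "1 \<le> 1 / (c * q) * p x" using c q by (simp add: field_simps)
      then have "1 \<le> ennreal (1 / (c * q)) * ennreal (p x)"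
        using c q p[of x] by (simp add: ennreal_mult[symmetric] flip: ennreal_1)
      then show ?thesis by (simp add: indicator_def)
    qed (simp add: indicator_def)
  qed
  also have "\<dots> = ennreal (1 / (c * q)) * (\<integral>\<^sup>+x. ennreal (p x) \<partial>M)" by (rule nn_integral_cmult) measurable
  also have "\<dots> \<le> ennreal (1 / (c * q)) * ennreal q" by (intro mult_left_mono int) simp
  also have "\<dots> = ennreal (1 / c)" using c q by (simp add: ennreal_mult[symmetric])
  finally show ?thesis .
qed

text \<open>Averaging the density of the output over a Gaussian codeword adds
  \<open>A ** transpose A\<close> to the covariance. The reference densities in the likelihood tests
  are exactly such averages.\<close>

lemma nn_integral_gblock_density:
  fixes A :: "real^'m^'r" and P :: "real^'r^'r" and y :: "nat \<Rightarrow> real^'r"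
  assumes P: "pos_semidef P"
  shows "(\<integral>\<^sup>+x. ennreal (\<Prod>j<n. gauss_density (mat 1 + P) (y j - A *v x j)) \<partial>gblock n)
    = ennreal (\<Prod>j<n. gauss_density (mat 1 + P + A ** transpose A) (y j))"
proof -
  interpret product_sigma_finite "\<lambda>_::nat. std_gaussian :: (real^'m) measure"
    by (simp add: product_sigma_finite_def prob_space_imp_sigma_finite)
  have S: "pos_def (mat 1 + P)" by (intro pos_def_add P) simp
  have S': "pos_def (mat 1 + P + A ** transpose A)" by (intro pos_def_add S pos_semidef_gram)
  have "(\<integral>\<^sup>+x. ennreal (\<Prod>j<n. gauss_density (mat 1 + P) (y j - A *v x j)) \<partial>gblock n)
    = (\<integral>\<^sup>+x. (\<Prod>j<n. ennreal (gauss_density (mat 1 + P) (y j - A *v x j))) \<partial>gblock n)"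
    using gauss_density_pos[OF S] by (simp add: prod_ennreal less_imp_le)
  also have "\<dots> = (\<Prod>j<n. \<integral>\<^sup>+w. ennreal (gauss_density (mat 1 + P) (y j - A *v w)) \<partial>std_gaussian)"
    by (rule product_nn_integral_prod) (simp, measurable)
  also have "\<dots> = (\<Prod>j<n. ennreal (gauss_density (mat 1 + P + A ** transpose A) (y j)))"
    by (simp add: nn_integral_gauss_density_convolution[OF P])
  also have "\<dots> = ennreal (\<Prod>j<n. gauss_density (mat 1 + P + A ** transpose A) (y j))"
    using gauss_density_pos[OF S'] by (simp add: prod_ennreal less_imp_le)
  finally show ?thesis .
qed

lemma gblock_component_measurable [measurable (raw)]:
  "f \<in> measurable K (gblock n) \<Longrightarrow> j < n \<Longrightarrow> (\<lambda>k. f k j) \<in> borel_measurable K"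
  using measurable_compose[OF _ measurable_component_singleton[of j "{..<n}" "\<lambda>_. std_gaussian"], of f K]
  by (simp add: measurable_cong_sets[OF refl sets_std_gaussian])

lemma block_component_measurable [measurable (raw)]:
  "f \<in> measurable K (\<Pi>\<^sub>M j\<in>{..<n}. borel) \<Longrightarrow> j < n \<Longrightarrow> (\<lambda>k. f k j) \<in> borel_measurable K"
  using measurable_compose[OF _ measurable_component_singleton[of j "{..<n}" "\<lambda>_. borel"], of f K] by simp

lemma pos_semidef_0 [simp]: "pos_semidef 0"
  using pos_semidef_sum[of "{}" "\<lambda>_. 0"] by simp

text \<open>After taking logarithms, a failed test is a lower-tail event for a sum of information
  densities.\<close>

lemma likelihood_test_fails:
  fixes S :: "real^'r^'r" and y z :: "nat \<Rightarrow> real^'r"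
  assumes S: "pos_def S"
    and fail: "\<not> exp (real n * t) * (\<Prod>j<n. gauss_density S (y j)) < (\<Prod>j<n. gauss_density (mat 1) (z j))"
  shows "(\<Sum>j<n. (y j \<bullet> (matrix_inv S *v y j) - z j \<bullet> z j) / 2) \<le> real n * (t - ln (det S) / 2)"
proof -
  note gS = gauss_density_pos[OF S]
  have g1: "0 < gauss_density (mat 1) w" for w :: "real^'r" by (rule gauss_density_pos) simp
  have p: "0 < (\<Prod>j<n. gauss_density S (y j))" "0 < (\<Prod>j<n. gauss_density (mat 1) (z j))"
    by (intro prod_pos gS g1)+
  have "ln (\<Prod>j<n. gauss_density (mat 1) (z j)) \<le> ln (exp (real n * t) * (\<Prod>j<n. gauss_density S (y j)))"
    using fail p by (intro ln_mono) auto
  also have "\<dots> = real n * t + ln (\<Prod>j<n. gauss_density S (y j))"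
    using p by (simp add: ln_mult_pos)
  finally have "ln (\<Prod>j<n. gauss_density (mat 1) (z j)) - ln (\<Prod>j<n. gauss_density S (y j)) \<le> real n * t" by simp
  moreover have "ln (\<Prod>j<n. gauss_density (mat 1) (z j)) - ln (\<Prod>j<n. gauss_density S (y j))
    = (\<Sum>j<n. ln (gauss_density (mat 1) (z j)) - ln (gauss_density S (y j)))"
    by (subst (1 2) ln_prod) (auto simp: sum_subtractf less_imp_neq[OF gS, symmetric] less_imp_neq[OF g1, symmetric])
  moreover have "ln (gauss_density (mat 1) (z j)) - ln (gauss_density S (y j))
    = (y j \<bullet> (matrix_inv S *v y j) - z j \<bullet> z j) / 2 + ln (det S) / 2" for j
    using ln_gauss_density_ratio[OF S, of "y j" "z j"] gS[of "y j"] g1[of "z j"]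
    by (simp add: ln_div diff_divide_distrib)
  ultimately show ?thesis by (simp add: sum.distrib algebra_simps)
qed

text \<open>Weak law of large numbers for the information density: its mean
  \<open>ln (det S) / 2\<close> exceeds the threshold exponent \<open>t\<close> by at least
  \<open>d\<close>, so a failure is a deviation of at least \<open>real n * d\<close>.
  \<open>V\<close> is the variance for one use and the same for all \<open>n\<close>.\<close>

lemma true_codeword_test:
  fixes A :: "real^'m^'r" and B :: "real^'k^'r"
  defines "S \<equiv> mat 1 + A ** transpose A + B ** transpose B"
  assumes d: "0 < d" and t: "t + d \<le> ln (det S) / 2"
  obtains V where "0 \<le> V" "\<And>n. 0 < n \<Longrightarrow> emeasure (gblock n \<Otimes>\<^sub>M gblock n \<Otimes>\<^sub>M gblock n)
    {q \<in> space (gblock n \<Otimes>\<^sub>M gblock n \<Otimes>\<^sub>M gblock n).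
      \<not> exp (real n * t) * (\<Prod>j<n. gauss_density S (A *v fst q j + B *v fst (snd q) j + snd (snd q) j))
        < (\<Prod>j<n. gauss_density (mat 1) (snd (snd q) j))} \<le> ennreal (V / (real n * d\<^sup>2))"
proof -
  define M where "M = (std_gaussian :: (real^'m) measure) \<Otimes>\<^sub>M (std_gaussian :: (real^'k) measure) \<Otimes>\<^sub>M (std_gaussian :: (real^'r) measure)"
  define u where "u p = A *v fst p + B *v fst (snd p) + snd (snd p)" for p :: "(real^'m) \<times> (real^'k) \<times> (real^'r)"
  define h where "h p = (u p \<bullet> (matrix_inv S *v u p) - snd (snd p) \<bullet> snd (snd p)) / 2" for p
  have S: "pos_def S" unfolding S_def by (intro pos_def_add pos_semidef_gram) simp
  have h: "h \<in> borel_measurable M" "integrable M (\<lambda>p. (h p)\<^sup>2)" "(\<integral>p. h p \<partial>M) = 0"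
    using info_density_moments[of A B] unfolding h_def u_def S_def M_def by auto
  define V where "V = (\<integral>p. (h p)\<^sup>2 \<partial>M)"
  have M: "prob_space M" unfolding M_def by (intro prob_space_pair) auto
  have "emeasure (gblock n \<Otimes>\<^sub>M gblock n \<Otimes>\<^sub>M gblock n)
    {q \<in> space (gblock n \<Otimes>\<^sub>M gblock n \<Otimes>\<^sub>M gblock n).
      \<not> exp (real n * t) * (\<Prod>j<n. gauss_density S (A *v fst q j + B *v fst (snd q) j + snd (snd q) j))
        < (\<Prod>j<n. gauss_density (mat 1) (snd (snd q) j))} \<le> ennreal (V / (real n * d\<^sup>2))" (is "emeasure ?N ?E \<le> _") if n: "0 < n" for n
  proof -
    let ?P = "\<Pi>\<^sub>M j\<in>{..<n}. M"
    let ?zip = "\<lambda>p. \<lambda>i\<in>{..<n}. (fst p i, fst (snd p) i, snd (snd p) i)"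
    have zip: "distr ?N ?P ?zip = ?P"
      unfolding M_def by (rule distr_zip3_PiM) auto
    have zm [measurable]: "?zip \<in> measurable ?N ?P" unfolding M_def
      by (intro measurable_restrict measurable_Pair; subst measurable_cong_sets[OF refl sets_std_gaussian]; measurable)
    let ?F = "{x \<in> space ?P. (\<Sum>j<n. h (x j)) \<le> - (real n * d)}"
    have [measurable]: "(\<lambda>x. h (x j)) \<in> borel_measurable ?P" if "j < n" for j
      using that by (intro measurable_compose[OF _ h(1)] measurable_component_singleton) simp
    have F: "?F \<in> sets ?P" by measurable
    have "?E \<subseteq> ?zip -` ?F \<inter> space ?N"
    proof
      fix q assume q: "q \<in> ?E"
      then have "(\<Sum>j<n. h (?zip q j)) \<le> real n * (t - ln (det S) / 2)"
        using likelihood_test_fails[OF S, of n t "\<lambda>j. A *v fst q j + B *v fst (snd q) j + snd (snd q) j" "\<lambda>j. snd (snd q) j"]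
        by (simp add: h_def u_def)
      also have "\<dots> \<le> real n * (- d)" using t by (intro mult_left_mono) auto
      finally have "(\<Sum>j<n. h (?zip q j)) \<le> - (real n * d)" by simp
      moreover have "q \<in> space ?N" using q by blast
      moreover then have "?zip q \<in> space ?P" by (rule measurable_space[OF zm])
      ultimately show "q \<in> ?zip -` ?F \<inter> space ?N" by blast
    qed
    then have "emeasure ?N ?E \<le> emeasure ?N (?zip -` ?F \<inter> space ?N)"
      by (rule emeasure_mono) (rule measurable_sets[OF zm F])
    also have "\<dots> = emeasure ?P ?F" using emeasure_distr[OF zm F] by (simp add: zip)
    also have "\<dots> \<le> ennreal (V / (real n * d\<^sup>2))"
      unfolding V_def by (rule emeasure_PiM_sum_tail[OF M h n d])
    finally show ?thesis .
  qed
  moreover have "0 \<le> V" by (simp add: V_def)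
  ultimately show thesis using that by blast
qed

text \<open>Likelihood ratios in favour of the pair \<open>x\<close>, \<open>v\<close>:
  \<open>test1\<close> compares it with a random codeword of the user beside the same
  \<open>v\<close>, \<open>test2\<close> with a random pair. Codewords are standard Gaussian;
  \<open>A\<close> and \<open>B\<close> will contain the square roots of the input
  covariances.\<close>

abbreviation test1 :: "real^'m^'r \<Rightarrow> real^'k^'r \<Rightarrow> nat \<Rightarrow> real \<Rightarrow> (nat \<Rightarrow> real^'m) \<Rightarrow> (nat \<Rightarrow> real^'k) \<Rightarrow> (nat \<Rightarrow> real^'r) \<Rightarrow> bool" where
  "test1 A B n t \<equiv> \<lambda>x v y. exp (real n * t) * (\<Prod>j<n. gauss_density (mat 1 + A ** transpose A) (y j - B *v v j)) < (\<Prod>j<n. gauss_density (mat 1) (y j - (A *v x j + B *v v j)))"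

abbreviation test2 :: "real^'m^'r \<Rightarrow> real^'k^'r \<Rightarrow> nat \<Rightarrow> real \<Rightarrow> (nat \<Rightarrow> real^'m) \<Rightarrow> (nat \<Rightarrow> real^'k) \<Rightarrow> (nat \<Rightarrow> real^'r) \<Rightarrow> bool" where
  "test2 A B n t \<equiv> \<lambda>x v y. exp (real n * t) * (\<Prod>j<n. gauss_density (mat 1 + A ** transpose A + B ** transpose B) (y j)) < (\<Prod>j<n. gauss_density (mat 1) (y j - (A *v x j + B *v v j)))"

abbreviation gaussian_decoding where
  "gaussian_decoding A B n t1 t2 \<eta> \<equiv> joint_decoding (gblock n) (gblock n) (gblock n) (\<Pi>\<^sub>M j\<in>{..<n}. borel)
    (received A B n) (test1 A B n t1) (test2 A B n t2)
    (ennreal (exp (- (real n * t1)))) (ennreal (exp (- (real n * t2)))) (ennreal \<eta>)"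

lemma joint_decoding_gaussian:
  fixes A :: "real^'m^'r" and B :: "real^'k^'r"
  defines "S1 \<equiv> mat 1 + A ** transpose A" and "S \<equiv> mat 1 + A ** transpose A + B ** transpose B"
  assumes d: "0 < d" and t1: "t1 + d \<le> ln (det S1) / 2" and t2: "t2 + d \<le> ln (det S) / 2"
  obtains V where "0 \<le> V" "\<And>n. 0 < n \<Longrightarrow> gaussian_decoding A B n t1 t2 (V / (real n * d\<^sup>2))"
proof -
  have S1: "pos_def S1" unfolding S1_def by (intro pos_def_add pos_semidef_gram) simp
  have S: "pos_def S" unfolding S_def by (intro pos_def_add pos_semidef_gram) simp
  have gpos: "0 < gauss_density (mat 1) w" for w :: "real^'r" by (rule gauss_density_pos) simp
  \<comment> \<open>Once the interferer's signal is subtracted, the transmitted pair passes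
    \<open>test1\<close> as if \<open>B\<close> were 0, so \<open>true_codeword_test\<close> serves
    for both tests.\<close>
  have S1_eq: "S1 = mat 1 + A ** transpose A + (0 :: real^'k^'r) ** transpose (0 :: real^'k^'r)"
    by (simp add: S1_def)
  obtain V1 where V1: "0 \<le> V1" "\<And>n. 0 < n \<Longrightarrow> emeasure (gblock n \<Otimes>\<^sub>M gblock n \<Otimes>\<^sub>M gblock n)
    {q \<in> space (gblock n \<Otimes>\<^sub>M gblock n \<Otimes>\<^sub>M gblock n).
      \<not> exp (real n * t1) * (\<Prod>j<n. gauss_density S1 (A *v fst q j + (0 :: real^'k^'r) *v fst (snd q) j + snd (snd q) j))
        < (\<Prod>j<n. gauss_density (mat 1) (snd (snd q) j))} \<le> ennreal (V1 / (real n * d\<^sup>2))"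
    using true_codeword_test[of d t1 A "0 :: real^'k^'r"] d t1 unfolding S1_eq by blast
  obtain V2 where V2: "0 \<le> V2" "\<And>n. 0 < n \<Longrightarrow> emeasure (gblock n \<Otimes>\<^sub>M gblock n \<Otimes>\<^sub>M gblock n)
    {q \<in> space (gblock n \<Otimes>\<^sub>M gblock n \<Otimes>\<^sub>M gblock n).
      \<not> exp (real n * t2) * (\<Prod>j<n. gauss_density S (A *v fst q j + B *v fst (snd q) j + snd (snd q) j))
        < (\<Prod>j<n. gauss_density (mat 1) (snd (snd q) j))} \<le> ennreal (V2 / (real n * d\<^sup>2))"
    using true_codeword_test[of d t2 A B] d t2 unfolding S_def by blast
  have "joint_decoding (gblock n) (gblock n) (gblock n) (\<Pi>\<^sub>M j\<in>{..<n}. borel)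
    (\<lambda>x v z. received A B n x v z)
    (\<lambda>x v y. exp (real n * t1) * (\<Prod>j<n. gauss_density S1 (y j - B *v v j)) < (\<Prod>j<n. gauss_density (mat 1) (y j - (A *v x j + B *v v j))))
    (\<lambda>x v y. exp (real n * t2) * (\<Prod>j<n. gauss_density S (y j)) < (\<Prod>j<n. gauss_density (mat 1) (y j - (A *v x j + B *v v j))))
    (ennreal (exp (- (real n * t1)))) (ennreal (exp (- (real n * t2)))) (ennreal ((V1 + V2) / (real n * d\<^sup>2)))"
    if n: "0 < n" for n
  proof -
    let ?X = "gblock n :: (nat \<Rightarrow> real^'m) measure" and ?V = "gblock n :: (nat \<Rightarrow> real^'k) measure" and ?Z = "gblock n :: (nat \<Rightarrow> real^'r) measure"
    let ?Y = "\<Pi>\<^sub>M j\<in>{..<n}. borel :: (real^'r) measure"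
    interpret X: prob_space ?X by simp
    interpret V: prob_space ?V by simp
    interpret Z: prob_space ?Z by simp
    have e: "1 / exp (real n * t) = exp (- (real n * t))" for t by (simp add: exp_minus field_simps)
    show ?thesis
    proof unfold_locales
      show "(\<lambda>(x, v, z). received A B n x v z) \<in> ?X \<Otimes>\<^sub>M ?V \<Otimes>\<^sub>M ?Z \<rightarrow>\<^sub>M ?Y"
        unfolding received_def split_def by measurable
      show "Measurable.pred (?X \<Otimes>\<^sub>M ?V \<Otimes>\<^sub>M ?Y) (\<lambda>(x, v, y). exp (real n * t1) * (\<Prod>j<n. gauss_density S1 (y j - B *v v j)) < (\<Prod>j<n. gauss_density (mat 1) (y j - (A *v x j + B *v v j))))"
        unfolding split_def by measurable
      show "Measurable.pred (?X \<Otimes>\<^sub>M ?V \<Otimes>\<^sub>M ?Y) (\<lambda>(x, v, y). exp (real n * t2) * (\<Prod>j<n. gauss_density S (y j)) < (\<Prod>j<n. gauss_density (mat 1) (y j - (A *v x j + B *v v j))))"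
        unfolding split_def by measurable
    next
      fix v y assume "v \<in> space ?V" "y \<in> space ?Y"
      have "(\<integral>\<^sup>+x. ennreal (\<Prod>j<n. gauss_density (mat 1) (y j - (A *v x j + B *v v j))) \<partial>?X)
        = ennreal (\<Prod>j<n. gauss_density S1 (y j - B *v v j))"
        using nn_integral_gblock_density[OF pos_semidef_0, of n "\<lambda>j. y j - B *v v j" A]
        by (simp add: S1_def algebra_simps)
      then show "emeasure ?X {x \<in> space ?X. exp (real n * t1) * (\<Prod>j<n. gauss_density S1 (y j - B *v v j)) < (\<Prod>j<n. gauss_density (mat 1) (y j - (A *v x j + B *v v j)))}
        \<le> ennreal (exp (- (real n * t1)))"
        unfolding e[symmetric]
        by (intro emeasure_likelihood_ratio_bound prod_nonneg prod_pos gauss_density_pos S1) (auto simp: less_imp_le[OF gpos])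
    next
      fix y assume "y \<in> space ?Y"
      have B0: "(\<integral>\<^sup>+v. ennreal (\<Prod>j<n. gauss_density (mat 1) (w j - B *v v j)) \<partial>?V)
        = ennreal (\<Prod>j<n. gauss_density (mat 1 + B ** transpose B) (w j))" for w
        using nn_integral_gblock_density[OF pos_semidef_0, of n w B] by simp
      have "(\<integral>\<^sup>+q. ennreal (\<Prod>j<n. gauss_density (mat 1) (y j - (A *v fst q j + B *v snd q j))) \<partial>(?X \<Otimes>\<^sub>M ?V))
        = (\<integral>\<^sup>+x. \<integral>\<^sup>+v. ennreal (\<Prod>j<n. gauss_density (mat 1) ((y j - A *v x j) - B *v v j)) \<partial>?V \<partial>?X)"
        by (subst V.nn_integral_fst[symmetric]) (auto simp: diff_diff_eq)
      also have "\<dots> = (\<integral>\<^sup>+x. ennreal (\<Prod>j<n. gauss_density (mat 1 + B ** transpose B) (y j - A *v x j)) \<partial>?X)"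
        by (simp only: B0)
      also have "\<dots> = ennreal (\<Prod>j<n. gauss_density S (y j))"
        by (simp only: nn_integral_gblock_density[OF pos_semidef_gram] S_def ac_simps)
      finally show "emeasure (?X \<Otimes>\<^sub>M ?V) {q \<in> space (?X \<Otimes>\<^sub>M ?V). exp (real n * t2) * (\<Prod>j<n. gauss_density S (y j)) < (\<Prod>j<n. gauss_density (mat 1) (y j - (A *v fst q j + B *v snd q j)))}
        \<le> ennreal (exp (- (real n * t2)))"
        unfolding e[symmetric]
        by (intro emeasure_likelihood_ratio_bound prod_nonneg prod_pos gauss_density_pos S) (auto simp: less_imp_le[OF gpos])
    next
      let ?N = "?X \<Otimes>\<^sub>M ?V \<Otimes>\<^sub>M ?Z"
      let ?E1 = "{q \<in> space ?N. \<not> exp (real n * t1) * (\<Prod>j<n. gauss_density S1 (A *v fst q j + (0 :: real^'k^'r) *v fst (snd q) j + snd (snd q) j))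
        < (\<Prod>j<n. gauss_density (mat 1) (snd (snd q) j))}"
      let ?E2 = "{q \<in> space ?N. \<not> exp (real n * t2) * (\<Prod>j<n. gauss_density S (A *v fst q j + B *v fst (snd q) j + snd (snd q) j))
        < (\<Prod>j<n. gauss_density (mat 1) (snd (snd q) j))}"
      let ?E = "{q \<in> space ?N. \<not> (exp (real n * t1) * (\<Prod>j<n. gauss_density S1 (received A B n (fst q) (fst (snd q)) (snd (snd q)) j - B *v fst (snd q) j))
           < (\<Prod>j<n. gauss_density (mat 1) (received A B n (fst q) (fst (snd q)) (snd (snd q)) j - (A *v fst q j + B *v fst (snd q) j))) \<and>
         exp (real n * t2) * (\<Prod>j<n. gauss_density S (received A B n (fst q) (fst (snd q)) (snd (snd q)) j))
           < (\<Prod>j<n. gauss_density (mat 1) (received A B n (fst q) (fst (snd q)) (snd (snd q)) j - (A *v fst q j + B *v fst (snd q) j))))}"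
      have E1: "?E1 \<in> sets ?N" by measurable
      have E2: "?E2 \<in> sets ?N" by measurable
      have "?E \<subseteq> ?E1 \<union> ?E2"
      proof
        fix q assume q: "q \<in> ?E"
        have r: "(\<Prod>j<n. gauss_density S1 (received A B n (fst q) (fst (snd q)) (snd (snd q)) j - B *v fst (snd q) j))
            = (\<Prod>j<n. gauss_density S1 (A *v fst q j + (0 :: real^'k^'r) *v fst (snd q) j + snd (snd q) j))"
          "(\<Prod>j<n. gauss_density (mat 1) (received A B n (fst q) (fst (snd q)) (snd (snd q)) j - (A *v fst q j + B *v fst (snd q) j)))
            = (\<Prod>j<n. gauss_density (mat 1) (snd (snd q) j))"
          "(\<Prod>j<n. gauss_density S (received A B n (fst q) (fst (snd q)) (snd (snd q)) j))
            = (\<Prod>j<n. gauss_density S (A *v fst q j + B *v fst (snd q) j + snd (snd q) j))"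
          by (simp_all add: received_def algebra_simps)
        show "q \<in> ?E1 \<union> ?E2" using q unfolding mem_Collect_eq r Un_iff by blast
      qed
      then have "emeasure ?N ?E \<le> emeasure ?N (?E1 \<union> ?E2)"
        by (rule emeasure_mono) (intro sets.Un E1 E2)
      also have "\<dots> \<le> emeasure ?N ?E1 + emeasure ?N ?E2" by (rule emeasure_subadditive[OF E1 E2])
      also have "\<dots> \<le> ennreal (V1 / (real n * d\<^sup>2)) + ennreal (V2 / (real n * d\<^sup>2))"
        by (intro add_mono V1 V2 n)
      also have "\<dots> = ennreal ((V1 + V2) / (real n * d\<^sup>2))"
        using V1 V2 by (simp add: ennreal_plus[symmetric] add_divide_distrib del: ennreal_plus)
      finally show "emeasure ?N ?E \<le> ennreal ((V1 + V2) / (real n * d\<^sup>2))" .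
    qed
  qed
  then show thesis using that[of "V1 + V2"] V1(1) V2(1) unfolding S1_def S_def by simp
qed

lemma card_messages_le:
  assumes "0 \<le> R"
  shows "real (card (messages R n)) \<le> 2 * exp (real n * R)"
proof -
  have "1 \<le> exp (real n * R)" using assms by simp
  moreover have "real (card (messages R n)) \<le> exp (real n * R) + 1"
    using of_int_ceiling_le_add_one[of "exp (real n * R)"] by (simp add: messages_def)
  ultimately show ?thesis by linarith
qed

lemma messages_eq: "messages R n = {..<card (messages R n)}"
  by (simp add: messages_def)

lemma ennreal_average_error:
  fixes A :: "real^'m^'r" and B :: "real^'k^'r"
  assumes M: "0 < M1" "0 < M2"
  shows "ennreal (average_error A B n {..<M1} {..<M2} f1 f2 bad) = (\<Sum>m1<M1. \<Sum>m2<M2.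
     emeasure (gblock n) {z \<in> space (gblock n). bad (received A B n (f1 m1) (f2 m2) z) m1 m2}) / ennreal (real M1 * real M2)"
proof -
  interpret G: prob_space "gblock n :: (nat \<Rightarrow> real^'r) measure" by simp
  show ?thesis
    unfolding average_error_def G.emeasure_eq_measure using M
    by (subst divide_ennreal[symmetric]) (auto simp: sum_nonneg sum_ennreal)
qed

abbreviation codebook :: "real \<Rightarrow> nat \<Rightarrow> (nat \<Rightarrow> nat \<Rightarrow> real^'t) measure" where
  "codebook R n \<equiv> \<Pi>\<^sub>M m\<in>messages R n. gblock n"

text \<open>The error is controlled by a measurable function \<open>Bd\<close> of the codebooks
  rather than by the existence of one good draw, because the same draw must also serve the other
  receiver and the power constraints. The decoder may depend on both codebooks.\<close>

abbreviation random_code_bound :: "real^'m^'r \<Rightarrow> real^'k^'r \<Rightarrow> real \<Rightarrow> real \<Rightarrow> nat \<Rightarrow> real \<Rightarrow> bool" where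
  "random_code_bound A B R1 R2 n t \<equiv> \<exists>Bd. Bd \<in> borel_measurable (codebook R1 n \<Otimes>\<^sub>M codebook R2 n) \<and>
      (\<integral>\<^sup>+c. Bd c \<partial>(codebook R1 n \<Otimes>\<^sub>M codebook R2 n)) \<le> ennreal t \<and>
      (\<forall>c1\<in>space (codebook R1 n). \<forall>c2\<in>space (codebook R2 n).
        \<exists>g. decoder R1 n g \<and>
          ennreal (average_error A B n (messages R1 n) (messages R2 n) c1 c2 (\<lambda>y m1 m2. g y \<noteq> m1)) \<le> Bd (c1, c2))"

lemma random_code_receiver:
  fixes A :: "real^'m^'r" and B :: "real^'k^'r"
  assumes R: "0 \<le> R1" "0 \<le> R2"
    and r1: "0 < R1 \<Longrightarrow> R1 < ln (det (mat 1 + A ** transpose A)) / 2"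
    and r2: "0 < R1 \<Longrightarrow> R1 + R2 < ln (det (mat 1 + A ** transpose A + B ** transpose B)) / 2"
  obtains \<tau> :: "nat \<Rightarrow> real" where "\<tau> \<longlonglongrightarrow> 0" "\<And>n. 0 \<le> \<tau> n"
    "\<And>n. 0 < n \<Longrightarrow> random_code_bound A B R1 R2 n (\<tau> n)"
proof (cases "R1 = 0")
  case True
  have "random_code_bound A B R1 R2 n 0" for n
  proof -
    \<comment> \<open>Rate 0 leaves a single message, and the constant decoder never errs; hence the
      rate inequalities are assumed only for a positive rate.\<close>
    have m: "messages R1 n = {0}" using True by (auto simp: messages_def)
    have "average_error A B n (messages R1 n) (messages R2 n) c1 c2 (\<lambda>y m1 m2. 0 \<noteq> m1) = 0" for c1 c2
      by (simp add: average_error_def m)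
    moreover have "decoder R1 n (\<lambda>_ :: nat \<Rightarrow> real^'r. 0)" by (simp add: decoder_def m)
    ultimately show ?thesis by (intro exI[of _ "\<lambda>_. 0"]) fastforce
  qed
  then show thesis using that[of "\<lambda>_. 0"] by simp
next
  case False
  then have R1: "0 < R1" using R by simp
  define J1 where "J1 = ln (det (mat 1 + A ** transpose A)) / 2"
  define J2 where "J2 = ln (det (mat 1 + A ** transpose A + B ** transpose B)) / 2"
  \<comment> \<open>Half of the smaller gap: one \<open>d\<close> lets the false-alarm probabilities
    beat the number of codewords, the other separates the thresholds from the mean information
    densities.\<close>
  define d where "d = min (J1 - R1) (J2 - (R1 + R2)) / 2"
  have d: "0 < d" using r1[OF R1] r2[OF R1] by (simp add: d_def J1_def J2_def)
  have t: "(R1 + d) + d \<le> J1" "(R1 + R2 + d) + d \<le> J2" by (simp_all add: d_def min_def)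
  obtain V where V: "0 \<le> V" and jd: "\<And>n. 0 < n \<Longrightarrow> gaussian_decoding A B n (R1 + d) (R1 + R2 + d) (V / (real n * d\<^sup>2))"
    using joint_decoding_gaussian[OF d t[unfolded J1_def J2_def]] by blast
  \<comment> \<open>The first summand bounds the failures of the transmitted pair. Rounding up at
    most doubles a number of messages, so the two union bounds contribute at most 2 and 4 times
    \<open>exp (- d) ^ n\<close>, which makes 6.\<close>
  define \<tau> where "\<tau> n = V / d\<^sup>2 * inverse (real n) + 6 * exp (- d) ^ n" for n
  have lim: "\<tau> \<longlonglongrightarrow> 0"
  proof -
    have "(\<lambda>n. inverse (real n)) \<longlonglongrightarrow> 0"
      by (rule tendsto_inverse_0_at_top[OF filterlim_real_sequentially])
    moreover have "(\<lambda>n. exp (- d) ^ n) \<longlonglongrightarrow> 0" using d by (intro LIMSEQ_power_zero) simp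
    ultimately have "\<tau> \<longlonglongrightarrow> V / d\<^sup>2 * 0 + 6 * 0" unfolding \<tau>_def by (intro tendsto_add tendsto_mult tendsto_const)
    then show ?thesis by simp
  qed
  have nn: "0 \<le> \<tau> n" for n using V by (simp add: \<tau>_def)
  show thesis
  proof (rule that[OF lim nn])
    fix n :: nat assume n: "0 < n"
    interpret J: joint_decoding "gblock n" "gblock n" "gblock n" "\<Pi>\<^sub>M j\<in>{..<n}. borel" "received A B n"
      "test1 A B n (R1 + d)" "test2 A B n (R1 + R2 + d)"
      "ennreal (exp (- (real n * (R1 + d))))" "ennreal (exp (- (real n * (R1 + R2 + d))))" "ennreal (V / (real n * d\<^sup>2))"
      by (rule jd[OF n])
    define M1 where "M1 = card (messages R1 n)"
    define M2 where "M2 = card (messages R2 n)"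
    have M: "0 < M1" "0 < M2" by (simp_all add: M1_def M2_def card_messages_pos)
    have m: "messages R1 n = {..<M1}" "messages R2 n = {..<M2}"
      unfolding M1_def M2_def by (rule messages_eq)+
    have M1: "real M1 \<le> 2 * exp (real n * R1)" and M2: "real M2 \<le> 2 * exp (real n * R2)"
      unfolding M1_def M2_def using R by (intro card_messages_le; simp)+
    have p1: "real M1 * exp (- (real n * (R1 + d))) \<le> 2 * exp (- d) ^ n"
    proof -
      have "real M1 * exp (- (real n * (R1 + d))) \<le> 2 * exp (real n * R1) * exp (- (real n * (R1 + d)))"
        by (intro mult_right_mono M1) simp
      also have "\<dots> = 2 * exp (- d) ^ n"
        by (simp add: exp_of_nat_mult[symmetric] exp_add[symmetric] mult.assoc algebra_simps)
      finally show ?thesis .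
    qed
    have p2: "real M1 * (real M2 * exp (- (real n * (R1 + R2 + d)))) \<le> 4 * exp (- d) ^ n"
    proof -
      have "real M1 * (real M2 * exp (- (real n * (R1 + R2 + d))))
        \<le> (2 * exp (real n * R1)) * ((2 * exp (real n * R2)) * exp (- (real n * (R1 + R2 + d))))"
        by (intro mult_mono M1 M2) auto
      also have "\<dots> = 4 * (exp (real n * R1) * exp (real n * R2) * exp (- (real n * (R1 + R2 + d))))"
        by simp
      also have "\<dots> = 4 * exp (- d) ^ n"
        by (simp add: exp_of_nat_mult[symmetric] exp_add[symmetric] algebra_simps)
      finally show ?thesis .
    qed
    have "(\<integral>\<^sup>+c. J.codebook_bound M1 M2 c \<partial>(codebook R1 n \<Otimes>\<^sub>M codebook R2 n))
      \<le> ennreal (V / (real n * d\<^sup>2)) + of_nat M1 * ennreal (exp (- (real n * (R1 + d)))) + of_nat M1 * (of_nat M2 * ennreal (exp (- (real n * (R1 + R2 + d)))))"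
      unfolding m by (rule J.integral_codebook_bound[OF M])
    also have "\<dots> = ennreal (V / (real n * d\<^sup>2) + real M1 * exp (- (real n * (R1 + d))) + real M1 * (real M2 * exp (- (real n * (R1 + R2 + d)))))"
      using V by (simp add: ennreal_of_nat_eq_real_of_nat ennreal_mult[symmetric] ennreal_plus[symmetric] del: ennreal_plus)
    also have "\<dots> \<le> ennreal (\<tau> n)"
    proof (rule ennreal_leI)
      have "V / (real n * d\<^sup>2) = V / d\<^sup>2 * inverse (real n)" by (simp add: field_simps)
      then show "V / (real n * d\<^sup>2) + real M1 * exp (- (real n * (R1 + d))) + real M1 * (real M2 * exp (- (real n * (R1 + R2 + d)))) \<le> \<tau> n"
        using p1 p2 by (simp add: \<tau>_def)
    qed
    finally have int: "(\<integral>\<^sup>+c. J.codebook_bound M1 M2 c \<partial>(codebook R1 n \<Otimes>\<^sub>M codebook R2 n)) \<le> ennreal (\<tau> n)" .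
    have dec: "\<exists>g. decoder R1 n g \<and>
          ennreal (average_error A B n (messages R1 n) (messages R2 n) c1 c2 (\<lambda>y m1 m2. g y \<noteq> m1)) \<le> J.codebook_bound M1 M2 (c1, c2)"
      if c: "c1 \<in> space (codebook R1 n)" "c2 \<in> space (codebook R2 n)" for c1 c2
    proof (intro exI conjI)
      note c = c[unfolded m]
      show "decoder R1 n (J.threshold_decoder M1 M2 c1 c2)"
        unfolding decoder_def m by (rule J.threshold_decoder_measurable[OF c M(1)])
      show "ennreal (average_error A B n (messages R1 n) (messages R2 n) c1 c2 (\<lambda>y m1 m2. J.threshold_decoder M1 M2 c1 c2 y \<noteq> m1))
        \<le> J.codebook_bound M1 M2 (c1, c2)"
        unfolding m ennreal_average_error[OF M] J.codebook_bound_def fst_conv snd_conv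
        by (intro divide_right_mono_ennreal sum_mono J.threshold_decoder_error[OF c]) auto
    qed
    show "random_code_bound A B R1 R2 n (\<tau> n)"
    proof -
      have "J.codebook_bound M1 M2 \<in> borel_measurable (codebook R1 n \<Otimes>\<^sub>M codebook R2 n)"
        unfolding m by (rule J.codebook_bound_measurable)
      then show ?thesis using int dec by blast
    qed
  qed
qed

text \<open>The empirical power of a random codebook exceeds its mean by the gap \<open>P - trace (G ** transpose G)\<close>
  only if the mean square of the per-codeword fluctuation exceeds the squared gap, which has small expectation
  for every number of codewords.\<close>

lemma random_code_power:
  fixes G :: "real^'m^'m"
  assumes P: "trace (G ** transpose G) < P \<or> G = 0 \<and> 0 \<le> P"
  obtains V gap :: real where "0 \<le> V" "0 < gap"
    "\<And>n. 0 < n \<Longrightarrow> \<exists>Bd. Bd \<in> borel_measurable (codebook R n) \<and>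
      (\<integral>\<^sup>+c. Bd c \<partial>(codebook R n)) \<le> ennreal (V * inverse (real n)) \<and>
      (\<forall>c. Bd c \<le> ennreal gap \<longrightarrow> power_constraint P R n (\<lambda>m j. G *v c m j))"
proof (cases "G = 0 \<and> 0 \<le> P")
  case True
  then have "power_constraint P R n (\<lambda>m j. G *v c m j)" for n c
    by (simp add: power_constraint_def)
  then show thesis by (intro that[of 0 1]) (auto intro!: exI[of _ "\<lambda>_. 0"])
next
  case False
  define tr where "tr = trace (G ** transpose G)"
  define gp where "gp = P - tr"
  have gp: "0 < gp" using P False by (auto simp: gp_def tr_def)
  define k where "k x = (norm (G *v x))\<^sup>2 - tr" for x
  have k: "k \<in> borel_measurable std_gaussian" "integrable std_gaussian (\<lambda>x. (k x)\<^sup>2)" "(\<integral>x. k x \<partial>std_gaussian) = 0"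
    using power_excess_moments[of G] unfolding k_def[abs_def] tr_def by auto
  define V where "V = (\<integral>x. (k x)\<^sup>2 \<partial>std_gaussian)"
  have V: "0 \<le> V" by (simp add: V_def)
  have "\<exists>Bd. Bd \<in> borel_measurable (codebook R n) \<and>
      (\<integral>\<^sup>+c. Bd c \<partial>(codebook R n)) \<le> ennreal (V * inverse (real n)) \<and>
      (\<forall>c. Bd c \<le> ennreal (gp\<^sup>2) \<longrightarrow> power_constraint P R n (\<lambda>m j. G *v c m j))" if n: "0 < n" for n
  proof -
    let ?C = "codebook R n :: (nat \<Rightarrow> nat \<Rightarrow> real^'m) measure"
    define M where "M = real (card (messages R n))"
    have M: "0 < M" by (simp add: M_def card_messages_pos)
    define y where "y x = (\<Sum>j<n. k (x j)) / real n" for x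
    have km: "(\<lambda>x. k (x j)) \<in> borel_measurable (gblock n)" if "j < n" for j
      using that by (intro measurable_compose[OF _ k(1)] measurable_component_singleton) simp
    have ym: "y \<in> borel_measurable (gblock n)"
      unfolding y_def[abs_def] using km by (intro borel_measurable_divide borel_measurable_sum) auto
    have y2m: "(\<lambda>x. ennreal ((y x)\<^sup>2)) \<in> borel_measurable (gblock n)" using ym by simp
    have inty: "(\<integral>\<^sup>+x. ennreal ((y x)\<^sup>2) \<partial>gblock n) = ennreal (V * inverse (real n))"
    proof -
      have "(\<integral>\<^sup>+x. ennreal ((y x)\<^sup>2) \<partial>gblock n) = (\<integral>\<^sup>+x. ennreal (1 / (real n)\<^sup>2) * ennreal ((\<Sum>j<n. k (x j))\<^sup>2) \<partial>gblock n)"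
        by (simp add: y_def power_divide ennreal_mult[symmetric])
      also have "\<dots> = ennreal (1 / (real n)\<^sup>2) * ennreal (real n * V)"
        unfolding V_def integral_PiM_square_sum[OF prob_space_std_gaussian k, symmetric]
        using km by (intro nn_integral_cmult) simp
      also have "\<dots> = ennreal (V * inverse (real n))"
        using V n by (simp add: ennreal_mult[symmetric] power2_eq_square field_simps)
      finally show ?thesis .
    qed
    define Bd where "Bd c = (\<Sum>m\<in>messages R n. ennreal ((y (c m))\<^sup>2)) / ennreal M" for c
    have ycm: "(\<lambda>c. ennreal ((y (c m))\<^sup>2)) \<in> borel_measurable ?C" if "m \<in> messages R n" for m
      using that by (intro measurable_compose[OF _ y2m] measurable_component_singleton)
    have "Bd \<in> borel_measurable ?C"
      unfolding Bd_def[abs_def] by (intro borel_measurable_divide_ennreal borel_measurable_sum ycm) auto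
    moreover have "(\<integral>\<^sup>+c. Bd c \<partial>?C) \<le> ennreal (V * inverse (real n))"
    proof -
      have "(\<integral>\<^sup>+c. Bd c \<partial>?C) = (\<Sum>m\<in>messages R n. \<integral>\<^sup>+c. ennreal ((y (c m))\<^sup>2) \<partial>?C) / ennreal M"
      proof -
        have "(\<integral>\<^sup>+c. (\<Sum>m\<in>messages R n. ennreal ((y (c m))\<^sup>2)) \<partial>?C) = (\<Sum>m\<in>messages R n. \<integral>\<^sup>+c. ennreal ((y (c m))\<^sup>2) \<partial>?C)"
          by (intro nn_integral_sum ycm)
        moreover have "(\<lambda>c. \<Sum>m\<in>messages R n. ennreal ((y (c m))\<^sup>2)) \<in> borel_measurable ?C"
          by (intro borel_measurable_sum ycm)
        ultimately show ?thesis unfolding Bd_def by (simp only: nn_integral_divide)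
      qed
      also have "\<dots> = (\<Sum>m\<in>messages R n. ennreal (V * inverse (real n))) / ennreal M"
        using nn_integral_PiM_component[OF prob_space_gblock _ y2m]
        by (intro arg_cong[where f = "\<lambda>x. x / ennreal M"] sum.cong refl) (simp add: inty)
      also have "\<dots> = ennreal (V * inverse (real n))"
        using M V by (simp add: ennreal_of_nat_eq_real_of_nat M_def[symmetric] ennreal_mult_divide_eq mult.commute[of "ennreal M"])
      finally show ?thesis by simp
    qed
    moreover have "power_constraint P R n (\<lambda>m j. G *v c m j)" if c: "Bd c \<le> ennreal (gp\<^sup>2)" for c
    proof -
      have "ennreal ((\<Sum>m\<in>messages R n. (y (c m))\<^sup>2) / M) = Bd c"
        unfolding Bd_def using M by (subst divide_ennreal[symmetric]) (auto simp: sum_nonneg sum_ennreal)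
      then have "ennreal ((\<Sum>m\<in>messages R n. (y (c m))\<^sup>2) / M) \<le> ennreal (gp\<^sup>2)" using c by simp
      then have avg: "(\<Sum>m\<in>messages R n. (y (c m))\<^sup>2) / M \<le> gp\<^sup>2" by (subst (asm) ennreal_le_iff) auto
      \<comment> \<open>Young's inequality. After averaging over the messages both terms are at most
        \<open>gp / 2\<close>, so the mean excess power is at most \<open>gp\<close>, although a
        single codeword may exceed the power by far.\<close>
      have yle: "y (c m) \<le> gp / 2 + (y (c m))\<^sup>2 / (2 * gp)" for m
        using sum_squares_bound[of "y (c m)" gp] gp by (simp add: field_simps power2_eq_square)
      have "1 / real n * (\<Sum>j<n. (\<Sum>m\<in>messages R n. (norm (G *v c m j))\<^sup>2) / M)
        = (\<Sum>m\<in>messages R n. (\<Sum>j<n. (norm (G *v c m j))\<^sup>2) / real n) / M"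
        by (simp add: sum_divide_distrib[symmetric] sum.swap[of _ "messages R n"] mult.commute)
      also have "\<dots> = (\<Sum>m\<in>messages R n. tr + y (c m)) / M"
        using n by (simp add: y_def k_def sum_subtractf diff_divide_distrib)
      also have "\<dots> \<le> (\<Sum>m\<in>messages R n. tr + gp / 2 + (y (c m))\<^sup>2 / (2 * gp)) / M"
        using M yle by (intro divide_right_mono sum_mono) (auto simp: add.assoc)
      also have "\<dots> = tr + gp / 2 + ((\<Sum>m\<in>messages R n. (y (c m))\<^sup>2) / M) / (2 * gp)"
        using M by (simp add: sum.distrib add_divide_distrib sum_divide_distrib[symmetric] M_def[symmetric] mult.commute)
      also have "\<dots> \<le> tr + gp / 2 + gp\<^sup>2 / (2 * gp)"
        using gp avg by (intro add_left_mono divide_right_mono) auto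
      also have "gp\<^sup>2 / (2 * gp) = gp / 2" using gp by (simp add: power2_eq_square)
      also have "tr + gp / 2 + gp / 2 = P" by (simp add: gp_def)
      finally show ?thesis by (simp add: power_constraint_def expectation_message_law M_def)
    qed
    ultimately show ?thesis by blast
  qed
  then show thesis using that[of V "gp\<^sup>2"] V gp by simp
qed

lemma received_matrix_mult:
  "received H1 H2 n (\<lambda>j. G1 *v x j) (\<lambda>j. G2 *v v j) z = received (H1 ** G1) (H2 ** G2) n x v z"
  by (simp add: received_def matrix_vector_mul_assoc)

lemma average_error_matrix_mult:
  "average_error H1 H2 n I1 I2 (\<lambda>m j. G1 *v c1 m j) (\<lambda>m j. G2 *v c2 m j) bad
    = average_error (H1 ** G1) (H2 ** G2) n I1 I2 c1 c2 bad"
  by (simp add: average_error_def received_matrix_mult)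

text \<open>The transmitted vectors are \<open>G1 *v c1 m j\<close> and \<open>G2 *v c2 m j\<close>
  with standard Gaussian codebooks. For the error analysis the factors are absorbed into the channel
  matrices; for the power constraints they stay with the codewords.\<close>

lemma achievable_gaussian:
  fixes H1 H3 :: "real^'t^'r" and H2 H4 :: "real^'r^'r" and G1 :: "real^'t^'t" and G2 :: "real^'r^'r"
    and N :: "((real^'r) \<times> (real^'r)) measure"
  assumes N: "noise_law N" and R: "0 \<le> R1" "0 \<le> R2"
    and P1: "trace (G1 ** transpose G1) < P1 \<or> G1 = 0 \<and> 0 \<le> P1"
    and P2: "trace (G2 ** transpose G2) < P2 \<or> G2 = 0 \<and> 0 \<le> P2"
    and r1: "0 < R1 \<Longrightarrow> R1 < ln (det (mat 1 + (H1 ** G1) ** transpose (H1 ** G1))) / 2"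
    and r12: "0 < R1 \<Longrightarrow> R1 + R2 < ln (det (mat 1 + (H1 ** G1) ** transpose (H1 ** G1) + (H2 ** G2) ** transpose (H2 ** G2))) / 2"
    and r2: "0 < R2 \<Longrightarrow> R2 < ln (det (mat 1 + (H4 ** G2) ** transpose (H4 ** G2))) / 2"
    and r21: "0 < R2 \<Longrightarrow> R2 + R1 < ln (det (mat 1 + (H4 ** G2) ** transpose (H4 ** G2) + (H3 ** G1) ** transpose (H3 ** G1))) / 2"
  shows "achievable H1 H2 H3 H4 N P1 P2 R1 R2"
proof -
  let ?C1 = "codebook R1 :: nat \<Rightarrow> (nat \<Rightarrow> nat \<Rightarrow> real^'t) measure"
  let ?C2 = "codebook R2 :: nat \<Rightarrow> (nat \<Rightarrow> nat \<Rightarrow> real^'r) measure"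
  obtain \<tau>1 :: "nat \<Rightarrow> real" where \<tau>1: "\<tau>1 \<longlonglongrightarrow> 0" "\<And>n. 0 \<le> \<tau>1 n"
    "\<And>n. 0 < n \<Longrightarrow> random_code_bound (H1 ** G1) (H2 ** G2) R1 R2 n (\<tau>1 n)"
    using random_code_receiver[OF R r1 r12] by blast
  obtain \<tau>2 :: "nat \<Rightarrow> real" where \<tau>2: "\<tau>2 \<longlonglongrightarrow> 0" "\<And>n. 0 \<le> \<tau>2 n"
    "\<And>n. 0 < n \<Longrightarrow> random_code_bound (H4 ** G2) (H3 ** G1) R2 R1 n (\<tau>2 n)"
    using random_code_receiver[OF R(2,1) r2 r21] by blast
  obtain V1 gap1 :: real where V1: "0 \<le> V1" "0 < gap1"
    "\<And>n. 0 < n \<Longrightarrow> \<exists>Bd. Bd \<in> borel_measurable (?C1 n) \<and> (\<integral>\<^sup>+c. Bd c \<partial>(?C1 n)) \<le> ennreal (V1 * inverse (real n)) \<and>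
      (\<forall>c. Bd c \<le> ennreal gap1 \<longrightarrow> power_constraint P1 R1 n (\<lambda>m j. G1 *v c m j))"
    using random_code_power[OF P1, of R1] by blast
  obtain V2 gap2 :: real where V2: "0 \<le> V2" "0 < gap2"
    "\<And>n. 0 < n \<Longrightarrow> \<exists>Bd. Bd \<in> borel_measurable (?C2 n) \<and> (\<integral>\<^sup>+c. Bd c \<partial>(?C2 n)) \<le> ennreal (V2 * inverse (real n)) \<and>
      (\<forall>c. Bd c \<le> ennreal gap2 \<longrightarrow> power_constraint P2 R2 n (\<lambda>m j. G2 *v c m j))"
    using random_code_power[OF P2, of R2] by blast
  have "0 \<le> trace (G1 ** transpose G1)" "0 \<le> trace (G2 ** transpose G2)"
    by (intro trace_pos_semidef_nonneg pos_semidef_gram)+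
  then have P: "0 \<le> P1" "0 \<le> P2" using P1 P2 by auto
  define \<tau> where "\<tau> n = \<tau>1 n + \<tau>2 n + V1 * inverse (real n) + V2 * inverse (real n)" for n
  have \<tau>_lim: "\<tau> \<longlonglongrightarrow> 0"
  proof -
    have i: "(\<lambda>n. inverse (real n)) \<longlonglongrightarrow> 0"
      by (rule tendsto_inverse_0_at_top[OF filterlim_real_sequentially])
    have "\<tau> \<longlonglongrightarrow> 0 + 0 + V1 * 0 + V2 * 0"
      unfolding \<tau>_def by (intro tendsto_add tendsto_mult tendsto_const i \<tau>1 \<tau>2)
    then show ?thesis by simp
  qed
  \<comment> \<open>Power constraints must hold for every positive block length, small errors only
    eventually. While \<open>\<tau> n\<close> is too large to guarantee the power, the all-zero code
    with a constant decoder is used.\<close>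
  let ?ok = "\<lambda>n f1 f2 g1 g2. power_constraint P1 R1 n f1 \<and> power_constraint P2 R2 n f2 \<and> decoder R1 n g1 \<and> decoder R2 n g2 \<and>
     (\<tau> n \<le> min gap1 gap2 \<longrightarrow> error1 H1 H2 N R1 R2 n f1 f2 g1 \<le> \<tau> n \<and> error2 H3 H4 N R1 R2 n f1 f2 g2 \<le> \<tau> n)"
  have ex: "\<exists>f1 f2 g1 g2. ?ok n f1 f2 g1 g2" if n: "0 < n" for n
  proof (cases "\<tau> n \<le> min gap1 gap2")
    case False
    have d: "decoder Q n (\<lambda>_ :: nat \<Rightarrow> real^'r. 0)" for Q
    proof -
      have "0 \<in> messages Q n" by (subst messages_eq) (simp add: card_messages_pos)
      then show ?thesis by (simp add: decoder_def)
    qed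
    have "power_constraint P1 R1 n (\<lambda>_ _. 0 :: real^'t)" "power_constraint P2 R2 n (\<lambda>_ _. 0 :: real^'r)"
      using P by (auto simp: power_constraint_def)
    then show ?thesis using False d by blast
  next
    case True
    interpret K1: prob_space "?C1 n" by (intro prob_space_PiM prob_space_gblock)
    interpret K2: prob_space "?C2 n" by (intro prob_space_PiM prob_space_gblock)
    interpret K12: pair_prob_space "?C1 n" "?C2 n" ..
    interpret K21: pair_prob_space "?C2 n" "?C1 n" ..
    let ?N = "?C1 n \<Otimes>\<^sub>M ?C2 n"
    obtain B1 where B1: "B1 \<in> borel_measurable ?N" "(\<integral>\<^sup>+c. B1 c \<partial>?N) \<le> ennreal (\<tau>1 n)"
      "\<And>c1 c2. c1 \<in> space (?C1 n) \<Longrightarrow> c2 \<in> space (?C2 n) \<Longrightarrow> \<exists>g. decoder R1 n g \<and>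
          ennreal (average_error (H1 ** G1) (H2 ** G2) n (messages R1 n) (messages R2 n) c1 c2 (\<lambda>y m1 m2. g y \<noteq> m1)) \<le> B1 (c1, c2)"
      using \<tau>1(3)[OF n] by blast
    obtain B2 where B2: "B2 \<in> borel_measurable (?C2 n \<Otimes>\<^sub>M ?C1 n)" "(\<integral>\<^sup>+c. B2 c \<partial>(?C2 n \<Otimes>\<^sub>M ?C1 n)) \<le> ennreal (\<tau>2 n)"
      "\<And>c1 c2. c1 \<in> space (?C1 n) \<Longrightarrow> c2 \<in> space (?C2 n) \<Longrightarrow> \<exists>g. decoder R2 n g \<and>
          ennreal (average_error (H4 ** G2) (H3 ** G1) n (messages R2 n) (messages R1 n) c2 c1 (\<lambda>y m2 m1. g y \<noteq> m2)) \<le> B2 (c2, c1)"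
      using \<tau>2(3)[OF n] by blast
    obtain Q1 where Q1: "Q1 \<in> borel_measurable (?C1 n)" "(\<integral>\<^sup>+c. Q1 c \<partial>?C1 n) \<le> ennreal (V1 * inverse (real n))"
      "\<And>c. Q1 c \<le> ennreal gap1 \<Longrightarrow> power_constraint P1 R1 n (\<lambda>m j. G1 *v c m j)"
      using V1(3)[OF n] by blast
    obtain Q2 where Q2: "Q2 \<in> borel_measurable (?C2 n)" "(\<integral>\<^sup>+c. Q2 c \<partial>?C2 n) \<le> ennreal (V2 * inverse (real n))"
      "\<And>c. Q2 c \<le> ennreal gap2 \<Longrightarrow> power_constraint P2 R2 n (\<lambda>m j. G2 *v c m j)"
      using V2(3)[OF n] by blast
    have m: "(\<lambda>c. B2 (snd c, fst c)) \<in> borel_measurable ?N"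
      by (rule measurable_compose[OF _ B2(1)]) simp
    have m1: "(\<lambda>c. Q1 (fst c)) \<in> borel_measurable ?N" by (rule measurable_compose[OF measurable_fst Q1(1)])
    have m2: "(\<lambda>c. Q2 (snd c)) \<in> borel_measurable ?N" by (rule measurable_compose[OF measurable_snd Q2(1)])
    have i2: "(\<integral>\<^sup>+c. B2 (snd c, fst c) \<partial>?N) = (\<integral>\<^sup>+c. B2 c \<partial>(?C2 n \<Otimes>\<^sub>M ?C1 n))"
      by (subst K21.distr_pair_swap) (simp add: nn_integral_distr B2(1) split_def)
    have i3: "(\<integral>\<^sup>+c. Q1 (fst c) \<partial>?N) = (\<integral>\<^sup>+c. Q1 c \<partial>?C1 n)"
      using K2.nn_integral_fst[OF m1] by (simp add: K2.emeasure_space_1)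
    have i4: "(\<integral>\<^sup>+c. Q2 (snd c) \<partial>?N) = (\<integral>\<^sup>+c. Q2 c \<partial>?C2 n)"
      using K2.nn_integral_fst[OF m2] by (simp add: K1.emeasure_space_1)
    \<comment> \<open>All four summands are nonnegative, so a draw with
      \<open>\<Phi> c \<le> ennreal (\<tau> n)\<close> meets both error bounds and, as
      \<open>\<tau> n\<close> is at most either gap, both power constraints.\<close>
    define \<Phi> where "\<Phi> c = B1 c + B2 (snd c, fst c) + Q1 (fst c) + Q2 (snd c)" for c
    have \<Phi>m: "\<Phi> \<in> borel_measurable ?N" unfolding \<Phi>_def by (intro borel_measurable_add B1 m m1 m2)
    have "(\<integral>\<^sup>+c. \<Phi> c \<partial>?N) = (\<integral>\<^sup>+c. B1 c \<partial>?N) + (\<integral>\<^sup>+c. B2 c \<partial>(?C2 n \<Otimes>\<^sub>M ?C1 n)) + (\<integral>\<^sup>+c. Q1 c \<partial>?C1 n) + (\<integral>\<^sup>+c. Q2 c \<partial>?C2 n)"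
      unfolding \<Phi>_def using B1(1) m m1 m2 by (simp add: nn_integral_add i2 i3 i4)
    also have "\<dots> \<le> ennreal (\<tau>1 n) + ennreal (\<tau>2 n) + ennreal (V1 * inverse (real n)) + ennreal (V2 * inverse (real n))"
      by (intro add_mono B1 B2 Q1 Q2)
    also have "\<dots> = ennreal (\<tau> n)"
      using \<tau>1(2)[of n] \<tau>2(2)[of n] V1(1) V2(1) by (simp add: \<tau>_def)
    finally obtain c where c: "c \<in> space ?N" "\<Phi> c \<le> ennreal (\<tau> n)"
      using K12.ex_le_of_nn_integral_le[OF \<Phi>m] by blast
    obtain c1 c2 where cc: "c = (c1, c2)" by (cases c)
    have sp: "c1 \<in> space (?C1 n)" "c2 \<in> space (?C2 n)" using c(1) by (auto simp: cc space_pair_measure)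
    have le: "B1 (c1, c2) \<le> \<Phi> c" "B2 (c2, c1) \<le> \<Phi> c" "Q1 c1 \<le> \<Phi> c" "Q2 c2 \<le> \<Phi> c"
      by (auto simp: \<Phi>_def cc add_increasing add_increasing2)
    have nn: "0 \<le> \<tau> n" using \<tau>1(2)[of n] \<tau>2(2)[of n] V1(1) V2(1) by (simp add: \<tau>_def)
    obtain g1 where g1: "decoder R1 n g1"
      "ennreal (average_error (H1 ** G1) (H2 ** G2) n (messages R1 n) (messages R2 n) c1 c2 (\<lambda>y m1 m2. g1 y \<noteq> m1)) \<le> B1 (c1, c2)"
      using B1(3)[OF sp] by blast
    obtain g2 where g2: "decoder R2 n g2"
      "ennreal (average_error (H4 ** G2) (H3 ** G1) n (messages R2 n) (messages R1 n) c2 c1 (\<lambda>y m2 m1. g2 y \<noteq> m2)) \<le> B2 (c2, c1)"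
      using B2(3)[OF sp] by blast
    define f1 where "f1 m j = G1 *v c1 m j" for m j
    define f2 where "f2 m j = G2 *v c2 m j" for m j
    have "ennreal (average_error (H1 ** G1) (H2 ** G2) n (messages R1 n) (messages R2 n) c1 c2 (\<lambda>y m1 m2. g1 y \<noteq> m1)) \<le> ennreal (\<tau> n)"
      using g1(2) le(1) c(2) by (meson order_trans)
    then have e1: "error1 H1 H2 N R1 R2 n f1 f2 g1 \<le> \<tau> n"
      unfolding error1_average[OF N g1(1)] f1_def f2_def average_error_matrix_mult ennreal_le_iff[OF nn] .
    have "ennreal (average_error (H4 ** G2) (H3 ** G1) n (messages R2 n) (messages R1 n) c2 c1 (\<lambda>y m2 m1. g2 y \<noteq> m2)) \<le> ennreal (\<tau> n)"
      using g2(2) le(2) c(2) by (meson order_trans)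
    then have e2: "error2 H3 H4 N R1 R2 n f1 f2 g2 \<le> \<tau> n"
      unfolding error2_average[OF N g2(1)] average_error_swap[of H3 H4] f1_def f2_def average_error_matrix_mult ennreal_le_iff[OF nn] .
    have "Q1 c1 \<le> ennreal gap1" "Q2 c2 \<le> ennreal gap2"
      using le(3,4) c(2) True ennreal_leI[of "\<tau> n" gap1] ennreal_leI[of "\<tau> n" gap2] by (auto intro: order_trans)
    then have "power_constraint P1 R1 n f1" "power_constraint P2 R2 n f2"
      unfolding f1_def f2_def using Q1(3) Q2(3) by blast+
    then show ?thesis using g1(1) g2(1) e1 e2 by blast
  qed
  obtain f1 f2 g1 g2 where ok: "\<And>n. 0 < n \<Longrightarrow> ?ok n (f1 n) (f2 n) (g1 n) (g2 n)"
  proof -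
    have "\<forall>n. \<exists>p. 0 < n \<longrightarrow> ?ok n (fst p) (fst (snd p)) (fst (snd (snd p))) (snd (snd (snd p)))"
      using ex by (simp add: split_paired_Ex)
    then obtain p where p: "\<forall>n. 0 < n \<longrightarrow> ?ok n (fst (p n)) (fst (snd (p n))) (fst (snd (snd (p n)))) (snd (snd (snd (p n))))"
      by (rule choice[THEN exE])
    show thesis
      by (rule that[of "\<lambda>n. fst (p n)" "\<lambda>n. fst (snd (p n))" "\<lambda>n. fst (snd (snd (p n)))" "\<lambda>n. snd (snd (snd (p n)))"])
        (use p in blast)
  qed
  have small: "eventually (\<lambda>n. \<tau> n \<le> min gap1 gap2 \<and> 0 < n) sequentially"
  proof -
    have "eventually (\<lambda>n. \<tau> n < min gap1 gap2) sequentially"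
      using \<tau>_lim V1(2) V2(2) by (intro order_tendstoD(2)[of \<tau> 0]) auto
    then show ?thesis using eventually_gt_at_top[of 0] by eventually_elim simp
  qed
  have "(\<lambda>n. error1 H1 H2 N R1 R2 n (f1 n) (f2 n) (g1 n)) \<longlonglongrightarrow> 0"
  proof (rule tendsto_sandwich[OF _ _ tendsto_const \<tau>_lim])
    show "eventually (\<lambda>n. 0 \<le> error1 H1 H2 N R1 R2 n (f1 n) (f2 n) (g1 n)) sequentially" by (simp add: error1_def)
    show "eventually (\<lambda>n. error1 H1 H2 N R1 R2 n (f1 n) (f2 n) (g1 n) \<le> \<tau> n) sequentially"
      using small by eventually_elim (use ok in blast)
  qed
  moreover have "(\<lambda>n. error2 H3 H4 N R1 R2 n (f1 n) (f2 n) (g2 n)) \<longlonglongrightarrow> 0"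
  proof (rule tendsto_sandwich[OF _ _ tendsto_const \<tau>_lim])
    show "eventually (\<lambda>n. 0 \<le> error2 H3 H4 N R1 R2 n (f1 n) (f2 n) (g2 n)) sequentially" by (simp add: error2_def)
    show "eventually (\<lambda>n. error2 H3 H4 N R1 R2 n (f1 n) (f2 n) (g2 n) \<le> \<tau> n) sequentially"
      using small by eventually_elim (use ok in blast)
  qed
  ultimately show ?thesis
    unfolding achievable_def using R ok by blast
qed

section \<open>Approaching the region by shrinking the covariances\<close>

lemma trace_gram_eq_0: "trace (G ** transpose G) = 0 \<Longrightarrow> G = 0" for G :: "real^'m^'n"
proof -
  assume "trace (G ** transpose G) = 0"
  then have "(\<Sum>i\<in>UNIV. \<Sum>k\<in>UNIV. (G $ i $ k)\<^sup>2) = 0"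
    by (simp add: trace_def matrix_matrix_mult_def transpose_def power2_eq_square)
  then have "G $ i $ k = 0" for i k
    by (simp add: sum_nonneg_eq_0_iff sum_nonneg)
  then show "G = 0" by (simp add: vec_eq_iff)
qed

lemma gram_scaled_factor:
  fixes S :: "real^'n^'n" and H :: "real^'n^'m"
  assumes "c *\<^sub>R S = G ** transpose G"
  shows "(H ** G) ** transpose (H ** G) = c *\<^sub>R (H ** S ** transpose H)"
proof -
  have "(H ** G) ** transpose (H ** G) = H ** (G ** transpose G) ** transpose H"
    by (simp add: matrix_transpose_mul matrix_mul_assoc)
  also have "\<dots> = c *\<^sub>R (H ** S ** transpose H)"
    unfolding assms[symmetric] by (simp add: matrix_scalar_ac scalar_matrix_assoc scalar_mult_eq_scaleR[symmetric])
  finally show ?thesis .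
qed

text \<open>Shrinking by \<open>c < 1\<close> creates slack unless \<open>S\<close> has trace 0; in
  that case \<open>G\<close> vanishes, which is admissible even for \<open>P = 0\<close>.\<close>

lemma power_slack:
  fixes S :: "real^'n^'n"
  assumes S: "pos_semidef S" "trace S \<le> P" and c: "0 \<le> c" "c < 1" and G: "c *\<^sub>R S = G ** transpose G"
  shows "trace (G ** transpose G) < P \<or> G = 0 \<and> 0 \<le> P"
proof -
  have tr: "trace (G ** transpose G) = c * trace S" by (simp add: G[symmetric] trace_def sum_distrib_left)
  have nn: "0 \<le> trace S" by (rule trace_pos_semidef_nonneg[OF S(1)])
  show ?thesis
  proof (cases "trace S = 0")
    case True
    then show ?thesis using S(2) trace_gram_eq_0[of G] tr by simp
  next
    case False
    then have "c * trace S < 1 * trace S" using nn c by (intro mult_strict_right_mono) auto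
    then show ?thesis using S(2) by (simp add: tr)
  qed
qed

lemma rate_region_subset_closure:
  fixes H1 H3 :: "real^'t^'r" and H2 H4 :: "real^'r^'r" and N :: "((real^'r) \<times> (real^'r)) measure"
  assumes N: "noise_law N" and mem: "(R1, R2) \<in> rate_region H1 H2 H3 H4 P1 P2"
  shows "(R1, R2) \<in> closure {(R1, R2). achievable H1 H2 H3 H4 N P1 P2 R1 R2}"
proof -
  obtain S1 :: "real^'t^'t" and S2 :: "real^'r^'r" where S: "pos_semidef S1" "pos_semidef S2" "trace S1 \<le> P1" "trace S2 \<le> P2"
    and R: "0 \<le> R1" "0 \<le> R2"
    and b1: "R1 \<le> rate1 H1 S1"
    and b2: "R2 \<le> rate1 H4 S2"
    and b12: "R1 + R2 \<le> rate2 H1 S1 H2 S2"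
    and b21: "R1 + R2 \<le> rate2 H3 S1 H4 S2"
    using mem unfolding rate_region_iff by blast
  \<comment> \<open>As \<open>c\<close> increases to 1 the shrunk rate tends to the full one. The
    case \<open>Y = 0\<close> covers the single-user bounds.\<close>
  have lim: "((\<lambda>c. ln (det (mat 1 + c *\<^sub>R X + c *\<^sub>R Y)) / 2) \<longlongrightarrow> ln (det (mat 1 + X + Y)) / 2) (at_left 1)"
    if X: "pos_semidef X" and Y: "pos_semidef Y" for X Y :: "real^'r^'r"
  proof -
    have "det (mat 1 + c *\<^sub>R X + c *\<^sub>R Y) \<noteq> 0" if "c \<in> {0..1}" for c
      using that by (intro less_imp_neq[symmetric] pos_def_det pos_def_add pos_semidef_scaleR X Y) auto
    then have "continuous_on {0..1} (\<lambda>c. ln (det (mat 1 + c *\<^sub>R X + c *\<^sub>R Y)) / 2)"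
      by (intro continuous_intros) auto
    then have "((\<lambda>c. ln (det (mat 1 + c *\<^sub>R X + c *\<^sub>R Y)) / 2) \<longlongrightarrow> ln (det (mat 1 + 1 *\<^sub>R X + 1 *\<^sub>R Y)) / 2) (at 1 within {0..1})"
      unfolding continuous_on_def by (rule bspec) simp
    then show ?thesis
      by (simp add: at_within_Icc_at_left)
  qed
  have psd: "pos_semidef (H1 ** S1 ** transpose H1)" "pos_semidef (H2 ** S2 ** transpose H2)"
    "pos_semidef (H3 ** S1 ** transpose H3)" "pos_semidef (H4 ** S2 ** transpose H4)"
    by (intro pos_semidef_congruence S)+
  show ?thesis
    unfolding closure_approachable
  proof (intro allI impI)
    fix e :: real assume e: "0 < e"
    \<comment> \<open>Each rate moves by at most \<open>k\<close>, so a third of \<open>e\<close>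
      keeps the distance below \<open>e\<close>.\<close>
    define k where "k = e / 3"
    have k: "0 < k" using e by (simp add: k_def)
    define F1 where "F1 c = ln (det (mat 1 + c *\<^sub>R (H1 ** S1 ** transpose H1) + c *\<^sub>R 0)) / 2" for c
    define F2 where "F2 c = ln (det (mat 1 + c *\<^sub>R (H4 ** S2 ** transpose H4) + c *\<^sub>R 0)) / 2" for c
    define F12 where "F12 c = ln (det (mat 1 + c *\<^sub>R (H1 ** S1 ** transpose H1) + c *\<^sub>R (H2 ** S2 ** transpose H2))) / 2" for c
    define F21 where "F21 c = ln (det (mat 1 + c *\<^sub>R (H4 ** S2 ** transpose H4) + c *\<^sub>R (H3 ** S1 ** transpose H3))) / 2" for c
    have "eventually (\<lambda>c. R1 - k < F1 c) (at_left 1)"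
      unfolding F1_def by (rule order_tendstoD(1)[OF lim[OF psd(1) pos_semidef_0]]) (use b1 k in simp)
    moreover have "eventually (\<lambda>c. R2 - k < F2 c) (at_left 1)"
      unfolding F2_def by (rule order_tendstoD(1)[OF lim[OF psd(4) pos_semidef_0]]) (use b2 k in simp)
    moreover have "eventually (\<lambda>c. R1 + R2 - k < F12 c) (at_left 1)"
      unfolding F12_def by (rule order_tendstoD(1)[OF lim[OF psd(1,2)]]) (use b12 k in simp)
    moreover have "eventually (\<lambda>c. R1 + R2 - k < F21 c) (at_left 1)"
      unfolding F21_def by (rule order_tendstoD(1)[OF lim[OF psd(4,3)]]) (use b21 k in \<open>simp add: ac_simps\<close>)
    moreover have "eventually (\<lambda>c. c \<in> {0<..<1 :: real}) (at_left 1)"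
      by (rule eventually_at_left_real) simp
    ultimately have "eventually (\<lambda>c. R1 - k < F1 c \<and> R2 - k < F2 c \<and> R1 + R2 - k < F12 c \<and> R1 + R2 - k < F21 c \<and> c \<in> {0<..<1}) (at_left 1)"
      by eventually_elim simp
    then obtain c where c: "R1 - k < F1 c" "R2 - k < F2 c" "R1 + R2 - k < F12 c" "R1 + R2 - k < F21 c" "0 < c" "c < 1"
      using eventually_happens[of _ "at_left (1::real)"] by auto
    obtain G1 :: "real^'t^'t" where G1: "c *\<^sub>R S1 = G1 ** transpose G1"
      using pos_semidef_factor[OF pos_semidef_scaleR[OF S(1)]] c(5) by (metis less_imp_le)
    obtain G2 :: "real^'r^'r" where G2: "c *\<^sub>R S2 = G2 ** transpose G2"
      using pos_semidef_factor[OF pos_semidef_scaleR[OF S(2)]] c(5) by (metis less_imp_le)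
    define Q1 where "Q1 = max 0 (R1 - k)"
    define Q2 where "Q2 = max 0 (R2 - k)"
    have Q: "0 \<le> Q1" "0 \<le> Q2" by (simp_all add: Q1_def Q2_def)
    \<comment> \<open>If one of the reduced rates is positive, the sum has dropped by at least
      \<open>k\<close>. If both are cut off at 0 this can fail, which is why
      \<open>achievable_gaussian\<close> asks for the sum-rate bounds only under a positive
      rate.\<close>
    have Qs: "0 < Q1 \<Longrightarrow> Q1 + Q2 \<le> R1 + R2 - k" "0 < Q2 \<Longrightarrow> Q1 + Q2 \<le> R1 + R2 - k" "0 < Q1 \<Longrightarrow> Q1 = R1 - k" "0 < Q2 \<Longrightarrow> Q2 = R2 - k"
      using R k by (auto simp: Q1_def Q2_def max_def split: if_splits)
    have "achievable H1 H2 H3 H4 N P1 P2 Q1 Q2"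
    proof (rule achievable_gaussian[OF N Q, of G1 _ G2])
      show "trace (G1 ** transpose G1) < P1 \<or> G1 = 0 \<and> 0 \<le> P1"
        by (rule power_slack[OF S(1,3) _ _ G1]) (use c in auto)
      show "trace (G2 ** transpose G2) < P2 \<or> G2 = 0 \<and> 0 \<le> P2"
        by (rule power_slack[OF S(2,4) _ _ G2]) (use c in auto)
      show "Q1 < ln (det (mat 1 + H1 ** G1 ** transpose (H1 ** G1))) / 2" if "0 < Q1"
        unfolding gram_scaled_factor[OF G1] using c(1) Qs(3)[OF that] by (simp add: F1_def)
      show "Q2 < ln (det (mat 1 + H4 ** G2 ** transpose (H4 ** G2))) / 2" if "0 < Q2"
        unfolding gram_scaled_factor[OF G2] using c(2) Qs(4)[OF that] by (simp add: F2_def)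
      show "Q1 + Q2 < ln (det (mat 1 + H1 ** G1 ** transpose (H1 ** G1) + H2 ** G2 ** transpose (H2 ** G2))) / 2" if "0 < Q1"
        unfolding gram_scaled_factor[OF G1] gram_scaled_factor[OF G2] using c(3) Qs(1)[OF that] by (simp add: F12_def)
      show "Q2 + Q1 < ln (det (mat 1 + H4 ** G2 ** transpose (H4 ** G2) + H3 ** G1 ** transpose (H3 ** G1))) / 2" if "0 < Q2"
        unfolding gram_scaled_factor[OF G1] gram_scaled_factor[OF G2] using c(4) Qs(2)[OF that] by (simp add: F21_def)
    qed
    moreover have "dist (Q1, Q2) (R1, R2) < e"
    proof -
      have "dist (Q1, Q2) (R1, R2) \<le> dist Q1 R1 + dist Q2 R2"
        unfolding dist_Pair_Pair by (rule sqrt_sum_squares_le_sum) auto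
      also have "\<dots> \<le> k + k" using R k by (intro add_mono) (auto simp: dist_real_def Q1_def Q2_def max_def)
      also have "\<dots> < e" using e by (simp add: k_def)
      finally show ?thesis .
    qed
    ultimately show "\<exists>y\<in>{(R1, R2). achievable H1 H2 H3 H4 N P1 P2 R1 R2}. dist y (R1, R2) < e" by blast
  qed
qed

theorem theorem7:
  fixes H1 H3 :: "real^'t^'r" and H2 H4 :: "real^'r^'r"
    and N :: "((real^'r) \<times> (real^'r)) measure" and P1 P2 :: real
  assumes "noise_law N"
    and "invertible H2" and "invertible H4"
    and "transpose H2 ** H2 \<succeq> transpose H4 ** H4"
    and "transpose H3 ** H3 \<succeq> transpose H1 ** H1"
  shows "capacity_region H1 H2 H3 H4 N P1 P2 =
    (\<Union>(S1, S2) \<in> {(S1 :: real^'t^'t, S2 :: real^'r^'r).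
          pos_semidef S1 \<and> pos_semidef S2 \<and> trace S1 \<le> P1 \<and> trace S2 \<le> P2}.
       {(R1, R2). 0 \<le> R1 \<and> 0 \<le> R2 \<and>
          R1 \<le> 1/2 * ln (det (mat 1 + H1 ** S1 ** transpose H1)) \<and>
          R2 \<le> 1/2 * ln (det (mat 1 + H4 ** S2 ** transpose H4)) \<and>
          R1 + R2 \<le> 1/2 * ln (det (mat 1 + H1 ** S1 ** transpose H1 + H2 ** S2 ** transpose H2)) \<and>
          R1 + R2 \<le> 1/2 * ln (det (mat 1 + H3 ** S1 ** transpose H3 + H4 ** S2 ** transpose H4))})"
proof -
  let ?A = "{(R1, R2). achievable H1 H2 H3 H4 N P1 P2 R1 R2}"
  have "closure ?A \<subseteq> rate_region H1 H2 H3 H4 P1 P2"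
    using achievable_imp_rate_region[OF assms(1,4,5)] by (intro closure_minimal closed_rate_region) auto
  moreover have "rate_region H1 H2 H3 H4 P1 P2 \<subseteq> closure ?A"
    using rate_region_subset_closure[OF assms(1)] by fast
  ultimately show ?thesis
    unfolding capacity_region_def rate_region_def by blast
qed

end
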